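(* Let $R$ be a commutative local ring in which $2$ is invertible, let $R[X]$ be the polynomial ring in one variable over $R$, and let $r\ge 2$. Then the group $SUm_r(R[X])/EUm_r(R[X])$ is abelian.
   Context: Let $B$ be a commutative ring with $1$. For row vectors $v=(a_0,a_1,\dots,a_r)=(a_0,v_1)$ and $w=(b_0,b_1,\dots,b_r)=(b_0,w_1)$ in $B^{r+1}$, where $v_1=(a_1,\dots,a_r)$ and $w_1=(b_1,\dots,b_r)$, the Suslin matrix $S_r(v,w)\in M_{2^r}(B)$ is defined inductively by $S_0(v,w)=a_0$ and $$S_r(v,w)=\begin{pmatrix} a_0 I_{2^{r-1}} & S_{r-1}(v_1,w_1)\\ -S_{r-1}(w_1,v_1)^T & b_0 I_{2^{r-1}}\end{pmatrix}.$$ Put $\langle v,w\rangle=v\cdot w^T$. If $\langle v,w\rangle=1$ then $S_r(v,w)$ is invertible. $SUm_r(B)$ is the subgroup of $GL_{2^r}(B)$ generated by all $S_r(v,w)$ with $v,w\in B^{r+1}$, $\langle v,w\rangle=1$. $EUm_r(B)$ is the subgroup generated by those $S_r(v,w)$ with $\langle v,w\rangle=1$ and $v=e_1\varepsilon$ for some $\varepsilon\in E_{r+1}(B)$, where $e_1=(1,0,\dots,0)$ and $E_{r+1}(B)$ is the group generated by elementary matrices. It is known (Jose--Rao) that $EUm_r(B)$ is a normal subgroup of $SUm_r(B)$ for $r\ge 2$ when $2$ is invertible in $B$. *)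

theory Defs
  imports
    "Jordan_Normal_Form.VS_Connect"
    "Jordan_Normal_Form.Gauss_Jordan_Elimination"
    "HOL-Algebra.Generated_Groups"
    "HOL-Algebra.Ideal"
begin

definition local_ring :: "'a :: comm_ring_1 itself \<Rightarrow> bool" where
  "local_ring _ \<longleftrightarrow> (\<exists>!M. maximalideal M (class_ring :: 'a ring))"

definition GL :: "nat \<Rightarrow> 'a :: comm_ring_1 mat monoid" where
  "GL n = units_of (ring_mat TYPE('a) n ())"

definition elem_group :: "nat \<Rightarrow> 'a :: comm_ring_1 mat set" where
  "elem_group n = generate (GL n) {addrow_mat n a i j | a i j. i < n \<and> j < n \<and> i \<noteq> j}"

text \<open>Rows \<open>v = (a\<^sub>0, \<dots>, a\<^sub>r)\<close> are vectors of dimension \<open>r + 1\<close>, so that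
  \<open>vec_last v (Suc r)\<close> removes the first entry of a row of dimension \<open>r + 2\<close>.\<close>

fun suslin :: "nat \<Rightarrow> 'a :: comm_ring_1 vec \<Rightarrow> 'a vec \<Rightarrow> 'a mat" where
  "suslin 0 v w = mat 1 1 (\<lambda>_. v $ 0)"
| "suslin (Suc r) v w =
    four_block_mat
      (v $ 0 \<cdot>\<^sub>m 1\<^sub>m (2 ^ r))
      (suslin r (vec_last v (Suc r)) (vec_last w (Suc r)))
      (- transpose_mat (suslin r (vec_last w (Suc r)) (vec_last v (Suc r))))
      (w $ 0 \<cdot>\<^sub>m 1\<^sub>m (2 ^ r))"

definition SUm :: "nat \<Rightarrow> 'a :: comm_ring_1 mat set" where
  "SUm r = generate (GL (2 ^ r))
    {suslin r v w | v w. v \<in> carrier_vec (r + 1) \<and> w \<in> carrier_vec (r + 1) \<and> v \<bullet> w = 1}"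

definition EUm :: "nat \<Rightarrow> 'a :: comm_ring_1 mat set" where
  "EUm r = generate (GL (2 ^ r))
    {suslin r v w | v w. v \<in> carrier_vec (r + 1) \<and> w \<in> carrier_vec (r + 1) \<and> v \<bullet> w = 1 \<and>
      (\<exists>\<epsilon> \<in> elem_group (r + 1). mat_of_row v = mat_of_row (unit_vec (r + 1) 0) * \<epsilon>)}"

lemma suslin_carrier: "suslin r v w \<in> carrier_mat (2 ^ r) (2 ^ r)"
proof (induction r arbitrary: v w)
  case (Suc r)
  have "four_block_mat
      (v $ 0 \<cdot>\<^sub>m 1\<^sub>m (2 ^ r))
      (suslin r (vec_last v (Suc r)) (vec_last w (Suc r)))
      (- transpose_mat (suslin r (vec_last w (Suc r)) (vec_last v (Suc r))))
      (w $ 0 \<cdot>\<^sub>m 1\<^sub>m (2 ^ r)) \<in> carrier_mat (2 ^ r + 2 ^ r) (2 ^ r + 2 ^ r)"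
    by (rule four_block_carrier_mat) auto
  then show ?case by (simp add: mult_2)
qed simp

lemma scalar_prod_vec_last:
  fixes v w :: "'a :: comm_ring_1 vec"
  assumes "v \<in> carrier_vec (Suc n)" "w \<in> carrier_vec (Suc n)"
  shows "v \<bullet> w = v $ 0 * w $ 0 + vec_last v n \<bullet> vec_last w n"
  using assms unfolding scalar_prod_def vec_last_def
  by (simp add: sum.atLeast0_lessThan_Suc_shift del: sum.op_ivl_Suc)

lemma smult_one_mat: "(a :: 'a :: comm_ring_1) \<cdot>\<^sub>m 1\<^sub>m n + b \<cdot>\<^sub>m 1\<^sub>m n = (a + b) \<cdot>\<^sub>m 1\<^sub>m n"
  by (rule eq_matI) auto

lemma four_block_smult_one:
  "four_block_mat (c \<cdot>\<^sub>m 1\<^sub>m n) (0\<^sub>m n n) (0\<^sub>m n n) (c \<cdot>\<^sub>m 1\<^sub>m n)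
    = (c :: 'a :: comm_ring_1) \<cdot>\<^sub>m 1\<^sub>m (n + n)"
  by (rule eq_matI) auto

lemma suslin_mult_transpose:
  fixes v w :: "'a :: comm_ring_1 vec"
  assumes "v \<in> carrier_vec (r + 1)" "w \<in> carrier_vec (r + 1)"
  shows "suslin r v w * transpose_mat (suslin r w v) = (v \<bullet> w) \<cdot>\<^sub>m 1\<^sub>m (2 ^ r)
       \<and> transpose_mat (suslin r w v) * suslin r v w = (v \<bullet> w) \<cdot>\<^sub>m 1\<^sub>m (2 ^ r)"
  using assms
proof (induction r arbitrary: v w)
  case 0
  then have "v \<bullet> w = v $ 0 * w $ 0" by (simp add: scalar_prod_def)
  then show ?case
    by (auto intro!: eq_matI simp: scalar_prod_def ac_simps)
next
  case (Suc r)
  let ?n = "2 ^ r :: nat"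
  define a b v' w' where "a = v $ 0" and "b = w $ 0"
    and "v' = vec_last v (Suc r)" and "w' = vec_last w (Suc r)"
  define S T where "S = suslin r v' w'" and "T = transpose_mat (suslin r w' v')"
  have S: "S \<in> carrier_mat ?n ?n" and T: "T \<in> carrier_mat ?n ?n"
    unfolding S_def T_def using suslin_carrier by auto
  have I: "x \<cdot>\<^sub>m 1\<^sub>m ?n \<in> carrier_mat ?n ?n" for x :: 'a by simp
  have IH: "S * T = (v' \<bullet> w') \<cdot>\<^sub>m 1\<^sub>m ?n" "T * S = (v' \<bullet> w') \<cdot>\<^sub>m 1\<^sub>m ?n"
    using Suc.IH[of v' w'] unfolding S_def T_def v'_def w'_def by auto
  have vw: "v \<bullet> w = a * b + v' \<bullet> w'"
    using scalar_prod_vec_last[of v "Suc r" w] Suc.prems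
    by (simp add: a_def b_def v'_def w'_def)
  have eq1: "suslin (Suc r) v w = four_block_mat (a \<cdot>\<^sub>m 1\<^sub>m ?n) S (- T) (b \<cdot>\<^sub>m 1\<^sub>m ?n)"
    by (simp add: a_def b_def v'_def w'_def S_def T_def)
  have "transpose_mat (suslin (Suc r) w v) =
      four_block_mat (transpose_mat (b \<cdot>\<^sub>m 1\<^sub>m ?n)) (transpose_mat (- transpose_mat S))
        (transpose_mat (suslin r w' v')) (transpose_mat (a \<cdot>\<^sub>m 1\<^sub>m ?n))"
    using S suslin_carrier[of r w' v']
    by (simp add: a_def b_def v'_def w'_def S_def
        transpose_four_block_mat[of _ ?n ?n _ ?n _ ?n])
  also have "\<dots> = four_block_mat (b \<cdot>\<^sub>m 1\<^sub>m ?n) (- S) T (a \<cdot>\<^sub>m 1\<^sub>m ?n)"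
    using S T by (intro arg_cong4[of _ _ _ _ _ _ _ _ four_block_mat])
      (auto intro!: eq_matI simp: T_def)
  finally have eq2: "transpose_mat (suslin (Suc r) w v) =
      four_block_mat (b \<cdot>\<^sub>m 1\<^sub>m ?n) (- S) T (a \<cdot>\<^sub>m 1\<^sub>m ?n)" .
  have sm: "(x \<cdot>\<^sub>m 1\<^sub>m ?n) * M = x \<cdot>\<^sub>m M" "M * (x \<cdot>\<^sub>m 1\<^sub>m ?n) = x \<cdot>\<^sub>m M"
    if "M \<in> carrier_mat ?n ?n" for x :: 'a and M
    using that by auto
  have neg: "M * (- N) = - (M * N)" "(- M) * N = - (M * N)"
    if "M \<in> carrier_mat ?n ?n" "N \<in> carrier_mat ?n ?n" for M N :: "'a mat"
    using that by auto
  have canc: "x \<cdot>\<^sub>m M + x \<cdot>\<^sub>m (- M) = 0\<^sub>m ?n ?n" "x \<cdot>\<^sub>m (- M) + x \<cdot>\<^sub>m M = 0\<^sub>m ?n ?n"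
    if "M \<in> carrier_mat ?n ?n" for x :: 'a and M
    using that by (auto intro!: eq_matI)
  have diag: "(x \<cdot>\<^sub>m 1\<^sub>m ?n) * (y \<cdot>\<^sub>m 1\<^sub>m ?n) = (x * y) \<cdot>\<^sub>m 1\<^sub>m ?n" for x y :: 'a
    by (subst sm) (auto intro!: eq_matI)
  have nn: "- (- (M :: 'a mat)) = M" for M by (rule eq_matI) auto
  have smi: "x \<cdot>\<^sub>m (1\<^sub>m ?n) + y \<cdot>\<^sub>m (1\<^sub>m ?n) = (x + y) \<cdot>\<^sub>m 1\<^sub>m ?n" for x y :: 'a
    by (rule smult_one_mat)
  have mS: "- S \<in> carrier_mat ?n ?n" and mT: "- T \<in> carrier_mat ?n ?n"
    using S T by auto
  have "suslin (Suc r) v w * transpose_mat (suslin (Suc r) w v)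
      = four_block_mat ((v \<bullet> w) \<cdot>\<^sub>m 1\<^sub>m ?n) (0\<^sub>m ?n ?n) (0\<^sub>m ?n ?n) ((v \<bullet> w) \<cdot>\<^sub>m 1\<^sub>m ?n)"
    unfolding eq1 eq2
    by (subst mult_four_block_mat[OF I S mT I I mS T I])
      (simp add: sm[OF S] sm[OF T] sm[OF mS] sm[OF mT] neg[OF T S] neg[OF mT S] neg[OF T mS]
        neg[OF mT mS] canc[OF S] canc[OF T] diag IH nn smi vw ac_simps)
  moreover have "transpose_mat (suslin (Suc r) w v) * suslin (Suc r) v w
      = four_block_mat ((v \<bullet> w) \<cdot>\<^sub>m 1\<^sub>m ?n) (0\<^sub>m ?n ?n) (0\<^sub>m ?n ?n) ((v \<bullet> w) \<cdot>\<^sub>m 1\<^sub>m ?n)"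
    unfolding eq1 eq2
    by (subst mult_four_block_mat[OF I mS T I I S mT I])
      (simp add: sm[OF S] sm[OF T] sm[OF mS] sm[OF mT] neg[OF S T] neg[OF mS T] neg[OF S mT]
        neg[OF mS mT] canc[OF S] canc[OF T] diag IH nn smi vw ac_simps)
  ultimately show ?case
    by (simp add: four_block_smult_one mult_2 del: suslin.simps)
qed

lemma suslin_in_GL:
  fixes v w :: "'a :: comm_ring_1 vec"
  assumes "v \<in> carrier_vec (r + 1)" "w \<in> carrier_vec (r + 1)" "v \<bullet> w = 1"
  shows "suslin r v w \<in> carrier (GL (2 ^ r))"
proof -
  have "(1 :: 'a) \<cdot>\<^sub>m 1\<^sub>m (2 ^ r) = 1\<^sub>m (2 ^ r)"
    by (rule eq_matI) auto
  then show ?thesis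
    using suslin_mult_transpose[OF assms(1,2)] assms(3)
      suslin_carrier[of r v w] suslin_carrier[of r w v]
    unfolding GL_def units_of_def Units_def ring_mat_def
    by (auto intro!: bexI[of _ "transpose_mat (suslin r w v)"])
qed

lemma group_GL: "group (GL n :: 'a :: comm_ring_1 mat monoid)"
proof -
  interpret R: ring "ring_mat TYPE('a) n ()" by (rule ring_mat)
  show ?thesis unfolding GL_def by (rule R.units_group)
qed

lemma subgroup_SUm: "subgroup (SUm r) (GL (2 ^ r) :: 'a :: comm_ring_1 mat monoid)"
  unfolding SUm_def
  by (rule group.generate_is_subgroup[OF group_GL]) (auto intro: suslin_in_GL)

lemma subgroup_EUm: "subgroup (EUm r) (GL (2 ^ r) :: 'a :: comm_ring_1 mat monoid)"
  unfolding EUm_def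
  by (rule group.generate_is_subgroup[OF group_GL]) (auto intro: suslin_in_GL)

lemma EUm_subset_SUm: "EUm r \<subseteq> (SUm r :: 'a :: comm_ring_1 mat set)"
  unfolding EUm_def SUm_def
  by (rule group.mono_generate[OF group_GL]) auto

lemma addrow_mat_in_GL:
  assumes "i < n" "j < n" "i \<noteq> j"
  shows "addrow_mat n (a :: 'a :: comm_ring_1) i j \<in> carrier (GL n)"
proof -
  have "addrow_mat n a i j * addrow_mat n (- a) i j = 1\<^sub>m n"
    if "i < n" "j < n" "i \<noteq> j" for a :: 'a
    using that by (subst addrow_mat[symmetric, of _ n n]) (auto intro!: eq_matI)
  from this[OF assms, of a] this[OF assms, of "- a"] assms show ?thesis
    unfolding GL_def units_of_def Units_def ring_mat_def
    by (auto intro!: bexI[of _ "addrow_mat n (- a) i j"])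
qed

end

theory Submission
  imports Defs "HOL-Computational_Algebra.Polynomial_FPS"
begin

text \<open>Suslin matrices are the odd elements of a Clifford algebra: with \<open>S\<close> the Suslin matrix of a
  pair \<open>x = (v, w)\<close> and \<open>S'\<close> its conjugate, \<open>S x * S' x\<close> is the scalar \<open>\<langle>v, w\<rangle>\<close>. If \<open>1/2\<close> exists,
  \<open>EUm\<close> is the group \<open>E\<close> generated by the root elements \<open>1 + c * g i * g' j\<close>, where \<open>g i\<close> is the image of
  the \<open>i\<close>-th basis vector. Conjugating a root element by \<open>S s\<close> gives an explicit word in root elements
  whose coefficients are polynomials in the entries of \<open>s\<close>; hence \<open>E\<close> is normal. If the entry \<open>a = t 0\<close> is
  inverted, then \<open>S t\<close> itself is a word in root elements with denominator \<open>a\<close>. Comparing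
  the words for \<open>S s * S t * S' s\<close> and \<open>S s' * S t * S' s'\<close> shows that \<open>S' s' * S s\<close> commutes with \<open>S t\<close>
  modulo \<open>E\<close> as soon as \<open>s\<close> and \<open>s'\<close> agree modulo a high power of \<open>a\<close>.

  Over \<open>R[X]\<close> deform \<open>s(X)\<close> to \<open>s(0)\<close> through \<open>s(X d)\<close>. The increments of \<open>d\<close> that do not change the class
  of the commutator with \<open>S t\<close> form an ideal, which contains powers of comaximal entries of
  elementary transforms of \<open>t\<close>, hence \<open>1\<close>; and \<open>S (s(0))\<close> lies in \<open>E\<close> because \<open>R\<close> is local. The
  entries used have a unit as constant term, so they are invertible in \<open>R[[X]]\<close>, which
  replaces the localizations of \<open>R[X]\<close>.\<close>

section \<open>Root elements in a Clifford algebra\<close>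

text \<open>The obstacle that shapes the proof: once \<open>a = t 0\<close> is inverted,
  \<open>S t\<close> is a word in root elements with denominators, and conjugation by such elements
  does not preserve the root group over R[X]. It does so after giving up some powers of
  \<open>a\<close>, and the loss is controlled only by the number of root elements used. Therefore
  every conjugate is kept as an explicit word whose length does not depend on \<open>s\<close>; the
  exponent of \<open>a\<close> can then be fixed before \<open>s\<close> and \<open>s'\<close> are
  known, and the congruence of \<open>s\<close> and \<open>s'\<close> is tracked coefficient by
  coefficient.

  Words with and without denominators must be compared in one ring. So all coefficients live in a
  large ring (later R[[X]]) with a distinguished subset \<open>P\<close> (the image of R[X]), and
  injectivity of R[X] in R[[X]] brings the result back to matrices.

  The condition \<open>r \<ge> 2\<close> gives a third hyperbolic pair, through which the awkward
  roots are written as commutators. The unit 2 enters twice: in showing that \<open>EUm\<close>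
  contains every root element, and in choosing between \<open>t 0 + t i\<close> and
  \<open>t 0 - t i\<close> an entry with unit constant term.\<close>

lemma hyperbolic_commutator:
  fixes X X' Y Y' K K' L L' :: "'m::ring_1"
  assumes K: "K * K' = 0" "K' * L + L' * K = 1"
    and X: "X * X' = 0" "X' * K = - (K' * X)" "X * L' = - (L * X')" "X' * Y = - (Y' * X)"
    and Y: "Y * Y' = 0" "Y' * X = - (X' * Y)" "Y * K' = - (K * Y')" "Y' * L = - (L' * Y)"
    and L: "L * L' = 0" and XK: "K' * X = - (X' * K)"
  shows "(1 + X * K') * (1 + L * Y') * (1 - X * K') * (1 - L * Y') = 1 + X * Y'"
proof -
  \<comment> \<open>\<open>A\<close> and \<open>B\<close> have square zero,
    \<open>A * B - B * A\<close> is \<open>X * Y'\<close> because the middle factor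
    \<open>K' * L + L' * K\<close> is 1, and \<open>A * B * A\<close> and \<open>B * A * B\<close>
    vanish. So the group commutator is 1 plus the ring commutator. \<open>X\<close> and
    \<open>Y\<close> may be combinations of basis vectors, which \<open>conj_word\<close>
    exploits.\<close>
  define A B where "A = X * K'" and "B = L * Y'"
  have AA: "A * A = 0"
  proof -
    have "A * A = X * (K' * X) * K'" by (simp add: A_def mult.assoc)
    also have "\<dots> = - ((X * X') * (K * K'))" by (simp add: XK mult.assoc)
    finally show ?thesis by (simp add: X)
  qed
  have BB: "B * B = 0"
  proof -
    have "B * B = L * (Y' * L) * Y'" by (simp add: B_def mult.assoc)
    also have "\<dots> = - ((L * L') * (Y * Y'))" by (simp add: Y(4) mult.assoc)
    finally show ?thesis by (simp add: Y)
  qed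
  have com: "A * B - B * A = X * Y'"
  proof -
    have "B * A = L * (Y' * X) * K'" by (simp add: A_def B_def mult.assoc)
    also have "\<dots> = - (L * X') * (Y * K')" by (simp add: Y(2) mult.assoc)
    also have "\<dots> = - (X * (L' * K) * Y')" by (simp add: X(3)[symmetric] Y(3) mult.assoc)
    finally have "A * B - B * A = X * (K' * L + L' * K) * Y'"
      by (simp add: A_def B_def mult.assoc algebra_simps)
    then show ?thesis by (simp add: K)
  qed
  have ABA: "A * (B * A) = 0"
  proof -
    have "A * (A * B - B * A) = X * (K' * X) * Y'" unfolding com by (simp add: A_def mult.assoc)
    also have "\<dots> = - ((X * X') * (K * Y'))" by (simp add: XK mult.assoc)
    finally have "A * A * B - A * (B * A) = 0" by (simp add: X right_diff_distrib mult.assoc)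
    then show ?thesis by (simp add: AA)
  qed
  have BAB: "B * (A * B) = 0"
  proof -
    have "(A * B - B * A) * B = X * (Y' * L) * Y'" unfolding com by (simp add: B_def mult.assoc)
    also have "\<dots> = - (X * L' * (Y * Y'))" by (simp add: Y(4) mult.assoc)
    finally have "A * (B * B) - B * (A * B) = 0" by (simp add: Y left_diff_distrib mult.assoc)
    then show ?thesis by (simp add: BB)
  qed
  have AAZ: "A * (A * Z) = 0" for Z by (simp add: AA mult.assoc[symmetric])
  have BBZ: "B * (B * Z) = 0" for Z by (simp add: BB mult.assoc[symmetric])
  have "(1 + A) * (1 + B) * (1 - A) * (1 - B) = 1 + (A * B - B * A)"
    by (simp add: distrib_left distrib_right left_diff_distrib right_diff_distrib
        AA BB ABA BAB AAZ BBZ mult.assoc)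
  then show ?thesis unfolding com by (simp add: A_def B_def)
qed

section \<open>Dual indices and coefficient ideals\<close>

definition star :: "nat \<Rightarrow> nat \<Rightarrow> nat" where
  "star n i = (if i < n then i + n else i - n)"

lemma star_lt [simp]: "i < 2 * n \<Longrightarrow> star n i < 2 * n"
  and star_star [simp]: "i < 2 * n \<Longrightarrow> star n (star n i) = i"
  and star_neq [simp]: "i < 2 * n \<Longrightarrow> star n i \<noteq> i" "i < 2 * n \<Longrightarrow> i \<noteq> star n i"
  by (auto simp: star_def)

lemma star_eq_iff [simp]: "i < 2 * n \<Longrightarrow> j < 2 * n \<Longrightarrow> star n i = star n j \<longleftrightarrow> i = j"
  by (metis star_star)

lemma star_swap: "i < 2 * n \<Longrightarrow> j < 2 * n \<Longrightarrow> j = star n i \<longleftrightarrow> i = star n j"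
  by (metis star_star)

text \<open>A predicate on sets rather than a ring of its own: the elements of \<open>P\<close> have
  to be multiplied with inverses that exist only in the surrounding ring.\<close>

definition subring_set :: "'f::comm_ring_1 set \<Rightarrow> bool" where
  "subring_set P \<longleftrightarrow> 1 \<in> P \<and> (\<forall>x\<in>P. \<forall>y\<in>P. x + y \<in> P \<and> x * y \<in> P) \<and> (\<forall>x\<in>P. - x \<in> P)"

lemma subring_setD:
  assumes "subring_set P"
  shows "0 \<in> P" "1 \<in> P" "x \<in> P \<Longrightarrow> y \<in> P \<Longrightarrow> x + y \<in> P" "x \<in> P \<Longrightarrow> y \<in> P \<Longrightarrow> x * y \<in> P"
    "x \<in> P \<Longrightarrow> - x \<in> P" "x \<in> P \<Longrightarrow> y \<in> P \<Longrightarrow> x - y \<in> P"  "x \<in> P \<Longrightarrow> x ^ k \<in> P"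
proof -
  have 1: "1 \<in> P" and a: "x \<in> P \<Longrightarrow> y \<in> P \<Longrightarrow> x + y \<in> P" and m: "x \<in> P \<Longrightarrow> y \<in> P \<Longrightarrow> x * y \<in> P"
    and u: "x \<in> P \<Longrightarrow> - x \<in> P" for x y using assms by (auto simp: subring_set_def)
  show "0 \<in> P" using a[OF 1 u[OF 1]] by simp
  show "x \<in> P \<Longrightarrow> y \<in> P \<Longrightarrow> x - y \<in> P" using a[of x "- y"] u[of y] by simp
  show "x \<in> P \<Longrightarrow> x ^ k \<in> P" by (induction k) (auto simp: 1 m)
qed (use assms in \<open>auto simp: subring_set_def\<close>)

text \<open>The ideal a^N P of \<open>P\<close>; the exponent \<open>N\<close> measures how many
  denominators a coefficient can still absorb.\<close>

definition pow_mult :: "'f::comm_ring_1 set \<Rightarrow> 'f \<Rightarrow> nat \<Rightarrow> 'f set" where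
  "pow_mult P a N = (\<lambda>x. a ^ N * x) ` P"

lemma pow_multI: "p \<in> P \<Longrightarrow> a ^ N * p \<in> pow_mult P a N" by (auto simp: pow_mult_def)

lemma pow_mult_mono:
  assumes "subring_set P" "a \<in> P" "M \<le> N" shows "pow_mult P a N \<subseteq> pow_mult P a M"
proof
  fix x assume "x \<in> pow_mult P a N"
  then obtain p where p: "p \<in> P" "x = a ^ N * p" by (auto simp: pow_mult_def)
  then have "x = a ^ M * (a ^ (N - M) * p)" using assms(3) by (simp add: mult.assoc[symmetric] power_add[symmetric])
  then show "x \<in> pow_mult P a M" using p assms by (auto intro!: pow_multI intro: subring_setD)
qed

lemma pow_mult_sub: "subring_set P \<Longrightarrow> a \<in> P \<Longrightarrow> pow_mult P a N \<subseteq> P"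
  by (auto simp: pow_mult_def intro!: subring_setD(4) subring_setD(7))

lemma pow_mult_uminus: "subring_set P \<Longrightarrow> x \<in> pow_mult P a N \<Longrightarrow> - x \<in> pow_mult P a N"
  by (auto simp: pow_mult_def image_iff intro!: bexI[of _ "- _"] subring_setD)

text \<open>Of the \<open>M + K\<close> factors \<open>a\<close> in \<open>c\<close>,
  \<open>K\<close> clear the denominator of \<open>u\<close> and \<open>M\<close> are left.\<close>

lemma pow_mult_scaled:
  assumes "subring_set P" "a \<in> P" "c \<in> pow_mult P a (M + K)" "a ^ K * u \<in> P"
  shows "c * u \<in> pow_mult P a M"
proof -
  obtain p where p: "p \<in> P" "c = a ^ (M + K) * p" using assms(3) by (auto simp: pow_mult_def)
  then have "c * u = a ^ M * (p * (a ^ K * u))" by (simp add: power_add algebra_simps)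
  then show ?thesis using p assms by (auto intro!: pow_multI intro: subring_setD(4))
qed

lemma pow_mult_mult: "subring_set P \<Longrightarrow> x \<in> pow_mult P a N \<Longrightarrow> y \<in> P \<Longrightarrow> y * x \<in> pow_mult P a N"
  by (auto simp: pow_mult_def image_iff mult.left_commute intro!: bexI[of _ "y * _"] subring_setD(4))

lemma pow_mult_add: "subring_set P \<Longrightarrow> x \<in> pow_mult P a N \<Longrightarrow> y \<in> pow_mult P a N \<Longrightarrow> x + y \<in> pow_mult P a N"
  by (auto simp: pow_mult_def image_iff distrib_left[symmetric] intro!: bexI subring_setD(3))

text \<open>The index \<open>i < n\<close> stands for the \<open>i\<close>-th coordinate of \<open>v\<close> and \<open>i + n\<close> for that of \<open>w\<close>; \<open>star n i\<close> is
  the index dual to \<open>i\<close> for the form \<open>\<langle>v, w\<rangle>\<close>.\<close>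

locale clifford =
  fixes n :: nat
    and smul :: "'f::comm_ring_1 \<Rightarrow> 'm::ring_1 \<Rightarrow> 'm"  (infixr "\<star>" 75)
    and g g' :: "nat \<Rightarrow> 'm"
  assumes n3: "3 \<le> n"
    and smul_add_right: "c \<star> (x + y) = c \<star> x + c \<star> y"
    and smul_add_left: "(c + d) \<star> x = c \<star> x + d \<star> x"
    and smul_smul [simp]: "c \<star> d \<star> x = (c * d) \<star> x"
    and smul_one [simp]: "1 \<star> x = x"
    and smul_mult_left [simp]: "(c \<star> x) * y = c \<star> (x * y)"
    and smul_mult_right [simp]: "x * (c \<star> y) = c \<star> (x * y)"
    and rel: "i < 2 * n \<Longrightarrow> j < 2 * n \<Longrightarrow> g i * g' j + g j * g' i = (if j = star n i then 1 else 0)"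
    and rel': "i < 2 * n \<Longrightarrow> j < 2 * n \<Longrightarrow> g' i * g j + g' j * g i = (if j = star n i then 1 else 0)"
    and iso [simp]: "i < 2 * n \<Longrightarrow> g i * g' i = 0" "i < 2 * n \<Longrightarrow> g' i * g i = 0"
    and g'_0: "g' 0 = g n" and g'_n: "g' n = g 0"
    and g'_other: "i < 2 * n \<Longrightarrow> i \<noteq> 0 \<Longrightarrow> i \<noteq> n \<Longrightarrow> g' i = - g i"
    and g_sum: "g 0 + g n = 1"
begin

text \<open>The axioms are symmetric in \<open>g\<close> and \<open>g'\<close>. Facts about
  \<open>root_elt'\<close> and \<open>S'\<close> are those about \<open>root_elt\<close> and
  \<open>S\<close> in this second instance.\<close>

lemma dual: "clifford n smul g' g"
proof
  show "i < 2 * n \<Longrightarrow> i \<noteq> 0 \<Longrightarrow> i \<noteq> n \<Longrightarrow> g i = - g' i" for i by (simp add: g'_other)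
  show "g' 0 + g' n = 1" using g_sum by (simp add: g'_0 g'_n add.commute)
qed (use n3 rel rel' g'_0 g'_n in \<open>auto simp: smul_add_right smul_add_left\<close>)

lemma smul_zero_right [simp]: "c \<star> 0 = 0" using smul_add_right[of c 0 0] by simp
lemma smul_zero_left [simp]: "0 \<star> x = 0" using smul_add_left[of 0 0 x] by simp
lemma smul_minus_right [simp]: "c \<star> (- x) = - (c \<star> x)"
  using smul_add_right[of c x "- x"] by (simp add: eq_neg_iff_add_eq_0 add.commute)
lemma smul_minus_left [simp]: "(- c) \<star> x = - (c \<star> x)"
  using smul_add_left[of c "- c" x] by (simp add: eq_neg_iff_add_eq_0 add.commute)
lemma smul_diff_right: "c \<star> (x - y) = c \<star> x - c \<star> y"
  using smul_add_right[of c x "- y"] by simp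
lemma smul_diff_left: "(c - d) \<star> x = c \<star> x - d \<star> x"
  using smul_add_left[of c "- d" x] by simp
lemma smul_sum_right: "c \<star> sum f A = (\<Sum>i\<in>A. c \<star> f i)"
  by (induction A rule: infinite_finite_induct) (auto simp: smul_add_right)

lemmas smul_simps = smul_add_right smul_add_left smul_diff_right smul_diff_left

section \<open>Root elements and the group they generate\<close>

lemma anticommute: "i < 2 * n \<Longrightarrow> j < 2 * n \<Longrightarrow> j \<noteq> star n i \<Longrightarrow> g i * g' j = - (g j * g' i)"
  using rel[of i j] by (simp add: eq_neg_iff_add_eq_0)
lemma anticommute': "i < 2 * n \<Longrightarrow> j < 2 * n \<Longrightarrow> j \<noteq> star n i \<Longrightarrow> g' i * g j = - (g' j * g i)"
  using rel'[of i j] by (simp add: eq_neg_iff_add_eq_0)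

definition root_pair :: "nat \<Rightarrow> nat \<Rightarrow> bool" where
  "root_pair i j \<longleftrightarrow> i < 2 * n \<and> j < 2 * n \<and> j \<noteq> star n i"

lemma root_pair_sym: "root_pair i j \<Longrightarrow> root_pair j i" unfolding root_pair_def by (metis star_star)

definition root_elt :: "nat \<Rightarrow> 'f \<Rightarrow> nat \<Rightarrow> 'm" where "root_elt i c j = 1 + c \<star> (g i * g' j)"

lemma root_pair_sq: assumes "root_pair i j" shows "g i * g' j * (g i * g' j) = 0"
proof -
  have "g i * g' j * (g i * g' j) = g i * (g' j * g i) * g' j" by (simp add: mult.assoc)
  also have "\<dots> = - ((g i * g' i) * (g j * g' j))"
    using assms root_pair_sym[OF assms] by (subst anticommute') (auto simp: root_pair_def mult.assoc)
  finally show ?thesis using assms by (simp add: root_pair_def)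
qed

lemma root_elt_add: "root_pair i j \<Longrightarrow> root_elt i c j * root_elt i d j = root_elt i (c + d) j"
  using root_pair_sq[of i j] by (simp add: root_elt_def algebra_simps smul_add_left)

lemma root_elt_zero [simp]: "root_elt i 0 j = 1" by (simp add: root_elt_def)
lemma root_elt_same [simp]: "i < 2 * n \<Longrightarrow> root_elt i c i = 1" by (simp add: root_elt_def)

lemma root_elt_inv [simp]: "root_pair i j \<Longrightarrow> root_elt i c j * root_elt i (- c) j = 1" "root_pair i j \<Longrightarrow> root_elt i (- c) j * root_elt i c j = 1"
  by (simp_all add: root_elt_add)

lemma root_elt_swap: assumes "root_pair i j" shows "root_elt i c j = root_elt j (- c) i"
  using assms by (simp add: root_elt_def root_pair_def anticommute[of i j])

text \<open>The Steinberg relation through the hyperbolic pair of \<open>k\<close>. Read from right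
  to left it splits the coefficient of a root element over two roots that involve
  \<open>k\<close>.\<close>

lemma root_elt_commutator:
  assumes k: "k < 2 * n" and pq: "root_pair p q" "p \<noteq> k" "p \<noteq> star n k" "q \<noteq> k" "q \<noteq> star n k"
  shows "root_elt p c k * root_elt (star n k) d q * root_elt p (- c) k * root_elt (star n k) (- d) q = root_elt p (c * d) q"
proof -
  have pq': "p < 2 * n" "q < 2 * n" "q \<noteq> star n p" "p \<noteq> star n q"
    using pq root_pair_sym[of p q] by (auto simp: root_pair_def)
  have s: "star n k \<noteq> star n p" "k \<noteq> star n p" "star n k \<noteq> star n q" "k \<noteq> star n q"
    using k pq pq' by (auto simp: star_swap[of p n k])
  have "(1 + (c \<star> g p) * g' k) * (1 + g (star n k) * (d \<star> g' q)) * (1 - (c \<star> g p) * g' k) * (1 - g (star n k) * (d \<star> g' q))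
    = 1 + (c \<star> g p) * (d \<star> g' q)"
    by (rule hyperbolic_commutator[where X' = "c \<star> g' p" and Y = "d \<star> g q" and L' = "g' (star n k)" and K = "g k"])
      (use k pq' rel'[of k "star n k"] anticommute[of p "star n k"] anticommute'[of p k]
        anticommute[of q k] anticommute'[of q "star n k"] anticommute'[of p q] anticommute'[of q p] anticommute'[of k p] pq(2-5) s in \<open>simp_all add: mult.commute[of d c]\<close>)
  then show ?thesis by (simp add: root_elt_def mult.commute)
qed

lemma root_pair_mid: assumes "root_pair p q" shows "g p * (g' q * g p) = 0" "g' p * (g q * g' p) = 0"
proof -
  have "p \<noteq> star n q" using assms root_pair_sym[OF assms] by (simp add: root_pair_def)
  then show "g p * (g' q * g p) = 0" "g' p * (g q * g' p) = 0"
    using assms anticommute'[of q p] anticommute[of q p] by (simp_all add: root_pair_def mult.assoc[symmetric])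
qed

lemma root_pair_mid2: assumes "root_pair p q" shows "g p * (g' q * (g p * z)) = 0"
  using root_pair_mid(1)[OF assms] by (metis mult.assoc mult_zero_left)

text \<open>\<open>g p * g' q * g p = 0\<close>, so for a common first index products become sums in
  the second argument.\<close>

lemma root_elt_mult_same: "root_pair p q \<Longrightarrow> root_elt p c q * (1 + g p * z) = 1 + g p * (c \<star> g' q + z)"
  by (simp add: root_elt_def algebra_simps root_pair_mid2)

text \<open>Only the monoid generated by root elements with coefficients in an arbitrary set
  \<open>C\<close>, which may be an ideal or a set with denominators. If \<open>C\<close> is closed
  under negation it is a group, by \<open>root_group_inv\<close>.\<close>

inductive_set root_group :: "'f set \<Rightarrow> 'm set" for C where
  one: "1 \<in> root_group C"
| step: "root_pair i j \<Longrightarrow> c \<in> C \<Longrightarrow> x \<in> root_group C \<Longrightarrow> root_elt i c j * x \<in> root_group C"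

lemma root_group_root_elt: "root_pair i j \<Longrightarrow> c \<in> C \<Longrightarrow> root_elt i c j \<in> root_group C"
  using root_group.step[OF _ _ root_group.one] by fastforce

lemma root_group_mult: "x \<in> root_group C \<Longrightarrow> y \<in> root_group C \<Longrightarrow> x * y \<in> root_group C"
  by (induction rule: root_group.induct) (auto simp: mult.assoc intro: root_group.intros)

lemma root_group_mono: "x \<in> root_group C \<Longrightarrow> C \<subseteq> D \<Longrightarrow> x \<in> root_group D"
  by (induction rule: root_group.induct) (auto intro: root_group.intros)

lemma root_group_inv:
  assumes "x \<in> root_group C" "\<And>c. c \<in> C \<Longrightarrow> - c \<in> C"
  shows "\<exists>y\<in>root_group C. x * y = 1 \<and> y * x = 1"
  using assms(1)
proof induction
  case one then show ?case by (auto intro: root_group.one bexI[of _ 1])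
next
  case (step i j c x)
  then obtain y where y: "y \<in> root_group C" "x * y = 1" "y * x = 1" by auto
  have "root_elt i c j * x * (y * root_elt i (- c) j) = root_elt i c j * (x * y) * root_elt i (- c) j"
    "y * root_elt i (- c) j * (root_elt i c j * x) = y * (root_elt i (- c) j * root_elt i c j) * x" by (simp_all only: mult.assoc)
  then have "root_elt i c j * x * (y * root_elt i (- c) j) = 1" "y * root_elt i (- c) j * (root_elt i c j * x) = 1"
    using step(1) y by simp_all
  moreover have "y * root_elt i (- c) j \<in> root_group C" using step y assms(2) by (auto intro: root_group_mult root_group_root_elt)
  ultimately show ?case by blast
qed

lemma root_group_conj:
  assumes "\<And>i j c. root_pair i j \<Longrightarrow> c \<in> C \<Longrightarrow> u * root_elt i c j * v \<in> root_group D" "v * u = 1" "u * v = 1" "x \<in> root_group C"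
  shows "u * x * v \<in> root_group D"
  using assms(4)
proof induction
  case one then show ?case using assms by (auto intro: root_group.one)
next
  case (step i j c x)
  have "u * (root_elt i c j * x) * v = u * root_elt i c j * (v * u) * x * v" by (simp add: assms(2) mult.assoc)
  also have "\<dots> = (u * root_elt i c j * v) * (u * x * v)" by (simp only: mult.assoc)
  finally show ?case using step assms(1) by (auto intro: root_group_mult)
qed

text \<open>As \<open>g p\<close> is orthogonal to \<open>g i\<close> and \<open>g j\<close>, it can
  be moved past \<open>g i * g' j\<close>, which turns into \<open>g' i * g j\<close>. Only
  \<open>g' q\<close> changes, by \<open>u\<close> times the combination \<open>?w\<close> of
  \<open>g' i\<close> and \<open>g' j\<close>, and the result is again a product of root elements
  with first index \<open>p\<close>.\<close>

lemma root_elt_conj: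
  assumes ij: "root_pair i j" and pq: "root_pair p q" and p: "p \<noteq> star n i" "p \<noteq> star n j"
  shows "root_elt i u j * root_elt p c q * root_elt i (- u) j
    = root_elt p c q * (root_elt p (if q = star n j then c * u else 0) i * root_elt p (if q = star n i then - (c * u) else 0) j)"
proof -
  let ?A = "g i * g' j" and ?A' = "g' i * g j"
  let ?\<beta> = "(if q = star n j then 1 else 0) :: 'f" and ?\<gamma> = "(if q = star n i then 1 else 0) :: 'f"
  let ?w = "?\<beta> \<star> g' i - ?\<gamma> \<star> g' j"
  have ix: "i < 2 * n" "j < 2 * n" "p < 2 * n" "q < 2 * n" "j \<noteq> star n i" "i \<noteq> star n j"
    "q \<noteq> star n p" using ij pq root_pair_sym[OF ij] by (auto simp: root_pair_def)
  have gpi: "root_pair p i" "root_pair p j" using ix p by (auto simp: root_pair_def star_swap)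
  have 1: "?A * g p = g p * ?A'"
  proof -
    have "?A * g p = g i * (g' j * g p)" by (simp add: mult.assoc)
    also have "\<dots> = - (g i * g' p * g j)" using ix p by (subst anticommute') (auto simp: mult.assoc)
    also have "\<dots> = g p * ?A'" using ix p by (subst anticommute) (auto simp: mult.assoc)
    finally show ?thesis .
  qed
  have 2: "?A' * g' q = g' q * ?A + ?w"
  proof -
    have 3: "g j * g' q = ?\<beta> \<star> 1 - g q * g' j" "g' i * g q = ?\<gamma> \<star> 1 - g' q * g i"
      using rel[of j q] rel'[of i q] ix by (auto simp: eq_diff_eq)
    have "?A' * g' q = ?\<beta> \<star> g' i - (g' i * g q) * g' j"
      unfolding mult.assoc[of "g' i"] 3(1) by (simp add: right_diff_distrib)
    also have "\<dots> = g' q * ?A + ?w" unfolding 3 by (simp add: left_diff_distrib mult.assoc)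
    finally show ?thesis .
  qed
  have w: "?w * ?A = 0"
    using ix root_pair_mid(2)[of j i] root_pair_sym[OF ij] by (simp add: left_diff_distrib) (simp add: mult.assoc[symmetric])
  have AA: "?A * ?A = 0" using root_pair_sq[OF ij] by simp
  have "(1 + u \<star> ?A) * (g p * g' q) = g p * ((1 + u \<star> ?A') * g' q)"
    using 1 by (simp add: distrib_left distrib_right mult.assoc[symmetric])
  also have "\<dots> = g p * (g' q * (1 + u \<star> ?A) + u \<star> ?w)"
    using 2 by (simp add: distrib_left distrib_right smul_simps)
  also have "\<dots> * (1 - u \<star> ?A) = g p * (g' q * ((1 + u \<star> ?A) * (1 - u \<star> ?A)) + u \<star> (?w * (1 - u \<star> ?A)))"
    by (simp add: distrib_right mult.assoc)
  also have "(1 + u \<star> ?A) * (1 - u \<star> ?A) = 1" using AA by (simp add: distrib_right right_diff_distrib)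
  also have "?w * (1 - u \<star> ?A) = ?w" using w by (simp add: right_diff_distrib)
  finally have "root_elt i u j * (c \<star> (g p * g' q)) * root_elt i (- u) j = c \<star> (g p * (g' q + u \<star> ?w))"
    by (simp add: root_elt_def)
  then have "root_elt i u j * root_elt p c q * root_elt i (- u) j = 1 + c \<star> (g p * (g' q + u \<star> ?w))"
    using ij by (simp add: root_elt_def[of p] distrib_left distrib_right)
  moreover have "root_elt p c q * (root_elt p (if q = star n j then c * u else 0) i * root_elt p (if q = star n i then - (c * u) else 0) j)
     = 1 + c \<star> (g p * (g' q + u \<star> ?w))"
  proof -
    have "root_elt p c q * (root_elt p d i * root_elt p e j) = 1 + g p * (c \<star> g' q + (d \<star> g' i + e \<star> g' j))" for d e
    proof -
      have "root_elt p e j = 1 + g p * (e \<star> g' j)" by (simp add: root_elt_def)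
      then show ?thesis using gpi pq by (simp only: root_elt_mult_same)
    qed
    then show ?thesis by (simp add: smul_simps distrib_left right_diff_distrib mult.commute)
  qed
  ultimately show ?thesis by simp
qed

text \<open>Two indices meet at most two of the hyperbolic pairs, and \<open>3 \<le> n\<close>
  provides a third.\<close>

lemma exists_index:
  assumes "i < 2 * n" "j < 2 * n"
  shows "\<exists>k < 2 * n. k \<noteq> i \<and> k \<noteq> j \<and> k \<noteq> star n i \<and> k \<noteq> star n j \<and>
     star n k \<noteq> i \<and> star n k \<noteq> j \<and> star n k \<noteq> star n i \<and> star n k \<noteq> star n j"
proof -
  define h where "h i = (if i < n then i else i - n)" for i
  have "\<exists>k\<in>{0,1,2}. k \<noteq> h i \<and> k \<noteq> h j"
    by (cases "h i = 0"; cases "h i = 1"; cases "h j = 0"; cases "h j = 1") auto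
  then obtain k where "k \<in> {0,1,2}" "k \<noteq> h i" "k \<noteq> h j" by blast
  then show ?thesis using n3 assms by (intro exI[of _ k]) (auto simp: star_def h_def split: if_splits)
qed

section \<open>Conjugation by root elements with denominators\<close>

context
  fixes P :: "'f set" and a :: 'f
  assumes P: "subring_set P" and aP: "a \<in> P"
begin

lemma root_group_conj_root_elt_root:
  assumes ij: "root_pair i j" and pq: "root_pair p q"
    and d: "p \<noteq> star n i \<and> p \<noteq> star n j \<or> q \<noteq> star n i \<and> q \<noteq> star n j"
    and c: "c \<in> pow_mult P a (M + K)" and u: "a ^ K * u \<in> P"
  shows "root_elt i u j * root_elt p c q * root_elt i (- u) j \<in> root_group (pow_mult P a M)"
proof -
  have *: "root_elt i u j * root_elt p c q * root_elt i (- u) j \<in> root_group (pow_mult P a M)"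
    if pq: "root_pair p q" and p: "p \<noteq> star n i" "p \<noteq> star n j" and c: "c \<in> pow_mult P a (M + K)" for p q c
  proof -
    have cu: "c * u \<in> pow_mult P a M" by (rule pow_mult_scaled[OF P aP c u])
    have "0 \<in> pow_mult P a M" using subring_setD(1)[OF P] pow_multI[of 0 P a M] by simp
    then have "(if q = star n j then c * u else 0) \<in> pow_mult P a M"
       "(if q = star n i then - (c * u) else 0) \<in> pow_mult P a M" using cu pow_mult_uminus[OF P cu] by auto
    moreover have "c \<in> pow_mult P a M" using c pow_mult_mono[OF P aP, of M "M + K"] by auto
    moreover have "root_pair p i" "root_pair p j" using pq p ij by (auto simp: root_pair_def star_swap)
    ultimately show ?thesis unfolding root_elt_conj[OF ij pq p] using pq by (intro root_group_mult root_group_root_elt) auto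
  qed
  from d show ?thesis
  proof
    assume "q \<noteq> star n i \<and> q \<noteq> star n j"
    then show ?thesis using *[OF root_pair_sym[OF pq]] pow_mult_uminus[OF P c] root_elt_swap[OF pq, of c] by simp
  qed (use * pq c in blast)
qed

text \<open>If \<open>p\<close> or \<open>q\<close> is dual to neither \<open>i\<close> nor
  \<open>j\<close>, then \<open>root_elt_conj\<close> applies and costs \<open>K\<close> powers of
  \<open>a\<close>. Otherwise both indices are among \<open>star n i\<close> and
  \<open>star n j\<close>; the root element is then a commutator of root elements through a further
  index \<open>k\<close>, to which the first case applies. Both factors of its coefficient must be
  divisible by a^(M+K), hence the exponent \<open>2 * (M + K)\<close>.\<close>

lemma root_group_conj_root_elt:
  assumes ij: "root_pair i j" and u: "a ^ K * u \<in> P"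
    and x: "x \<in> root_group (pow_mult P a (2 * (M + K)))"
  shows "root_elt i u j * x * root_elt i (- u) j \<in> root_group (pow_mult P a M)"
proof (rule root_group_conj[OF _ _ _ x])
  fix p q c assume pq: "root_pair p q" and c: "c \<in> pow_mult P a (2 * (M + K))"
  show "root_elt i u j * root_elt p c q * root_elt i (- u) j \<in> root_group (pow_mult P a M)"
  proof (cases "p \<noteq> star n i \<and> p \<noteq> star n j \<or> q \<noteq> star n i \<and> q \<noteq> star n j")
    case True
    then show ?thesis using c pow_mult_mono[OF P aP, of "M + K" "2 * (M + K)"] ij pq u by (auto intro: root_group_conj_root_elt_root)
  next
    case False
    have cc: "root_elt i u j * (w * x * y * z) * root_elt i (- u) j \<in> root_group (pow_mult P a M)"
      if "root_elt i u j * w * root_elt i (- u) j \<in> root_group (pow_mult P a M)" "root_elt i u j * x * root_elt i (- u) j \<in> root_group (pow_mult P a M)"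
        "root_elt i u j * y * root_elt i (- u) j \<in> root_group (pow_mult P a M)" "root_elt i u j * z * root_elt i (- u) j \<in> root_group (pow_mult P a M)" for w x y z
    proof -
      have "root_elt i u j * (w * x * y * z) * root_elt i (- u) j = root_elt i u j * w * (root_elt i (- u) j * root_elt i u j) * x
          * (root_elt i (- u) j * root_elt i u j) * y * (root_elt i (- u) j * root_elt i u j) * z * root_elt i (- u) j"
        using ij by (simp add: mult.assoc)
      also have "\<dots> = (root_elt i u j * w * root_elt i (- u) j) * (root_elt i u j * x * root_elt i (- u) j)
          * (root_elt i u j * y * root_elt i (- u) j) * (root_elt i u j * z * root_elt i (- u) j)" by (simp only: mult.assoc)
      finally show ?thesis using that by (auto intro!: root_group_mult)
    qed
    obtain k where k: "k < 2 * n" "k \<noteq> i" "k \<noteq> j" "k \<noteq> star n i" "k \<noteq> star n j"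
     "star n k \<noteq> i" "star n k \<noteq> j" "star n k \<noteq> star n i" "star n k \<noteq> star n j"
      using exists_index[of i j] ij by (auto simp: root_pair_def)
    have pq': "p = star n i \<or> p = star n j" "q = star n i \<or> q = star n j" using False by auto
    obtain d where d: "d \<in> P" "c = a ^ (M + K) * (a ^ (M + K) * d)"
      using c by (auto simp: pow_mult_def mult_2 power_add mult.assoc)
    have m: "a ^ (M + K) * e \<in> pow_mult P a (M + K)" "- (a ^ (M + K) * e) \<in> pow_mult P a (M + K)" if "e \<in> P" for e
      using that by (auto intro!: pow_multI pow_mult_uminus P)
    note m1 = m(1)[OF subring_setD(2)[OF P], simplified] m(2)[OF subring_setD(2)[OF P], simplified]
    have gd: "root_pair p k" "root_pair (star n k) q" using k pq pq' ij by (auto simp: root_pair_def)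
    have "root_elt p c q = root_elt p (a ^ (M + K)) k * root_elt (star n k) (a ^ (M + K) * d) q * root_elt p (- (a ^ (M + K))) k * root_elt (star n k) (- (a ^ (M + K) * d)) q"
      unfolding d(2) by (rule root_elt_commutator[symmetric]) (use k pq pq' in auto)
    then show ?thesis using gd k pq' d m1 m[of d] ij u
      by (auto intro!: cc root_group_conj_root_elt_root)
  qed
qed (use ij in auto)

end

text \<open>One word in root elements evaluated at two systems of coefficients that are related by \<open>Q\<close>.\<close>

inductive word_pair :: "('f \<Rightarrow> 'f \<Rightarrow> bool) \<Rightarrow> nat \<Rightarrow> 'm \<Rightarrow> 'm \<Rightarrow> bool" for Q where
  one: "word_pair Q m 1 1"
| step: "root_pair i j \<Longrightarrow> Q u v \<Longrightarrow> word_pair Q m x y \<Longrightarrow> word_pair Q (Suc m) (root_elt i u j * x) (root_elt i v j * y)"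

lemma word_pair_root_elt: "root_pair i j \<Longrightarrow> Q u v \<Longrightarrow> word_pair Q 1 (root_elt i u j) (root_elt i v j)"
  using word_pair.step[OF _ _ word_pair.one, of i j Q u v 0] by simp

lemma word_pair_mono: "word_pair Q m x y \<Longrightarrow> m \<le> m' \<Longrightarrow> word_pair Q m' x y"
proof (induction arbitrary: m' rule: word_pair.induct)
  case (step i j u v m x y)
  then obtain k where "m' = Suc k" "m \<le> k" by (cases m') auto
  then show ?case using step by (auto intro: word_pair.step)
qed (rule word_pair.one)

lemma word_pair_mult: "word_pair Q m x y \<Longrightarrow> word_pair Q m' x' y' \<Longrightarrow> word_pair Q (m + m') (x * x') (y * y')"
proof (induction rule: word_pair.induct)
  case (one m) then show ?case by (auto intro: word_pair_mono)
qed (auto simp: mult.assoc intro: word_pair.step)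

lemma word_pair_prod_list:
  "(\<And>k. k \<in> set ks \<Longrightarrow> word_pair Q m (f k) (h k)) \<Longrightarrow> word_pair Q (length ks * m) (prod_list (map f ks)) (prod_list (map h ks))"
proof (induction ks)
  case (Cons k ks)
  then show ?case using word_pair_mult[of Q m "f k" "h k" "length ks * m"] by simp
qed (simp add: word_pair.one)

lemma word_pair_diag: "word_pair (\<lambda>u v. u = v \<and> u \<in> C) m x y \<Longrightarrow> x \<in> root_group C"
  by (induction rule: word_pair.induct) (auto intro: root_group.intros)

text \<open>Induction on the length. Stripping the leading factors with coefficients
  \<open>u\<close> and \<open>v\<close> leaves the quotient of the shorter words conjugated by a
  root element with denominator, times a root element with coefficient \<open>u - v\<close>. The
  inductive hypothesis is used at the larger exponent \<open>2 * (M + K)\<close> to pay for the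
  conjugation. \<open>N\<close> depends on the length bound \<open>m\<close> but not on the
  words.\<close>

lemma word_pair_quotient:
  fixes P a b K
  defines "Q \<equiv> \<lambda>N u v. a ^ K * u \<in> P \<and> a ^ K * v \<in> P \<and> a ^ K * (u - v) \<in> pow_mult P a N"
  assumes P: "subring_set P" "a \<in> P" and ab: "a * b = 1"
  shows "\<exists>N. \<forall>x y. word_pair (Q N) m x y \<longrightarrow> (\<exists>z. y * z = 1 \<and> z * y = 1 \<and> x * z \<in> root_group (pow_mult P a M))"
proof (induction m arbitrary: M)
  case 0
  show ?case
  proof (intro exI[of _ "0::nat"] allI impI)
    fix x y assume "word_pair (Q 0) 0 x y"
    then show "\<exists>z. y * z = 1 \<and> z * y = 1 \<and> x * z \<in> root_group (pow_mult P a M)"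
      by (auto elim!: word_pair.cases intro: root_group.one exI[of _ 1])
  qed
next
  case (Suc m)
  obtain N where N: "\<And>x y. word_pair (Q N) m x y \<Longrightarrow>
      \<exists>z. y * z = 1 \<and> z * y = 1 \<and> x * z \<in> root_group (pow_mult P a (2 * (M + K)))" using Suc by blast
  \<comment> \<open>\<open>N\<close> serves the tail of the word. \<open>M + K\<close> ensures that
    \<open>u - v\<close>, of which only the multiple by a^K is known to lie in a^N' P, lies in a^M P
    after division by a^K.\<close>
  define N' where "N' = max N (M + K)"
  have Qm: "Q N' u v \<Longrightarrow> Q N u v" for u v
    using pow_mult_mono[OF P, of N N'] by (auto simp: Q_def N'_def)
  have RLm: "word_pair (Q N') k x y \<Longrightarrow> word_pair (Q N) k x y" for k x y
    by (induction rule: word_pair.induct) (auto intro: word_pair.intros Qm)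
  show ?case
  proof (intro exI[of _ N'] allI impI)
    fix x y assume "word_pair (Q N') (Suc m) x y"
    then show "\<exists>z. y * z = 1 \<and> z * y = 1 \<and> x * z \<in> root_group (pow_mult P a M)"
    proof cases
      case one then show ?thesis by (auto intro: root_group.one exI[of _ 1])
    next
      case (step i j u v x' y')
      obtain z where z: "y' * z = 1" "z * y' = 1" "x' * z \<in> root_group (pow_mult P a (2 * (M + K)))"
        using N[OF RLm[OF step(5)]] by blast
      let ?z = "z * root_elt i (- v) j"
      have "y * ?z = root_elt i v j * (y' * z) * root_elt i (- v) j" "?z * y = z * (root_elt i (- v) j * root_elt i v j) * y'"
        unfolding step(1,2) by (simp_all only: mult.assoc)
      then have yz: "y * ?z = 1" "?z * y = 1" using z step(3) by simp_all
      have uv: "u - v \<in> pow_mult P a M"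
      proof -
        obtain p where p: "p \<in> P" "a ^ K * (u - v) = a ^ N' * p" using step(4) by (auto simp: Q_def pow_mult_def)
        have "u - v = (a * b) ^ K * (u - v)" by (simp add: ab)
        also have "\<dots> = b ^ K * (a ^ K * (u - v))" by (simp add: power_mult_distrib algebra_simps)
        also have "\<dots> = b ^ K * (a ^ ((M + K) + (N' - (M + K))) * p)" using p by (simp add: N'_def)
        also have "\<dots> = (a * b) ^ K * (a ^ M * (a ^ (N' - (M + K)) * p))"
          unfolding power_add power_mult_distrib by (simp add: algebra_simps)
        finally show ?thesis using p P by (auto simp: ab intro!: pow_multI intro: subring_setD)
      qed
      have "x * ?z = (root_elt i u j * (x' * z) * root_elt i (- u) j) * (root_elt i u j * root_elt i (- v) j)"
      proof -
        have "(root_elt i u j * (x' * z) * root_elt i (- u) j) * (root_elt i u j * root_elt i (- v) j)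
          = root_elt i u j * (x' * z) * (root_elt i (- u) j * root_elt i u j) * root_elt i (- v) j" by (simp only: mult.assoc)
        then show ?thesis using step(1,3) by (simp add: mult.assoc)
      qed
      also have "root_elt i u j * root_elt i (- v) j = root_elt i (u - v) j" using step(3) by (simp add: root_elt_add)
      finally have "x * ?z \<in> root_group (pow_mult P a M)"
        using root_group_conj_root_elt[OF P step(3) _ z(3), of u] step(3,4) uv
        by (auto simp: Q_def intro!: root_group_mult root_group_root_elt)
      then show ?thesis using yz by blast
    qed
  qed
qed

section \<open>Vectors in the Clifford algebra and conjugation by them\<close>

definition S :: "(nat \<Rightarrow> 'f) \<Rightarrow> 'm" where "S x = (\<Sum>i<2 * n. x i \<star> g i)"
definition S' :: "(nat \<Rightarrow> 'f) \<Rightarrow> 'm" where "S' x = (\<Sum>i<2 * n. x i \<star> g' i)"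

definition unit_vector :: "(nat \<Rightarrow> 'f) \<Rightarrow> bool" where
  "unit_vector x \<longleftrightarrow> S x * S' x = 1 \<and> S' x * S x = 1"

definition root_elt' :: "nat \<Rightarrow> 'f \<Rightarrow> nat \<Rightarrow> 'm" where "root_elt' i c j = 1 + c \<star> (g' i * g j)"

lemma g_S: assumes "i < 2 * n" shows "g i * S' x + S x * g' i = x (star n i) \<star> 1"
proof -
  have "g i * S' x + S x * g' i = (\<Sum>k<2 * n. x k \<star> (g i * g' k + g k * g' i))"
    by (simp add: S_def S'_def sum_distrib_left sum_distrib_right sum.distrib smul_add_right)
  also have "\<dots> = (\<Sum>k<2 * n. if k = star n i then x k \<star> 1 else 0)"
    using assms by (intro sum.cong) (auto simp: rel)
  finally show ?thesis using assms by simp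
qed

lemmas scalar_ac = mult.commute[of "x::'f" for x] mult.left_commute[of "x::'f" for x] mult.assoc[of "x::'f" for x]

text \<open>With \<open>a = s (star n i)\<close>, \<open>b = s (star n j)\<close> and \<open>w = b * g i - a * g j\<close> the conjugate of a root
  element by \<open>S s\<close> is \<open>root_elt i l j * (1 - l * w * S' s)\<close>. The second factor is multiplicative in the
  coordinates of \<open>s\<close>; the two coordinates dual to \<open>i\<close> and \<open>j\<close> are not orthogonal to \<open>w\<close> separately,
  and together they are obtained as a commutator through the hyperbolic pair of \<open>k\<close>.\<close>

definition conj_word :: "(nat \<Rightarrow> 'f) \<Rightarrow> nat \<Rightarrow> 'f \<Rightarrow> nat \<Rightarrow> nat \<Rightarrow> 'm" where
  "conj_word s i l j k = root_elt i l j
     * prod_list (map (\<lambda>m. root_elt i (l * - (s (star n j) * s m)) m * root_elt j (l * (s (star n i) * s m)) m)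
         (filter (\<lambda>m. m \<noteq> star n i \<and> m \<noteq> star n j) [0..<2 * n]))
     * ((root_elt i (l * - s (star n j)) k * root_elt j (l * s (star n i)) k)
      * (root_elt (star n k) (s (star n i)) (star n i) * root_elt (star n k) (s (star n j)) (star n j))
      * (root_elt i (l * s (star n j)) k * root_elt j (l * - s (star n i)) k)
      * (root_elt (star n k) (- s (star n i)) (star n i) * root_elt (star n k) (- s (star n j)) (star n j)))"

lemma conj_word:
  assumes s: "unit_vector s" and ij: "root_pair i j" "i \<noteq> j"
    and k: "k < 2 * n" "k \<noteq> i" "k \<noteq> j" "k \<noteq> star n i" "k \<noteq> star n j"
  shows "S s * root_elt' i l j * S' s = conj_word s i l j k"
proof -
  define a b where "a = s (star n i)" and "b = s (star n j)"
  define w where "w = b \<star> g i - a \<star> g j"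
  have ix: "i < 2 * n" "j < 2 * n" "j \<noteq> star n i" "i \<noteq> star n j" using ij root_pair_sym[of i j] by (auto simp: root_pair_def)
  have SS: "S s * S' s = 1" "S' s * S s = 1" using s by (auto simp: unit_vector_def)
  have i1: "S s * g' i = a \<star> 1 - g i * S' s" and j1: "g j * S' s = b \<star> 1 - S s * g' j"
    and j2: "S s * g' j = b \<star> 1 - g j * S' s"
    using g_S[of i s] g_S[of j s] ix by (simp_all add: a_def b_def eq_diff_eq add.commute)
  have "S s * (g' i * g j) * S' s = (S s * g' i) * (g j * S' s)" by (simp add: mult.assoc)
  also have "\<dots> = (a \<star> 1 - g i * S' s) * (b \<star> 1 - S s * g' j)" unfolding i1 j1 ..
  also have "\<dots> = (a * b) \<star> 1 - a \<star> (S s * g' j) - b \<star> (g i * S' s) + g i * (S' s * S s) * g' j"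
    by (simp add: left_diff_distrib right_diff_distrib smul_diff_right mult.assoc mult.commute[of b a])
  also have "\<dots> = g i * g' j - w * S' s"
    unfolding SS j2 by (simp add: w_def smul_diff_right left_diff_distrib)
  finally have 1: "S s * root_elt' i l j * S' s = 1 + l \<star> (g i * g' j - w * S' s)"
    using SS by (simp add: root_elt'_def distrib_left distrib_right)
  have "g i * g' j * w = 0" using root_pair_mid(1)[OF ij(1)] ix by (simp add: w_def right_diff_distrib mult.assoc)
  then have 2: "S s * root_elt' i l j * S' s = root_elt i l j * (1 - l \<star> (w * S' s))"
    unfolding 1 by (simp add: root_elt_def distrib_right right_diff_distrib smul_diff_right mult.assoc[symmetric])
  \<comment> \<open>The vector \<open>w\<close> is isotropic and orthogonal to the
    \<open>m\<close>-th basis vector. This makes the factors in \<open>comb\<close> multiply by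
    adding their second arguments.\<close>
  have mid: "w * (g' m * w) = 0" if "m < 2 * n" "m \<noteq> star n i" "m \<noteq> star n j" for m
  proof -
    have gm: "root_pair i m" "root_pair j m" using that ix by (auto simp: root_pair_def)
    have "g i * (g' m * g j) = - (g j * (g' m * g i))"
    proof -
      have "g i * (g' m * g j) = - (g m * g' i * g j)" using that ix by (subst mult.assoc[symmetric], subst anticommute) auto
      also have "\<dots> = g m * g' j * g i" using ix anticommute'[of i j] by (simp add: mult.assoc)
      also have "\<dots> = - (g j * g' m * g i)" using that ix by (subst anticommute) (auto simp: star_swap)
      finally show ?thesis by (simp add: mult.assoc)
    qed
    then show ?thesis using root_pair_mid(1)[OF gm(1)] root_pair_mid(1)[OF gm(2)]
      by (simp add: w_def left_diff_distrib right_diff_distrib smul_diff_right mult.commute[of a b])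
  qed
  have fac: "root_elt i (c * - b) m * root_elt j (c * a) m = 1 - c \<star> (w * g' m)" if m: "m < 2 * n" "m \<noteq> star n i" "m \<noteq> star n j" for c m
  proof -
    have "g i * g' m * (g j * g' m) = g i * (g' m * g j) * g' m" by (simp add: mult.assoc)
    also have "\<dots> = - (g i * g' j * (g m * g' m))"
      using m ix by (subst anticommute') (auto simp: star_swap mult.assoc)
    finally have "g i * g' m * (g j * g' m) = 0" using m by simp
    then show ?thesis by (simp add: root_elt_def w_def distrib_left distrib_right left_diff_distrib smul_diff_right)
  qed
  have comb: "(1 - l \<star> (w * y)) * (1 - l \<star> (w * z)) = 1 - l \<star> (w * (y + z))" if "w * (y * w) = 0" for y z
  proof -
    have "w * (y * (w * z)) = 0" using that by (metis mult.assoc mult_zero_left)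
    then show ?thesis by (simp add: left_diff_distrib right_diff_distrib distrib_left smul_add_right mult.assoc)
  qed
  define ks where "ks = filter (\<lambda>m. m \<noteq> star n i \<and> m \<noteq> star n j) [0..<2 * n]"
  have ks: "m < 2 * n" "m \<noteq> star n i" "m \<noteq> star n j" if "m \<in> set ks" for m using that by (auto simp: ks_def)
  have prod: "prod_list (map (\<lambda>m. root_elt i (l * - (b * s m)) m * root_elt j (l * (a * s m)) m) ms)
      = 1 - l \<star> (w * sum_list (map (\<lambda>m. s m \<star> g' m) ms)) \<and> w * (sum_list (map (\<lambda>m. s m \<star> g' m) ms) * w) = 0"
    if "set ms \<subseteq> set ks" for ms
    using that
  proof (induction ms)
    case (Cons m ms)
    have "root_elt i (l * - (b * s m)) m * root_elt j (l * (a * s m)) m = 1 - l \<star> (w * (s m \<star> g' m))"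
      using fac[of m "l * s m"] ks Cons.prems by (simp add: ac_simps)
    then show ?case using Cons comb[of "s m \<star> g' m"] mid[of m] ks by (simp add: distrib_left distrib_right)
  qed simp
  \<comment> \<open>The pairing of \<open>w\<close> with \<open>z\<close> is
    \<open>b * a - a * b = 0\<close>. So \<open>w\<close> and \<open>z\<close> satisfy the relations
    of \<open>X\<close> and \<open>Y'\<close> in \<open>hyperbolic_commutator\<close>, although
    \<open>w\<close> is orthogonal to neither summand of \<open>z\<close> in general.\<close>
  define z where "z = a \<star> g' (star n i) + b \<star> g' (star n j)"
  have Ssum: "S' s = sum_list (map (\<lambda>m. s m \<star> g' m) ks) + z"
  proof -
    have "sum_list (map (\<lambda>m. s m \<star> g' m) ks) = (\<Sum>m\<in>{..<2 * n} - {star n i, star n j}. s m \<star> g' m)"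
      by (subst sum_list_distinct_conv_sum_set) (auto simp: ks_def intro: sum.cong)
    moreover have "S' s = (\<Sum>m\<in>{..<2 * n} - {star n i, star n j}. s m \<star> g' m) + (\<Sum>m\<in>{star n i, star n j}. s m \<star> g' m)"
      unfolding S'_def using ix by (subst sum.subset_diff[of "{star n i, star n j}"]) auto
    ultimately show ?thesis using ix ij by (simp add: z_def a_def b_def)
  qed
  have 3: "1 - l \<star> (w * S' s) = prod_list (map (\<lambda>m. root_elt i (l * - (b * s m)) m * root_elt j (l * (a * s m)) m) ks) * (1 - l \<star> (w * z))"
    unfolding Ssum using prod[of ks] comb by simp
  have ks4: "star n k < 2 * n" "star n k \<noteq> star n i" "star n k \<noteq> star n j" "star n k \<noteq> i" "star n k \<noteq> j"
    using k ix by (auto simp: star_swap)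
  have "(1 + ((- l) \<star> w) * g' k) * (1 + g (star n k) * z) * (1 - ((- l) \<star> w) * g' k) * (1 - g (star n k) * z) = 1 + ((- l) \<star> w) * z"
  proof (rule hyperbolic_commutator[where K = "g k" and L' = "g' (star n k)"
        and X' = "(- l) \<star> (b \<star> g' i - a \<star> g' j)" and Y = "a \<star> g (star n i) + b \<star> g (star n j)"])
    note d = w_def z_def left_diff_distrib right_diff_distrib distrib_left distrib_right smul_simps
    show "g k * g' k = 0" "g (star n k) * g' (star n k) = 0" using k by simp_all
    show "g' k * g (star n k) + g' (star n k) * g k = 1" using rel'[of k "star n k"] k by simp
    show "((- l) \<star> w) * ((- l) \<star> (b \<star> g' i - a \<star> g' j)) = 0"
      using ix anticommute[of i j] by (simp add: d scalar_ac)
    show "((- l) \<star> (b \<star> g' i - a \<star> g' j)) * g k = - (g' k * ((- l) \<star> w))"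
      using k ix anticommute'[of i k] anticommute'[of j k] by (simp add: d)
    then show "g' k * ((- l) \<star> w) = - (((- l) \<star> (b \<star> g' i - a \<star> g' j)) * g k)" by simp
    show "((- l) \<star> w) * g' (star n k) = - (g (star n k) * ((- l) \<star> (b \<star> g' i - a \<star> g' j)))"
      using ks4 ix anticommute[of i "star n k"] anticommute[of j "star n k"] by (simp add: d)
    show "((- l) \<star> (b \<star> g' i - a \<star> g' j)) * (a \<star> g (star n i) + b \<star> g (star n j)) = - (z * ((- l) \<star> w))"
    proof -
      have r: "g' i * g (star n i) = 1 - g' (star n i) * g i" "g' j * g (star n j) = 1 - g' (star n j) * g j"
        "g' i * g (star n j) = - (g' (star n j) * g i)" "g' j * g (star n i) = - (g' (star n i) * g j)"
        using rel'[of i "star n i"] rel'[of j "star n j"] anticommute'[of i "star n j"] anticommute'[of j "star n i"] ix ij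
        by (auto simp: eq_diff_eq)
      show ?thesis by (simp add: d r scalar_ac)
    qed
    then show "z * ((- l) \<star> w) = - (((- l) \<star> (b \<star> g' i - a \<star> g' j)) * (a \<star> g (star n i) + b \<star> g (star n j)))" by simp
    show "(a \<star> g (star n i) + b \<star> g (star n j)) * z = 0"
      using ix anticommute[of "star n i" "star n j"] by (simp add: d scalar_ac)
    show "(a \<star> g (star n i) + b \<star> g (star n j)) * g' k = - (g k * z)"
      using k ix anticommute[of "star n i" k] anticommute[of "star n j" k] by (simp add: d)
    show "z * g (star n k) = - (g' (star n k) * (a \<star> g (star n i) + b \<star> g (star n j)))"
      using ks4 ix k anticommute'[of "star n i" "star n k"] anticommute'[of "star n j" "star n k"] by (simp add: d)
  qed
  moreover have "1 + g (star n k) * (c \<star> z) = root_elt (star n k) (c * a) (star n i) * root_elt (star n k) (c * b) (star n j)" for c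
  proof -
    have gk: "root_pair (star n k) (star n i)" "root_pair (star n k) (star n j)" using k ks4 ix by (auto simp: root_pair_def)
    have e: "root_elt (star n k) (c * b) (star n j) = 1 + g (star n k) * ((c * b) \<star> g' (star n j))" by (simp add: root_elt_def)
    show ?thesis unfolding e root_elt_mult_same[OF gk(1)] z_def by (simp add: smul_add_right)
  qed
  note this[of 1] this[of "-1"]
  moreover note fac[OF k(1,4,5), of l] fac[OF k(1,4,5), of "- l"]
  ultimately have 4: "1 - l \<star> (w * z) = (root_elt i (l * - b) k * root_elt j (l * a) k)
      * (root_elt (star n k) a (star n i) * root_elt (star n k) b (star n j))
      * (root_elt i (l * b) k * root_elt j (l * - a) k)
      * (root_elt (star n k) (- a) (star n i) * root_elt (star n k) (- b) (star n j))"
    by simp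
  show ?thesis unfolding 2 3 4 conj_word_def a_def b_def ks_def by (simp add: mult.assoc)
qed

text \<open>The passage from \<open>g\<close> to \<open>g'\<close> in coordinates: it swaps the
  basis vectors 0 and \<open>n\<close> and negates the others, which is minus the reflection in
  their sum, the vector that represents 1. Thus \<open>S'\<close> is \<open>S\<close> of a flipped
  vector.\<close>

definition flip_sign :: "nat \<Rightarrow> 'f" where "flip_sign i = (if i = 0 \<or> i = n then 1 else - 1)"
definition flip_index :: "nat \<Rightarrow> nat" where "flip_index i = (if i = 0 then n else if i = n then 0 else i)"

lemma flip_index_lt [simp]: "i < 2 * n \<Longrightarrow> flip_index i < 2 * n" using n3 by (auto simp: flip_index_def)
lemma flip_index_flip_index [simp]: "flip_index (flip_index i) = i" by (auto simp: flip_index_def)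
lemma flip_sign_flip_index [simp]: "flip_sign (flip_index i) = flip_sign i" by (auto simp: flip_index_def flip_sign_def)
lemma flip_sign_cases: "flip_sign i = 1 \<or> flip_sign i = - 1" by (auto simp: flip_sign_def)
lemma flip_sign_flip_sign [simp]: "flip_sign i * flip_sign i = 1" "flip_sign i * (flip_sign i * x) = x" using flip_sign_cases[of i] by auto
lemma star_flip_index: "i < 2 * n \<Longrightarrow> star n (flip_index i) = flip_index (star n i)" using n3 by (auto simp: flip_index_def star_def)

lemma g'_flip_index: "i < 2 * n \<Longrightarrow> g' i = flip_sign i \<star> g (flip_index i)"
  by (auto simp: flip_sign_def flip_index_def g'_0 g'_n g'_other)
lemma g_flip_index: "i < 2 * n \<Longrightarrow> g i = flip_sign i \<star> g' (flip_index i)"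
  by (auto simp: flip_sign_def flip_index_def g'_0 g'_n g'_other)

lemma root_pair_flip_index: "root_pair i j \<Longrightarrow> root_pair (flip_index i) (flip_index j)"
  by (auto simp: root_pair_def star_flip_index) (metis flip_index_flip_index)

lemma root_elt_eq_root_elt': assumes "root_pair i j" shows "root_elt i c j = root_elt' (flip_index i) (flip_sign i * flip_sign j * c) (flip_index j)"
proof -
  have "g i * g' j = (flip_sign i * flip_sign j) \<star> (g' (flip_index i) * g (flip_index j))"
    using assms by (simp add: root_pair_def g_flip_index[of i] g'_flip_index[of j] mult.commute)
  then show ?thesis by (simp add: root_elt_def root_elt'_def mult.commute)
qed

lemma S'_eq_S: "S' x = S (\<lambda>k. flip_sign k * x (flip_index k))"
  unfolding S_def S'_def
  by (rule sum.reindex_bij_witness[where i = flip_index and j = flip_index]) (auto simp: g'_flip_index scalar_ac)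

lemma S_eq_S': "S x = S' (\<lambda>k. flip_sign k * x (flip_index k))"
  unfolding S_def S'_def
  by (rule sum.reindex_bij_witness[where i = flip_index and j = flip_index]) (auto simp: g_flip_index scalar_ac)

definition flip :: "(nat \<Rightarrow> 'f) \<Rightarrow> nat \<Rightarrow> 'f" where "flip x k = flip_sign k * x (flip_index k)"

lemma S_flip: "S (flip x) = S' x" "S' (flip x) = S x"
  unfolding flip_def[abs_def] by (rule S'_eq_S[symmetric], rule S_eq_S'[symmetric])

lemma unit_vector_flip: "unit_vector x \<Longrightarrow> unit_vector (flip x)"
  by (simp add: unit_vector_def S_flip)

text \<open>\<open>A\<close> relates coordinates of two vectors and \<open>Q\<close> coefficients of
  two words. They differ because the elements of \<open>C\<close> may carry denominators:
  \<open>A\<close> is multiplicative, while a product with an element of \<open>C\<close> only has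
  to satisfy \<open>Q\<close>.\<close>

definition compat :: "('f \<Rightarrow> 'f \<Rightarrow> bool) \<Rightarrow> ('f \<Rightarrow> 'f \<Rightarrow> bool) \<Rightarrow> 'f set \<Rightarrow> bool" where
  "compat A Q C \<longleftrightarrow> A 1 1 \<and> (\<forall>u v. A u v \<longrightarrow> Q u v \<and> A (- u) (- v)) \<and>
    (\<forall>u v u' v'. A u v \<longrightarrow> A u' v' \<longrightarrow> A (u * u') (v * v')) \<and> (\<forall>l\<in>C. \<forall>u v. A u v \<longrightarrow> Q (l * u) (l * v))"

text \<open>The length of \<open>conj_word\<close>: one leading root element, two for each of at
  most \<open>2 * n\<close> indices, and eight for the commutator.\<close>

lemma conj_root_elt'_word_pair:
  assumes cp: "compat A Q C" and l: "l \<in> C"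
    and st: "unit_vector s" "unit_vector t" "\<And>m. m < 2 * n \<Longrightarrow> A (s m) (t m)"
    and ij: "root_pair i j"
  shows "word_pair Q (4 * n + 9) (S s * root_elt' i l j * S' s) (S t * root_elt' i l j * S' t)"
proof (cases "i = j")
  case True
  then have "root_elt' i l j = 1" using ij by (simp add: root_elt'_def root_pair_def)
  then show ?thesis using st by (auto simp: unit_vector_def intro: word_pair.one)
next
  case False
  have ix: "i < 2 * n" "j < 2 * n" "j \<noteq> star n i" "i \<noteq> star n j" using ij root_pair_sym[of i j] by (auto simp: root_pair_def)
  obtain k where k: "k < 2 * n" "k \<noteq> i" "k \<noteq> j" "k \<noteq> star n i" "k \<noteq> star n j"
     "star n k \<noteq> star n i" "star n k \<noteq> star n j" "star n k \<noteq> i" "star n k \<noteq> j"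
    using exists_index[of i j] ix by blast
  have A: "A 1 1" "\<And>u v. A u v \<Longrightarrow> Q u v" "\<And>u v. A u v \<Longrightarrow> A (- u) (- v)" "\<And>u v. A u v \<Longrightarrow> Q (l * u) (l * v)"
    "\<And>u v u' v'. A u v \<Longrightarrow> A u' v' \<Longrightarrow> A (u * u') (v * v')" using cp l by (auto simp: compat_def)
  have Qa: "A u v \<Longrightarrow> Q u v" "A u v \<Longrightarrow> Q (- u) (- v)" "A u v \<Longrightarrow> Q (l * u) (l * v)" "A u v \<Longrightarrow> Q (l * - u) (l * - v)" for u v
    using A by blast+
  have gd: "root_pair i j" "root_pair i k" "root_pair j k" "root_pair (star n k) (star n i)" "root_pair (star n k) (star n j)"
    using k ix by (auto simp: root_pair_def)
  define ks where "ks = filter (\<lambda>m. m \<noteq> star n i \<and> m \<noteq> star n j) [0..<2 * n]"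
  have gk: "root_pair i m" "root_pair j m" "m < 2 * n" if "m \<in> set ks" for m using that ix by (auto simp: ks_def root_pair_def)
  have sA: "A (s (star n i)) (t (star n i))" "A (s (star n j)) (t (star n j))" using st ix by auto
  have m: "word_pair Q (Suc (Suc 0)) (root_elt p u q * root_elt p' u' q') (root_elt p v q * root_elt p' v' q')"
    if "root_pair p q" "root_pair p' q'" "Q u v" "Q u' v'" for p q p' q' u v u' v'
    using word_pair_mult[OF word_pair_root_elt[of p q Q u v] word_pair_root_elt[of p' q' Q u' v']] that by simp
  have 1: "word_pair Q 1 (root_elt i l j) (root_elt i l j)" using Qa(3)[OF A(1)] by (intro word_pair_root_elt gd) simp
  have 2: "word_pair Q (length ks * Suc (Suc 0))
    (prod_list (map (\<lambda>m. root_elt i (l * - (s (star n j) * s m)) m * root_elt j (l * (s (star n i) * s m)) m) ks))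
    (prod_list (map (\<lambda>m. root_elt i (l * - (t (star n j) * t m)) m * root_elt j (l * (t (star n i) * t m)) m) ks))"
    by (rule word_pair_prod_list, intro m gk Qa A(5) sA st(3)) auto
  have "word_pair Q (1 + length ks * Suc (Suc 0) + (Suc (Suc 0) + Suc (Suc 0) + Suc (Suc 0) + Suc (Suc 0)))
    (conj_word s i l j k) (conj_word t i l j k)"
    unfolding conj_word_def ks_def[symmetric]
    by (intro word_pair_mult 1 2 m gd Qa sA)
  moreover have "length ks \<le> 2 * n" unfolding ks_def by (rule order.trans[OF length_filter_le]) simp
  ultimately show ?thesis
    using conj_word[OF st(1) ij False k(1-5)] conj_word[OF st(2) ij False k(1-5)]
    by (auto elim: word_pair_mono)
qed

text \<open>The length bound is chosen before the relations and the vectors; it depends on the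
  conjugated word alone. This order of quantifiers is what \<open>dilation\<close> needs.\<close>

lemma conj_root_group_word_pair:
  assumes "x \<in> root_group C"
  shows "\<exists>m. \<forall>A Q s t. compat A Q C \<longrightarrow> unit_vector s \<longrightarrow> unit_vector t \<longrightarrow> (\<forall>m<2 * n. A (s m) (t m)) \<longrightarrow>
     word_pair Q m (S s * x * S' s) (S t * x * S' t)"
  using assms
proof induction
  case one
  then show ?case by (auto simp: unit_vector_def intro: word_pair.one)
next
  case (step i j c x)
  then obtain m where m: "\<And>A Q s t. compat A Q C \<Longrightarrow> unit_vector s \<Longrightarrow> unit_vector t \<Longrightarrow> \<forall>m<2 * n. A (s m) (t m) \<Longrightarrow>
     word_pair Q m (S s * x * S' s) (S t * x * S' t)" by metis
  show ?case
  proof (intro exI[of _ "4 * n + 9 + m"] allI impI)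
    fix A Q s t
    assume cp: "compat A Q C" and st: "unit_vector s" "unit_vector t" "\<forall>m<2 * n. A (s m) (t m)"
    have "compat A Q {flip_sign i * flip_sign j * c}"
      using cp step(2) flip_sign_cases[of i] flip_sign_cases[of j] by (auto simp: compat_def) (metis mult_minus_left mult_minus_right)+
    then have "word_pair Q (4 * n + 9) (S s * root_elt i c j * S' s) (S t * root_elt i c j * S' t)"
      unfolding root_elt_eq_root_elt'[OF step(1)] by (rule conj_root_elt'_word_pair) (use st step root_pair_flip_index in auto)
    moreover have "S s * (root_elt i c j * x) * S' s = (S s * root_elt i c j * S' s) * (S s * x * S' s)" if "unit_vector s" for s
    proof -
      have "(S s * root_elt i c j * S' s) * (S s * x * S' s) = S s * root_elt i c j * (S' s * S s) * x * S' s" by (simp only: mult.assoc)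
      also have "S' s * S s = 1" using that by (simp add: unit_vector_def)
      finally show ?thesis by (simp add: mult.assoc)
    qed
    ultimately show "word_pair Q (4 * n + 9 + m) (S s * (root_elt i c j * x) * S' s) (S t * (root_elt i c j * x) * S' t)"
      using st m[OF cp st] by (simp add: word_pair_mult)
  qed
qed

text \<open>The case of two equal vectors, with equality inside \<open>P\<close> as both relations:
  the word then shows membership. For \<open>S'\<close> the vector is flipped.\<close>

lemma conj_root_group:
  assumes P: "subring_set P" and s: "unit_vector s" "\<And>m. m < 2 * n \<Longrightarrow> s m \<in> P" and x: "x \<in> root_group P"
  shows "S s * x * S' s \<in> root_group P" "S' s * x * S s \<in> root_group P"
proof -
  have *: "S s * x * S' s \<in> root_group P" if s: "unit_vector s" "\<And>m. m < 2 * n \<Longrightarrow> s m \<in> P" for s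
  proof -
    let ?A = "\<lambda>u v. u = v \<and> u \<in> P"
    have "compat ?A ?A P" using subring_setD[OF P] by (auto simp: compat_def)
    then show ?thesis using conj_root_group_word_pair[OF x] s word_pair_diag by blast
  qed
  show "S s * x * S' s \<in> root_group P" using * s by blast
  have "flip s m \<in> P" if "m < 2 * n" for m
    using s(2)[OF flip_index_lt[OF that]] flip_sign_cases[of m] subring_setD(5)[OF P] by (auto simp: flip_def)
  then show "S' s * x * S s \<in> root_group P" using *[of "flip s"] unit_vector_flip[OF s(1)] by (simp add: S_flip)
qed

section \<open>Unit vectors with an invertible entry as words in root elements\<close>

lemma sum_root_group:
  assumes "finite K" "\<And>k. k \<in> K \<Longrightarrow> root_pair p k \<and> c k \<in> C"
  shows "1 + g p * (\<Sum>k\<in>K. c k \<star> g' k) \<in> root_group C"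
  using assms
proof (induction K)
  case (insert k K)
  have "root_elt p (c k) k * (1 + g p * (\<Sum>k\<in>K. c k \<star> g' k)) \<in> root_group C" using insert by (intro root_group.step) auto
  then show ?case using insert by (simp add: root_elt_mult_same)
qed (simp add: root_group.one)

text \<open>Steinberg's h(a) = w(a) w(-1), where w(a) is the product of the unipotents with
  coefficients a, -1/a, a. It acts as \<open>a\<close> on the image of the idempotent
  \<open>E * F\<close>, as \<open>b\<close> on that of \<open>F * E\<close>, and trivially on the
  rest.\<close>

lemma sl2_torus:
  assumes "E * E = 0" "F * F = 0" "E * (F * E) = E" "F * (E * F) = F" and ab: "a * b = 1"
  shows "(1 + a \<star> E) * (1 + (- b) \<star> F) * (1 + a \<star> E) * ((1 + (- 1) \<star> E) * (1 + 1 \<star> F) * (1 + (- 1) \<star> E))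
    = 1 + (a - 1) \<star> (E * F) + (b - 1) \<star> (F * E)"
proof -
  have z: "E * (E * x) = 0" "F * (F * x) = 0" for x using assms by (simp_all add: mult.assoc[symmetric])
  have ba: "b * a = 1" "a * (b * x) = x" "a * (a * b) = a" "b * (a * x) = x" for x
    using ab by (simp_all add: mult.commute) (metis mult.assoc mult.commute mult_1)+
  have y: "E * (F * (E * x)) = E * x" "F * (E * (F * x)) = F * x" for x
    using assms(3,4) by (metis mult.assoc)+
  have tri: "(1 + c \<star> E) * (1 + (- d) \<star> F) * (1 + c \<star> E) = 1 - E * F - F * E + c \<star> E - d \<star> F" if "c * d = 1" for c d
  proof -
    have "d * c = 1" "c * (d * c) = c" using that by (simp_all add: mult.commute)
    then show ?thesis using that assms
      by (simp add: distrib_left distrib_right mult.assoc left_diff_distrib right_diff_distrib smul_simps)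
  qed
  have "(1 + (- 1) \<star> E) * (1 + 1 \<star> F) * (1 + (- 1) \<star> E) = 1 - E * F - F * E - E + F" using tri[of "- 1" "- 1"] by simp
  then show ?thesis unfolding tri[OF ab]
    by (simp add: assms distrib_left distrib_right left_diff_distrib right_diff_distrib mult.assoc z y smul_simps)
qed

text \<open>The two \<open>SL\<^sub>2\<close>-triples used here have sum of coroots twice the first basis vector, so the product of
  their tori is the diagonal element.\<close>

lemma torus_root_group:
  assumes C: "1 \<in> C" "- 1 \<in> C" "a \<in> C" "- b \<in> C" and ab: "a * b = 1"
  shows "a \<star> g 0 + b \<star> g n \<in> root_group C"
proof -
  define F F' G H where "F = g 0" and "F' = g n" and "G = g 1" and "H = g (n + 1)"
  have lt: "0 < 2 * n" "n < 2 * n" "1 < 2 * n" "n + 1 < 2 * n" using n3 by auto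
  have st: "star n 0 = n" "star n n = 0" "star n 1 = n + 1" "star n (n + 1) = 1" using n3 by (auto simp: star_def)
  have gp: "g' 0 = F'" "g' n = F" "g' 1 = - G" "g' (n + 1) = - H" using n3
    by (auto simp: g'_0 g'_n F_def F'_def G_def H_def g'_other)
  have F': "F' = 1 - F" using g_sum by (simp add: F_def F'_def eq_diff_eq add.commute)
  have FF: "F * F = F" using iso(1)[OF lt(1)] unfolding gp F' by (simp add: F_def[symmetric] right_diff_distrib)
  have GG: "G * G = 0" "H * H = 0" using iso(1)[OF lt(3)] iso(1)[OF lt(4)] gp by (simp_all add: G_def H_def)
  have HG: "H * G = - 1 - G * H"
  proof -
    have "- (G * H) - H * G = 1" using rel[OF lt(3,4)] st(3) unfolding gp by (simp add: G_def H_def)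
    moreover have "H * G = - (- (G * H) - H * G) - G * H" by simp
    ultimately show ?thesis by metis
  qed
  have GF: "G * F = G - F * G" "H * F = H - F * H"
  proof -
    have "G * F' = F * G" "H * F' = F * H"
      using anticommute[OF lt(3,1)] anticommute[OF lt(4,1)] st(3,4) n3 unfolding gp by (simp_all add: F_def G_def H_def)
    then show "G * F = G - F * G" "H * F = H - F * H" unfolding F' by (simp_all add: right_diff_distrib)  (metis diff_diff_eq2 add_diff_cancel_left')+
  qed
  have ass: "F * (F * x) = F * x" "G * (G * x) = 0" "H * (H * x) = 0" "H * (G * x) = - x - G * (H * x)"
    "G * (F * x) = G * x - F * (G * x)" "H * (F * x) = H * x - F * (H * x)" for x
    by (simp_all add: mult.assoc[symmetric] FF GG HG GF left_diff_distrib)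
  note rules = FF GG HG GF ass mult.assoc left_diff_distrib right_diff_distrib distrib_left distrib_right
  let ?E = "g 0 * g' 1" and ?F = "g (n + 1) * g' n" and ?E2 = "g 0 * g' (n + 1)" and ?F2 = "g 1 * g' n"
  have gd: "root_pair 0 1" "root_pair (n + 1) n" "root_pair 0 (n + 1)" "root_pair 1 n" using lt st n3 by (auto simp: root_pair_def)
  have t: "1 + (a - 1) \<star> (e * f) + (b - 1) \<star> (f * e) \<in> root_group C"
    if ef: "e = g i * g' j" "f = g k * g' m" "root_pair i j" "root_pair k m" and r: "e * (f * e) = e" "f * (e * f) = f"
    for e f i j k m
  proof -
    have "root_elt i a j * root_elt k (- b) m * root_elt i a j * (root_elt i (- 1) j * root_elt k 1 m * root_elt i (- 1) j) \<in> root_group C"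
      using C ef by (auto intro!: root_group_mult root_group_root_elt)
    moreover have "e * e = 0" "f * f = 0" using root_pair_sq ef by auto
    ultimately show ?thesis using sl2_torus[OF _ _ r ab] by (simp add: root_elt_def ef(1,2))
  qed
  have e: "?E = - (F * G)" "?F = H * F" "?E2 = - (F * H)" "?F2 = G * F"
    unfolding gp by (simp_all add: F_def G_def H_def)
  have r: "?E * (?F * ?E) = ?E" "?F * (?E * ?F) = ?F" "?E2 * (?F2 * ?E2) = ?E2" "?F2 * (?E2 * ?F2) = ?F2"
    unfolding e by (simp_all add: rules)
  have p: "?E * ?F = - (F * (G * H))" "?F * ?E = - (H * (F * G))" "?E2 * ?F2 = F + F * (G * H)" "?F2 * ?E2 = - (G * (F * H))"
    unfolding e by (simp_all add: rules)
  have "(1 + (a - 1) \<star> (?E * ?F) + (b - 1) \<star> (?F * ?E)) * (1 + (a - 1) \<star> (?E2 * ?F2) + (b - 1) \<star> (?F2 * ?E2))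
    = a \<star> F + b \<star> F'"
    unfolding p F' by (simp add: rules smul_simps)
  moreover have "(1 + (a - 1) \<star> (?E * ?F) + (b - 1) \<star> (?F * ?E)) * (1 + (a - 1) \<star> (?E2 * ?F2) + (b - 1) \<star> (?F2 * ?E2)) \<in> root_group C"
    by (rule root_group_mult) (use t gd r in blast)+
  ultimately show ?thesis by (simp add: F_def F'_def)
qed

text \<open>A Gauss decomposition with pivot \<open>t 0\<close>: unipotent, torus, unipotent. The
  entry \<open>t n\<close> does not occur in the middle factor; it is reproduced by
  \<open>Y * Y = a * d - 1\<close>, which is the condition \<open>unit_vector t\<close>.\<close>

lemma unit_vector_root_group:
  assumes t: "unit_vector t" and ab: "t 0 * b = 1"
    and C: "1 \<in> C" "- 1 \<in> C" "t 0 \<in> C" "- b \<in> C" "\<And>k. k < 2 * n \<Longrightarrow> - (t k * b) \<in> C"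
  shows "S t \<in> root_group C"
proof -
  define a d where "a = t 0" and "d = t n"
  define F F' where "F = g 0" and "F' = g n"
  define K where "K = {..<2 * n} - {0, n}"
  define Y where "Y = (\<Sum>k\<in>K. t k \<star> g k)"
  have n: "0 < 2 * n" "n < 2 * n" "n \<noteq> 0" using n3 by auto
  have K: "k < 2 * n" "k \<noteq> 0" "k \<noteq> n" if "k \<in> K" for k using that by (auto simp: K_def)
  have stK: "k \<noteq> star n 0" "k \<noteq> star n n" if "k \<in> K" for k using K[OF that] n by (auto simp: star_def)
  have gp: "g' 0 = F'" "g' n = F" by (simp_all add: g'_0 g'_n F_def F'_def)
  have F': "F' = 1 - F" using g_sum by (simp add: F_def F'_def eq_diff_eq add.commute)
  have FF: "F * F = F" using iso(1)[OF n(1)] unfolding gp F' by (simp add: F_def[symmetric] right_diff_distrib)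
  have St: "S t = a \<star> F + d \<star> F' + Y"
    unfolding S_def Y_def K_def using n by (subst sum.subset_diff[of "{0, n}"]) (auto simp: a_def d_def F_def F'_def add.commute)
  have Y': "(\<Sum>k\<in>K. t k \<star> g' k) = - Y"
  proof -
    have "t k \<star> g' k = - (t k \<star> g k)" if "k \<in> K" for k using K[OF that] by (simp add: g'_other)
    then show ?thesis by (simp add: Y_def sum_negf)
  qed
  have St': "S' t = a \<star> F' + d \<star> F - Y"
  proof -
    have "S' t = (\<Sum>k\<in>K. t k \<star> g' k) + (\<Sum>k\<in>{0, n}. t k \<star> g' k)"
      unfolding S'_def K_def using n by (subst sum.subset_diff[of "{0, n}"]) auto
    then show ?thesis unfolding Y' using n by (simp add: gp a_def d_def)
  qed
  have YF: "Y * F = Y - F * Y"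
  proof -
    have "g k * F = g k - F * g k" if "k \<in> K" for k
    proof -
      have "g k * F = F' * g k"
        using anticommute[of k n] K[OF that] n stK(2)[OF that] star_swap[of n n k] unfolding gp by (auto simp: g'_other F'_def)
      then show ?thesis by (simp add: F' left_diff_distrib)
    qed
    then have "Y * F = (\<Sum>k\<in>K. t k \<star> (g k - F * g k))" unfolding Y_def sum_distrib_right by (intro sum.cong) auto
    then show ?thesis by (simp add: Y_def smul_diff_right sum_subtractf sum_distrib_left)
  qed
  have ass: "F * (F * x) = F * x" "Y * (F * x) = Y * x - F * (Y * x)" for x
    by (simp_all add: mult.assoc[symmetric] FF YF left_diff_distrib)
  note rules = FF YF ass mult.assoc left_diff_distrib right_diff_distrib distrib_left distrib_right smul_simps
  have "S t * S' t = (a * d) \<star> 1 - Y * Y"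
    unfolding St St' F' by (simp add: rules mult.commute[of d a])
  then have YY: "Y * Y = (a * d) \<star> 1 - 1" using t by (simp add: unit_vector_def algebra_simps)
  then have YYx: "Y * (Y * x) = (a * d) \<star> x - x" for x by (simp add: mult.assoc[symmetric] left_diff_distrib)
  have ab': "a * b = 1" "b * a = 1" using ab by (simp_all add: a_def mult.commute)
  have ba: "b * (a * x) = x" for x using ab'(2) by (metis mult.assoc mult_1)
  have LDU: "S t = (1 + F' * (b \<star> Y)) * (a \<star> F + b \<star> F') * (1 + F * (b \<star> Y))"
    unfolding St F' by (simp add: rules YY YYx ab' ba)
  have "b \<star> Y = (\<Sum>k\<in>K. (- (t k * b)) \<star> g' k)"
  proof -
    have "(\<Sum>k\<in>K. (- (t k * b)) \<star> g' k) = - (b \<star> (\<Sum>k\<in>K. t k \<star> g' k))"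
      by (simp add: smul_sum_right sum_negf mult.commute)
    then show ?thesis by (simp add: Y')
  qed
  moreover have "1 + g p * (\<Sum>k\<in>K. (- (t k * b)) \<star> g' k) \<in> root_group C" if "p = 0 \<or> p = n" for p
  proof (rule sum_root_group)
    show "finite K" by (simp add: K_def)
    show "root_pair p k \<and> - (t k * b) \<in> C" if "k \<in> K" for k
      using K[OF that] stK[OF that] n C(5) \<open>p = 0 \<or> p = n\<close> by (auto simp: root_pair_def)
  qed
  ultimately have "1 + F' * (b \<star> Y) \<in> root_group C" "1 + F * (b \<star> Y) \<in> root_group C" by (simp_all add: F_def F'_def)
  moreover have "a \<star> F + b \<star> F' \<in> root_group C"
    unfolding F_def F'_def using C ab by (intro torus_root_group) (auto simp: a_def)
  ultimately show ?thesis unfolding LDU by (intro root_group_mult)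
qed

section \<open>Dilation and commutation modulo root elements\<close>

lemma dilation:
  assumes P: "subring_set P" and t: "unit_vector t" "\<And>k. k < 2 * n \<Longrightarrow> t k \<in> P" and ab: "t 0 * b = 1"
  shows "\<exists>N. \<forall>s s'. unit_vector s \<longrightarrow> unit_vector s' \<longrightarrow> (\<forall>k<2 * n. s k \<in> P \<and> s' k \<in> P \<and> s k - s' k \<in> pow_mult P (t 0) N)
     \<longrightarrow> (\<exists>e\<in>root_group P. S' s' * S s * S t = e * (S t * (S' s' * S s)))"
proof -
  define a where "a = t 0"
  have aP: "a \<in> P" using t n3 by (simp add: a_def)
  \<comment> \<open>The coefficients of the word for \<open>S t\<close> are divided by
    \<open>a\<close> at most once, so one factor \<open>a\<close> clears all of them. Hence the
    exponent 1 in \<open>Q\<close> below.\<close>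
  define C where "C = {u. a * u \<in> P}"
  have "t 0 * (t k * b) = t k" for k using ab by (metis mult.left_commute mult_1_right)
  then have "S t \<in> root_group C"
    using t ab subring_setD[OF P] aP
    by (intro unit_vector_root_group[OF t(1) ab]) (auto simp: C_def a_def)
  from conj_root_group_word_pair[OF this] obtain m where m: "\<And>A Q s s'. compat A Q C \<Longrightarrow> unit_vector s \<Longrightarrow> unit_vector s'
     \<Longrightarrow> \<forall>k<2 * n. A (s k) (s' k) \<Longrightarrow> word_pair Q m (S s * S t * S' s) (S s' * S t * S' s')" by metis
  define Q where "Q N u v \<longleftrightarrow> a ^ 1 * u \<in> P \<and> a ^ 1 * v \<in> P \<and> a ^ 1 * (u - v) \<in> pow_mult P a N" for N u v
  define A where "A N u v \<longleftrightarrow> u \<in> P \<and> v \<in> P \<and> u - v \<in> pow_mult P a N" for N u v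
  obtain N where N: "\<And>x y. word_pair (Q N) m x y \<Longrightarrow> \<exists>z. y * z = 1 \<and> z * y = 1 \<and> x * z \<in> root_group (pow_mult P a 0)"
    using word_pair_quotient[OF P aP ab[folded a_def], of 1 m 0] unfolding Q_def by blast
  have "compat (A N) (Q N) C"
    unfolding compat_def
  proof (intro conjI allI ballI impI)
    show "A N 1 1" using subring_setD[OF P] pow_multI[of 0 P a N] by (simp add: A_def)
  next
    fix u v assume uv: "A N u v"
    show "Q N u v" using uv aP pow_mult_mult[OF P] subring_setD(4)[OF P] by (auto simp: A_def Q_def)
    show "A N (- u) (- v)" using uv pow_mult_uminus[OF P] subring_setD(5)[OF P] by (fastforce simp: A_def)
    fix u' v' assume uv': "A N u' v'"
    have "u * u' - v * v' = u * (u' - v') + v' * (u - v)" by (simp add: algebra_simps)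
    then show "A N (u * u') (v * v')"
      using uv uv' pow_mult_mult[OF P] pow_mult_add[OF P] subring_setD(4)[OF P] by (auto simp: A_def)
  next
    fix l u v assume l: "l \<in> C" and uv: "A N u v"
    have "a * (l * u) = (a * l) * u" "a * (l * v) = (a * l) * v" "a * (l * u - l * v) = (a * l) * (u - v)"
      by (simp_all add: algebra_simps)
    moreover have "(a * l) * u \<in> P" "(a * l) * v \<in> P" "(a * l) * (u - v) \<in> pow_mult P a N"
      using l uv pow_mult_mult[OF P] subring_setD(4)[OF P] by (auto simp: A_def C_def)
    ultimately show "Q N (l * u) (l * v)" by (simp only: Q_def power_one_right)
  qed
  note word_pair = m[OF this]
  show ?thesis
  proof (intro exI[of _ N] allI impI)
    fix s s' assume s: "unit_vector s" "unit_vector s'" "\<forall>k<2 * n. s k \<in> P \<and> s' k \<in> P \<and> s k - s' k \<in> pow_mult P (t 0) N"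
    let ?x = "S s * S t * S' s" and ?y = "S s' * S t * S' s'"
    have "word_pair (Q N) m ?x ?y" using s by (intro word_pair) (auto simp: A_def a_def)
    then obtain z where z: "?y * z = 1" "z * ?y = 1" "?x * z \<in> root_group (pow_mult P a 0)" using N by blast
    define e where "e = ?x * z"
    have e: "e \<in> root_group P" using root_group_mono[OF z(3) pow_mult_sub[OF P aP]] by (simp add: e_def)
    have "?x = e * ?y" using z(2) by (simp add: e_def mult.assoc)
    \<comment> \<open>Multiplying \<open>?x = e * ?y\<close> by \<open>S' s'\<close> on the left and
      \<open>S s\<close> on the right turns the comparison of two conjugates of \<open>S t\<close>
      into the commutation of \<open>S' s' * S s\<close> with \<open>S t\<close>; the error
      \<open>e\<close> is conjugated by \<open>S' s'\<close> and stays in the root group.\<close>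
    then have "S' s' * ?x * S s = S' s' * (e * ?y) * S s" by simp
    moreover have "S' s' * ?x * S s = S' s' * S s * S t * (S' s * S s)" by (simp only: mult.assoc)
    moreover have "S' s' * (e * ?y) * S s = (S' s' * e * S s') * (S t * (S' s' * S s))" by (simp only: mult.assoc)
    ultimately have "S' s' * S s * S t = (S' s' * e * S s') * (S t * (S' s' * S s))"
      using s by (simp add: unit_vector_def)
    moreover have "S' s' * e * S s' \<in> root_group P" using conj_root_group(2)[OF P s(2) _ e] s by auto
    ultimately show "\<exists>e\<in>root_group P. S' s' * S s * S t = e * (S t * (S' s' * S s))" by blast
  qed
qed

section \<open>Transvections of vectors\<close>

lemma root_elt'_root_group: "root_pair i j \<Longrightarrow> c \<in> C \<Longrightarrow> - c \<in> C \<Longrightarrow> root_elt' i c j \<in> root_group C"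
proof -
  assume a: "root_pair i j" "c \<in> C" "- c \<in> C"
  have "root_elt' i c j = root_elt (flip_index i) (flip_sign i * (flip_sign j * c)) (flip_index j)"
    using root_elt_eq_root_elt'[OF root_pair_flip_index[OF a(1)], of "flip_sign i * (flip_sign j * c)"] by (simp add: mult.assoc mult.left_commute)
  then show ?thesis using a root_pair_flip_index flip_sign_cases[of i] flip_sign_cases[of j] by (auto intro: root_group_root_elt)
qed

lemma root_elt'_inv: assumes "root_pair i j" shows "root_elt' i c j * root_elt' i (- c) j = 1"
proof -
  interpret dual: clifford n smul g' g by (rule dual)
  show ?thesis using dual.root_elt_inv(1)[OF assms] by (simp only: dual.root_elt_def root_elt'_def)
qed

text \<open>The Eichler transvection in the isotropic plane of the basis vectors \<open>i\<close>
  and \<open>k\<close>; it preserves the quadratic form.\<close>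

definition transvect :: "nat \<Rightarrow> 'f \<Rightarrow> nat \<Rightarrow> (nat \<Rightarrow> 'f) \<Rightarrow> nat \<Rightarrow> 'f" where
  "transvect i u k t = t(i := t i + u * t (star n k), k := t k - u * t (star n i))"

lemma sum_update:
  assumes "k < 2 * n" shows "(\<Sum>i<2 * n. (t(k := c)) i \<star> f i) = (\<Sum>i<2 * n. t i \<star> f i) + (c - t k) \<star> f k"
proof -
  have "(\<Sum>i\<in>{..<2 * n} - {k}. (t(k := c)) i \<star> f i) = (\<Sum>i\<in>{..<2 * n} - {k}. t i \<star> f i)"
    by (intro sum.cong) auto
  then show ?thesis using assms
      sum.remove[of "{..<2 * n}" k "\<lambda>i. (t(k := c)) i \<star> f i"] sum.remove[of "{..<2 * n}" k "\<lambda>i. t i \<star> f i"]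
    by (simp add: smul_diff_left)
qed

lemma S_update: "k < 2 * n \<Longrightarrow> S (t(k := c)) = S t + (c - t k) \<star> g k"
  and S'_update: "k < 2 * n \<Longrightarrow> S' (t(k := c)) = S' t + (c - t k) \<star> g' k"
  unfolding S_def S'_def by (rule sum_update; assumption)+

text \<open>Root elements are the spin lifts of transvections. The term quadratic in
  \<open>u\<close> vanishes because \<open>g' k * S t * g' k\<close> is a multiple of
  \<open>g' k\<close>.\<close>

lemma S_transvect:
  assumes ik: "root_pair i k" "i \<noteq> k"
  shows "S (transvect i u k t) = root_elt i u k * S t * root_elt' k u i"
    and "S' (transvect i u k t) = root_elt' k (- u) i * S' t * root_elt i (- u) k"
proof -
  have ix: "i < 2 * n" "k < 2 * n" "k \<noteq> star n i" "i \<noteq> star n k" using ik root_pair_sym[of i k] by (auto simp: root_pair_def)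
  interpret dual: clifford n smul g' g by (rule dual)
  have dual_eqs: "dual.S t = S' t" "dual.S' t = S t" by (simp_all only: dual.S_def dual.S'_def S_def S'_def)
  have 1: "S (transvect i u k t) = S t + (u * t (star n k)) \<star> g i - (u * t (star n i)) \<star> g k"
    using ix ik by (simp add: transvect_def S_update)
  have 2: "S' (transvect i u k t) = S' t + (u * t (star n k)) \<star> g' i - (u * t (star n i)) \<star> g' k"
    using ix ik by (simp add: transvect_def S'_update)
  \<comment> \<open>Kept free of \<open>g\<close>, \<open>g'\<close> and \<open>S\<close> so that it
    yields both claims, the second with the two halves and the indices exchanged and
    \<open>- u\<close> for \<open>u\<close>.\<close>
  have *: "(1 + u \<star> (G i * G' k)) * T * (1 + u \<star> (G' k * G i)) = T + (u * B) \<star> G i - (u * D) \<star> G k"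
    if "G' k * T = B \<star> 1 - T' * G k" "G i * T' = D \<star> 1 - T * G' i" "G k * G' k = 0" "G i * (G' k * G i) = 0" 
      "G' i * G k = - (G' k * G i)" for G G' :: "nat \<Rightarrow> 'm" and T T' B D u i k
  proof -
    have a: "G i * G' k * T + T * (G' k * G i) = B \<star> G i - D \<star> G k"
    proof -
      have "G i * G' k * T = G i * (G' k * T)" by (simp add: mult.assoc)
      also have "\<dots> = B \<star> G i - (G i * T') * G k" unfolding that(1) by (simp add: right_diff_distrib mult.assoc)
      also have "\<dots> = B \<star> G i - D \<star> G k + T * (G' i * G k)" unfolding that(2) by (simp add: left_diff_distrib mult.assoc)
      finally show ?thesis unfolding that(5) by simp
    qed
    have "G i * G' k * T * (G' k * G i) = G i * ((G' k * T) * G' k) * G i" by (simp add: mult.assoc)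
    also have "(G' k * T) * G' k = B \<star> G' k - T' * (G k * G' k)" unfolding that(1) by (simp add: left_diff_distrib mult.assoc)
    finally have b: "G i * G' k * T * (G' k * G i) = 0" using that(3,4) by (simp add: mult.assoc)
    have "(1 + u \<star> (G i * G' k)) * T * (1 + u \<star> (G' k * G i)) = T + u \<star> (G i * G' k * T + T * (G' k * G i)) + (u * u) \<star> (G i * G' k * T * (G' k * G i))"
      by (simp add: distrib_left distrib_right smul_add_right)
    then show ?thesis unfolding a b by (simp add: smul_diff_right)
  qed
  have e: "g' k * S t = t (star n k) \<star> 1 - S' t * g k" "g i * S' t = t (star n i) \<star> 1 - S t * g' i" 
    "g i * S' t = t (star n i) \<star> 1 - S t * g' i" "g' k * S t = t (star n k) \<star> 1 - S' t * g k"
    using g_S[of i t] dual.g_S[of k t] ix by (simp_all add: dual_eqs eq_diff_eq)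
  show "S (transvect i u k t) = root_elt i u k * S t * root_elt' k u i"
    using *[OF e(1,2), of u] root_pair_mid(1)[OF ik(1)] anticommute'[of i k] ix 1
    by (simp add: root_elt_def root_elt'_def)
  show "S' (transvect i u k t) = root_elt' k (- u) i * S' t * root_elt i (- u) k"
    using *[of g i "S' t" "t (star n i)" "S t" g' k "t (star n k)" "- u"] e root_pair_mid(2)[OF root_pair_sym[OF ik(1)]] anticommute[of k i] ix 2
    by (simp add: root_elt_def root_elt'_def)
qed

lemma unit_vector_transvect:
  assumes ik: "root_pair i k" "i \<noteq> k" and t: "unit_vector t"
  shows "unit_vector (transvect i u k t)"
proof -
  have x: "root_elt' k u i * root_elt' k (- u) i = 1" "root_elt' k (- u) i * root_elt' k u i = 1"
    using root_elt'_inv[of k i u] root_elt'_inv[of k i "- u"] root_pair_sym[OF ik(1)] by auto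
  have "root_elt i u k * S t * root_elt' k u i * (root_elt' k (- u) i * S' t * root_elt i (- u) k)
     = root_elt i u k * (S t * (root_elt' k u i * root_elt' k (- u) i) * S' t) * root_elt i (- u) k"
    "root_elt' k (- u) i * S' t * root_elt i (- u) k * (root_elt i u k * S t * root_elt' k u i)
     = root_elt' k (- u) i * (S' t * (root_elt i (- u) k * root_elt i u k) * S t) * root_elt' k u i" by (simp_all only: mult.assoc)
  then show ?thesis using ik x t unfolding unit_vector_def S_transvect[OF ik] by simp
qed

lemma transvect_root_group:
  assumes P: "subring_set P" and u: "u \<in> P" and ik: "root_pair i k" "i \<noteq> k"
    and e: "S (transvect i u k t) \<in> root_group P"
  shows "S t \<in> root_group P"
proof -
  have x1: "root_elt' k u i * root_elt' k (- u) i = 1" using root_elt'_inv root_pair_sym[OF ik(1)] by blast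
  have "root_elt i (- u) k * S (transvect i u k t) * root_elt' k (- u) i
     = (root_elt i (- u) k * root_elt i u k) * S t * (root_elt' k u i * root_elt' k (- u) i)"
    unfolding S_transvect(1)[OF ik] by (simp only: mult.assoc)
  then have "S t = root_elt i (- u) k * S (transvect i u k t) * root_elt' k (- u) i" using x1 ik by simp
  moreover have "root_elt i (- u) k \<in> root_group P" "root_elt' k (- u) i \<in> root_group P"
    using root_group_root_elt root_elt'_root_group root_pair_sym[OF ik(1)] ik(1) u subring_setD(5)[OF P] by auto
  ultimately show ?thesis using e root_group_mult by metis
qed

section \<open>Normalizing and commuting modulo the root group\<close>

context
  fixes P :: "'f set"
  assumes P: "subring_set P"
begin

text \<open>Stated without inverses, since \<open>x\<close> is an arbitrary element of the ring and
  not a member of a group.\<close>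

definition normalizes :: "'m \<Rightarrow> bool" where "normalizes x \<longleftrightarrow> (\<forall>e\<in>root_group P. \<exists>e'\<in>root_group P. x * e = e' * x)"
definition comm :: "'m \<Rightarrow> 'm \<Rightarrow> bool" where "comm x y \<longleftrightarrow> (\<exists>e\<in>root_group P. x * y = e * (y * x))"

lemma normalizes_root_group: "e \<in> root_group P \<Longrightarrow> normalizes e"
  unfolding normalizes_def
proof
  fix d assume "e \<in> root_group P" "d \<in> root_group P"
  moreover from root_group_inv[OF this(1)] obtain f where "f \<in> root_group P" "f * e = 1" using subring_setD(5)[OF P] by blast
  ultimately show "\<exists>e'\<in>root_group P. e * d = e' * e" by (intro bexI[of _ "e * d * f"]) (auto simp: mult.assoc intro: root_group_mult)
qed

lemma normalizes_S:
  assumes "unit_vector s" "\<And>k. k < 2 * n \<Longrightarrow> s k \<in> P" shows "normalizes (S s)" "normalizes (S' s)"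
  unfolding normalizes_def
proof (safe)
  fix e assume e: "e \<in> root_group P"
  have u: "S' s * S s = 1" "S s * S' s = 1" using assms(1) by (auto simp: unit_vector_def)
  show "\<exists>e'\<in>root_group P. S s * e = e' * S s" "\<exists>e'\<in>root_group P. S' s * e = e' * S' s"
    using conj_root_group[OF P assms e] u
    by (auto simp: mult.assoc intro: bexI[of _ "S s * e * S' s"] bexI[of _ "S' s * e * S s"])
qed

lemma normalizes_mult: "normalizes x \<Longrightarrow> normalizes y \<Longrightarrow> normalizes (x * y)"
  unfolding normalizes_def by (metis mult.assoc)

lemma comm_mult_left:
  assumes "normalizes x" "comm x y" "comm x' y" shows "comm (x * x') y"
proof -
  obtain e f where ef: "e \<in> root_group P" "x * y = e * (y * x)" "f \<in> root_group P" "x' * y = f * (y * x')" using assms by (auto simp: comm_def)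
  obtain f' where f': "f' \<in> root_group P" "x * f = f' * x" using assms(1) ef(3) by (auto simp: normalizes_def)
  have "x * x' * y = (x * f) * (y * x')" by (simp add: ef(4) mult.assoc)
  also have "\<dots> = f' * (x * y) * x'" by (simp add: f' mult.assoc)
  finally have "x * x' * y = (f' * e) * (y * (x * x'))" by (simp add: ef(2) mult.assoc)
  then show ?thesis using ef f' by (auto simp: comm_def intro: root_group_mult)
qed

lemma comm_sym: assumes "comm x y" shows "comm y x"
proof -
  obtain e where e: "e \<in> root_group P" "x * y = e * (y * x)" using assms by (auto simp: comm_def)
  obtain f where f: "f \<in> root_group P" "f * e = 1" using root_group_inv[OF e(1)] subring_setD(5)[OF P] by blast
  have "f * (x * y) = y * x" using f e by (simp add: mult.assoc[symmetric])
  then show ?thesis using f unfolding comm_def by (metis)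
qed

lemma comm_mult_right: "normalizes y \<Longrightarrow> comm x y \<Longrightarrow> comm x y' \<Longrightarrow> comm x (y * y')"
  using comm_mult_left comm_sym by blast

lemma comm_root_group: assumes "normalizes x" "e \<in> root_group P" shows "comm x e" "comm e x"
proof -
  obtain e' where e': "e' \<in> root_group P" "x * e = e' * x" using assms by (auto simp: normalizes_def)
  obtain f where f: "f \<in> root_group P" "f * e = 1" using root_group_inv[OF assms(2)] subring_setD(5)[OF P] by blast
  have "x * e = (e' * f) * (e * x)" using f e' by (simp add: mult.assoc) (simp add: mult.assoc[symmetric])
  then show "comm x e" using e' f by (auto simp: comm_def intro: root_group_mult)
  then show "comm e x" by (rule comm_sym)
qed

text \<open>A transvection multiplies \<open>S t\<close> by root elements on both sides, and every
  \<open>x\<close> that normalizes the root group commutes with these modulo the root group.\<close>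

lemma comm_transvect:
  assumes x: "normalizes x" and ik: "root_pair i k" "i \<noteq> k" and u: "u \<in> P"
    and t: "unit_vector t" "\<And>k. k < 2 * n \<Longrightarrow> t k \<in> P"
    and c: "comm x (S (transvect i u k t))"
  shows "comm x (S t)"
proof -
  have x1: "root_elt' k u i * root_elt' k (- u) i = 1" using root_elt'_inv root_pair_sym[OF ik(1)] by blast
  have e: "root_elt i (- u) k \<in> root_group P" "root_elt' k (- u) i \<in> root_group P"
    using root_group_root_elt root_elt'_root_group root_pair_sym[OF ik(1)] ik(1) u subring_setD(5)[OF P] by auto
  have "root_elt i (- u) k * (S (transvect i u k t) * root_elt' k (- u) i)
     = (root_elt i (- u) k * root_elt i u k) * S t * (root_elt' k u i * root_elt' k (- u) i)"
    unfolding S_transvect(1)[OF ik] by (simp only: mult.assoc)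
  then have "S t = root_elt i (- u) k * (S (transvect i u k t) * root_elt' k (- u) i)" using x1 ik by simp
  moreover have "normalizes (S (transvect i u k t))"
  proof (rule normalizes_S(1)[OF unit_vector_transvect[OF ik t(1)]])
    show "transvect i u k t m \<in> P" if "m < 2 * n" for m
      using that ik(1) u t(2) subring_setD[OF P] by (auto simp: transvect_def root_pair_def)
  qed
  ultimately show ?thesis using comm_mult_right comm_root_group(1)[OF x] normalizes_root_group e c by metis
qed

end

text \<open>This is where \<open>1/2\<close> is needed: \<open>[1 + l * g i, 1 + g j] = 1 + 2 * l * g i * g j\<close>. The roots that involve
  the indices \<open>0\<close> and \<open>n\<close> come from a vector \<open>t\<close> that is not symmetric in them.\<close>

lemma root_in_subgroup:
  assumes P: "subring_set P" and half: "h \<in> P" "h + h = 1"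
    and H: "1 \<in> H" "\<And>x y. x \<in> H \<Longrightarrow> y \<in> H \<Longrightarrow> x * y \<in> H"
    and Hinv: "\<And>x. x \<in> H \<Longrightarrow> \<exists>y\<in>H. y * x = 1"
    and HS: "\<And>t. unit_vector t \<Longrightarrow> (\<And>k. k < 2 * n \<Longrightarrow> t k \<in> P) \<Longrightarrow> t 0 = 1 \<Longrightarrow> S t \<in> H"
    and ij: "root_pair i j" and c: "c \<in> P"
  shows "root_elt i c j \<in> H"
proof -
  have n0: "0 < n" "n \<noteq> 0" "0 < 2 * n" "n < 2 * n" using n3 by auto
  have st0: "star n 0 = n" "star n n = 0" using n0 by (auto simp: star_def)
  have ng: "g' k = - g k" if "k < 2 * n" "k \<noteq> 0" "k \<noteq> n" for k using that by (rule g'_other)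
  have Se: "S (\<lambda>k. if k = 0 \<or> k = n then 1 else 0) = 1" "S' (\<lambda>k. if k = 0 \<or> k = n then 1 else 0) = 1"
  proof -
    have s: "(\<Sum>i<2 * n. (if i = 0 \<or> i = n then 1 else 0) \<star> f i) = f 0 + f n" for f
      using n0 by (subst sum.subset_diff[of "{0, n}"]) auto
    show "S (\<lambda>k. if k = 0 \<or> k = n then 1 else 0) = 1" "S' (\<lambda>k. if k = 0 \<or> k = n then 1 else 0) = 1"
      using g_sum by (simp_all add: S_def S'_def s g'_0 g'_n add.commute)
  qed
  let ?e = "\<lambda>k. if k = 0 \<or> k = n then 1 else 0 :: 'f"
  have sq: "g k * g k = 0" if "k < 2 * n" "k \<noteq> 0" "k \<noteq> n" for k using iso(1)[OF that(1)] ng[OF that] by simp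
  have unip: "1 + c \<star> g k \<in> H" if k: "k < 2 * n" "k \<noteq> 0" "k \<noteq> n" and c: "c \<in> P" for k c
  proof -
    have u: "S (?e(k := c)) = 1 + c \<star> g k" "S' (?e(k := c)) = 1 - c \<star> g k"
      using k ng[OF k] by (simp_all add: S_update S'_update Se)
    then have "unit_vector (?e(k := c))"
      using sq[OF k] by (simp add: unit_vector_def distrib_right left_diff_distrib right_diff_distrib distrib_left)
    then show ?thesis using HS[of "?e(k := c)"] k c subring_setD[OF P] unfolding u by auto
  qed
  have inner: "root_elt i c j \<in> H" if ij: "root_pair i j" "i \<noteq> 0" "i \<noteq> n" "j \<noteq> 0" "j \<noteq> n" and c: "c \<in> P" for i j c
  proof -
    have ix: "i < 2 * n" "j < 2 * n" "j \<noteq> star n i" using ij by (auto simp: root_pair_def)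
    have ac: "g j * g i = - (g i * g j)" using anticommute[of i j] ix ij ng by simp
    have acz: "g j * (g i * z) = - (g i * (g j * z))" "g i * (g i * z) = 0" "g j * (g j * z) = 0" for z
      using ac sq ix ij by (simp_all add: mult.assoc[symmetric])
    \<comment> \<open>Since \<open>g' j = - g j\<close>, the target is 1 minus \<open>c\<close>
      times \<open>g i * g j\<close>, so the commutator, which doubles \<open>l\<close>, must give
      \<open>l + l = - c\<close>.\<close>
    let ?l = "- (h * c)"
    have "(1 + l \<star> g i) * (1 + 1 \<star> g j) * (1 + (- l) \<star> g i) * (1 + (- 1) \<star> g j) = 1 + (l + l) \<star> (g i * g j)" for l
      unfolding smul_add_left using sq ix ij
      by (simp add: distrib_left distrib_right left_diff_distrib right_diff_distrib mult.assoc ac acz smul_add_right smul_diff_right)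
    note this[of ?l]
    also have "?l + ?l = - c" using half(2) by (metis distrib_right minus_add_distrib mult_1)
    also have "1 + (- c) \<star> (g i * g j) = root_elt i c j" using ng ix ij by (simp add: root_elt_def)
    finally have "root_elt i c j = (1 + ?l \<star> g i) * (1 + 1 \<star> g j) * (1 + (- ?l) \<star> g i) * (1 + (- 1) \<star> g j)" ..
    also have "\<dots> \<in> H" by (intro H(2) unip) (use ix ij half c subring_setD[OF P] in auto)
    finally show ?thesis .
  qed
  have outer: "root_elt m c n \<in> H" "root_elt m c 0 \<in> H" if m: "m < 2 * n" "m \<noteq> 0" "m \<noteq> n" and c: "c \<in> P" for m c
  proof -
    \<comment> \<open>A hyperbolic pair \<open>p\<close>, \<open>q\<close> apart from that of 0 and
      from that of \<open>m\<close>.\<close>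
    define p where "p = (if m = 1 \<or> m = n + 1 then 2 else 1 :: nat)"
    define q where "q = p + n"
    have p: "p < n" "p \<noteq> 0" "p \<noteq> m" "q \<noteq> m" "q < 2 * n" "q \<noteq> 0" "q \<noteq> n" "p \<noteq> n" "p < 2 * n" "p \<noteq> q"
      "star n p = q" "star n q = p" using n3 by (auto simp: p_def q_def star_def)
    have sm: "star n m \<noteq> 0" "star n m \<noteq> n" "star n m \<noteq> p" "star n m \<noteq> q" "star n m \<noteq> m"
      using m p n0 by (auto simp: star_def split: if_splits)
    define F where "F = g 0"
    have gn: "g n = 1 - F" using g_sum by (simp add: F_def eq_diff_eq add.commute)
    have FF: "F * F = F" using iso(1)[OF n0(3)] unfolding g'_0 gn by (simp add: F_def[symmetric] right_diff_distrib)
    have r: "g k * F = g k - F * g k" if "k < 2 * n" "k \<noteq> 0" "k \<noteq> n" for k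
    proof -
      have "0 \<noteq> star n k" using that n0 by (auto simp: star_def)
      then have h: "g k - g k * F = F * g k" using anticommute[of k 0] that n0 ng[OF that] unfolding g'_0 gn
        by (simp add: F_def right_diff_distrib)
      have "g k * F = g k - (g k - g k * F)" by simp
      then show ?thesis unfolding h .
    qed
    have pq: "g q * g p = - 1 - g p * g q"
    proof -
      have "- (g p * g q) - g q * g p = 1" using rel[of p q] p ng by simp
      moreover have "g q * g p = - (- (g p * g q) - g q * g p) - g p * g q" by simp
      ultimately show ?thesis by metis
    qed
    have mp: "g m * g p = - (g p * g m)" "g m * g q = - (g q * g m)"
      using anticommute[of p m] anticommute[of q m] p m ng by auto
    have s0: "g p * g p = 0" "g q * g q = 0" "g m * g m = 0" using sq p m by auto
    note r' = r[OF m] r[OF p(9,2,8)] r[OF p(5,6,7)]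
    have ass: "g p * (g p * z) = 0" "g q * (g q * z) = 0" "g m * (g m * z) = 0" "F * (F * z) = F * z"
       "g m * (g p * z) = - (g p * (g m * z))" "g m * (g q * z) = - (g q * (g m * z))" "g q * (g p * z) = - z - g p * (g q * z)"
       "g m * (F * z) = g m * z - F * (g m * z)" "g p * (F * z) = g p * z - F * (g p * z)" "g q * (F * z) = g q * z - F * (g q * z)" for z
      by (simp_all add: mult.assoc[symmetric] s0 FF mp pq r' left_diff_distrib)
    note rules = s0 FF mp pq r' ass mult.assoc left_diff_distrib right_diff_distrib distrib_left distrib_right smul_simps
    \<comment> \<open>The pair \<open>p\<close>, \<open>q\<close> alone contributes 1 to the form,
      so the entry at \<open>n\<close> can be 0 while the entry at 0 is 1. This is the asymmetry
      that separates \<open>g 0\<close> from \<open>g n\<close>.\<close>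
    define t where "t d = ?e(p := 1, q := 1, n := 0, m := - d)" for d
    have St: "S (t d) = F + g p + g q - d \<star> g m" "S' (t d) = 1 - F - g p - g q + d \<star> g m" for d
      using m p n0 ng gn unfolding t_def by (simp_all add: S_update S'_update Se g'_n F_def)
    have ut: "unit_vector (t d)" for d
      unfolding unit_vector_def St by (simp add: rules)
    have tP: "t d k \<in> P" if "d \<in> P" for d k using that subring_setD[OF P] by (auto simp: t_def)
    have tH: "S (t d) \<in> H" if "d \<in> P" for d
    proof (rule HS[OF ut tP[OF that]])
      show "t d 0 = 1" using m p n0 by (simp add: t_def)
    qed
    have "S' (t 0) \<in> H"
    proof -
      obtain y where y: "y \<in> H" "y * S (t 0) = 1" using Hinv tH subring_setD(1)[OF P] by blast
      have "y = y * (S (t 0) * S' (t 0))" using ut[of 0] by (simp add: unit_vector_def)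
      also have "\<dots> = S' (t 0)" using y(2) by (simp add: mult.assoc[symmetric])
      finally show ?thesis using y by simp
    qed
    have gd: "root_pair m p" "root_pair m q" using m p sm by (auto simp: root_pair_def)
    have mn: "root_elt m d n \<in> H" if d: "d \<in> P" for d
    proof -
      \<comment> \<open>\<open>S (t d)\<close> is \<open>S (t 0)\<close> minus \<open>d\<close>
        times \<open>g m\<close>, so its product with \<open>S' (t 0)\<close> is 1 minus
        \<open>d\<close> times \<open>g m * (1 - F - g p - g q)\<close>. The other three factors
        cancel every term but \<open>g m * F\<close>.\<close>
      have "S (t d) * S' (t 0) * ((1 + d \<star> g m) * (root_elt m d p * root_elt m d q)) = root_elt m d n"
        unfolding St root_elt_def g'_n using ng p by (simp add: rules F_def[symmetric])
      moreover have "S (t d) * S' (t 0) * ((1 + d \<star> g m) * (root_elt m d p * root_elt m d q)) \<in> H"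
        by (intro H(2) tH d \<open>S' (t 0) \<in> H\<close> unip inner gd m p(2,8,6,7))
      ultimately show ?thesis by simp
    qed
    then show "root_elt m c n \<in> H" using c .
    have "(1 + c \<star> g m) * root_elt m (- c) n = root_elt m c 0"
      unfolding root_elt_def g'_n g'_0 gn by (simp add: rules F_def[symmetric])
    then show "root_elt m c 0 \<in> H" using H(2)[OF unip[OF m c] mn[OF subring_setD(5)[OF P c]]] by simp
  qed
  consider "i = j" | "i \<noteq> 0" "i \<noteq> n" "j \<noteq> 0" "j \<noteq> n" | "i \<noteq> 0" "i \<noteq> n" "j = 0 \<or> j = n" | "j \<noteq> 0" "j \<noteq> n" "i = 0 \<or> i = n"
    using ij st0 unfolding root_pair_def by metis
  then show ?thesis
  proof cases
    case 1 then show ?thesis using ij H(1) by (simp add: root_pair_def)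
  next
    case 2 then show ?thesis using inner ij c by blast
  next
    case 3 then show ?thesis using outer ij c by (auto simp: root_pair_def)
  next
    case 4
    then have "root_elt j (- c) i \<in> H" using outer ij subring_setD(5)[OF P c] by (auto simp: root_pair_def)
    then show ?thesis using root_elt_swap[OF ij] by simp
  qed
qed

end

section \<open>Matrices as operators on sequences\<close>

text \<open>Square matrices of a size that is not a type form no instance of class \<open>ring_1\<close>. Letting them act
  on all consecutive blocks of a sequence embeds them into one, with unit going to unit.\<close>

typedef (overloaded) 'f lin = "{f :: (nat \<Rightarrow> 'f::comm_ring_1) \<Rightarrow> nat \<Rightarrow> 'f.
    (\<forall>x y. f (\<lambda>i. x i + y i) = (\<lambda>i. f x i + f y i)) \<and> (\<forall>c x. f (\<lambda>i. c * x i) = (\<lambda>i. c * f x i))}"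
  morphisms app Lin
  by (rule exI[of _ "\<lambda>x i. 0"]) auto

lemma app_lin: "app f (\<lambda>i. x i + y i) i = app f x i + app f y i" "app f (\<lambda>i. c * x i) i = c * app f x i"
  using app[of f] by auto

lemma lin_eqI: "(\<And>x i. app f x i = app g x i) \<Longrightarrow> f = g"
  by (metis app_inject ext)

instantiation lin :: (comm_ring_1) ring_1
begin

definition "0 = Lin (\<lambda>x i. 0)"
definition "1 = Lin (\<lambda>x. x)"
definition "f + g = Lin (\<lambda>x i. app f x i + app g x i)"
definition "f - g = Lin (\<lambda>x i. app f x i - app g x i)"
definition "- f = Lin (\<lambda>x i. - app f x i)"
definition "f * g = Lin (\<lambda>x. app f (app g x))"

lemma app_simps [simp]:
  "app 0 x i = 0" "app 1 x = x" "app (f + g) x i = app f x i + app g x i"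
  "app (f - g) x i = app f x i - app g x i" "app (- f) x i = - app f x i" "app (f * g) x = app f (app g x)"
proof -
  have "app f (app g (\<lambda>i. x i + y i)) = (\<lambda>i. app f (app g x) i + app f (app g y) i)"
    "app f (app g (\<lambda>i. c * x i)) = (\<lambda>i. c * app f (app g x) i)" for x y c
    using app[of f] app[of g] by auto
  then show "app (f * g) x = app f (app g x)" by (simp add: times_lin_def Lin_inverse)
qed (auto simp: zero_lin_def one_lin_def plus_lin_def minus_lin_def uminus_lin_def Lin_inverse app_lin algebra_simps)

instance
proof
  show "(0 :: 'a lin) \<noteq> 1"
  proof
    assume "(0 :: 'a lin) = 1"
    then have "app (0 :: 'a lin) (\<lambda>_. 1) 0 = app 1 (\<lambda>_. 1) 0" by simp
    then show False by simp
  qed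
  show "(a + b) * c = a * c + b * c" "a * (b + c) = a * b + a * c" for a b c :: "'a lin"
  proof -
    have "app (b + c) x = (\<lambda>i. app b x i + app c x i)" for x by auto
    then show "(a + b) * c = a * c + b * c" "a * (b + c) = a * b + a * c"
      by (auto intro!: lin_eqI simp: app_lin)
  qed
qed (auto intro!: lin_eqI)

end

definition lin_smul :: "'f::comm_ring_1 \<Rightarrow> 'f lin \<Rightarrow> 'f lin" where
  "lin_smul c f = Lin (\<lambda>x i. c * app f x i)"

lemma app_smul [simp]: "app (lin_smul c f) x i = c * app f x i"
  by (auto simp: lin_smul_def Lin_inverse app_lin algebra_simps)

lemma lin_smul:
  "lin_smul c (f + g) = lin_smul c f + lin_smul c g" "lin_smul (c + d) f = lin_smul c f + lin_smul d f"
  "lin_smul c (lin_smul d f) = lin_smul (c * d) f" "lin_smul 1 f = f"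
  "lin_smul c f * g = lin_smul c (f * g)" "f * lin_smul c g = lin_smul c (f * g)"
proof -
  have "app (lin_smul c g) x = (\<lambda>i. c * app g x i)" for x by auto
  then show "f * lin_smul c g = lin_smul c (f * g)" by (auto intro!: lin_eqI simp: app_lin)
qed (auto intro!: lin_eqI simp: algebra_simps)

context comm_ring_hom begin

text \<open>The entries pass through \<open>hom\<close>, so that a matrix over the small ring
  becomes an operator over the large one; \<open>D * (i div D)\<close> is the start of the block
  that contains \<open>i\<close>.\<close>

definition op_mat :: "nat \<Rightarrow> 'a mat \<Rightarrow> 'b lin" where
  "op_mat D M = Lin (\<lambda>x i. \<Sum>j<D. hom (M $$ (i mod D, j)) * x (D * (i div D) + j))"

lemma app_op_mat: "app (op_mat D M) x i = (\<Sum>j<D. hom (M $$ (i mod D, j)) * x (D * (i div D) + j))"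
proof -
  have "app (op_mat D M) = (\<lambda>x i. \<Sum>j<D. hom (M $$ (i mod D, j)) * x (D * (i div D) + j))"
    unfolding op_mat_def
    by (rule Lin_inverse) (auto simp: algebra_simps sum.distrib sum_distrib_left)
  then show ?thesis by simp
qed

lemma op_mat_simps:
  assumes D: "0 < D" and M: "M \<in> carrier_mat D D" and N: "N \<in> carrier_mat D D"
  shows "op_mat D (M + N) = op_mat D M + op_mat D N" "op_mat D (M * N) = op_mat D M * op_mat D N"
    "op_mat D (c \<cdot>\<^sub>m M) = lin_smul (hom c) (op_mat D M)"
proof -
  show "op_mat D (M + N) = op_mat D M + op_mat D N"
    using assms by (auto intro!: lin_eqI simp: app_op_mat hom_add algebra_simps sum.distrib)
  show "op_mat D (c \<cdot>\<^sub>m M) = lin_smul (hom c) (op_mat D M)"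
    using assms by (auto intro!: lin_eqI simp: app_op_mat hom_mult algebra_simps sum_distrib_left)
  show "op_mat D (M * N) = op_mat D M * op_mat D N"
  proof (rule lin_eqI)
    fix x i
    have "(M * N) $$ (i mod D, j) = (\<Sum>k<D. M $$ (i mod D, k) * N $$ (k, j))" if "j < D" for j
      using that assms by (auto simp: scalar_prod_def atLeast0LessThan)
    then have "app (op_mat D (M * N)) x i
       = (\<Sum>j<D. \<Sum>k<D. hom (M $$ (i mod D, k)) * (hom (N $$ (k, j)) * x (D * (i div D) + j)))"
      by (simp add: app_op_mat hom_sum hom_mult sum_distrib_right mult.assoc)
    also have "\<dots> = (\<Sum>k<D. \<Sum>j<D. hom (M $$ (i mod D, k)) * (hom (N $$ (k, j)) * x (D * (i div D) + j)))"
      by (rule sum.swap)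
    also have "\<dots> = app (op_mat D M * op_mat D N) x i"
      by (simp add: app_op_mat sum_distrib_left)
    finally show "app (op_mat D (M * N)) x i = app (op_mat D M * op_mat D N) x i" .
  qed
qed

lemma op_mat_one: "0 < D \<Longrightarrow> op_mat D (1\<^sub>m D) = 1"
proof (rule lin_eqI)
  fix x :: "nat \<Rightarrow> 'b" and i assume D: "0 < D"
  have "app (op_mat D (1\<^sub>m D)) x i = (\<Sum>j<D. if i mod D = j then x (D * (i div D) + j) else 0)"
    unfolding app_op_mat using D by (intro sum.cong) auto
  then show "app (op_mat D (1\<^sub>m D)) x i = app 1 x i" using D by simp
qed

end

lemma (in inj_comm_ring_hom) op_mat_inj:
  assumes M: "M \<in> carrier_mat D D" and N: "N \<in> carrier_mat D D" and eq: "op_mat D M = op_mat D N"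
  shows "M = N"
proof (rule eq_matI)
  fix i j assume ij: "i < dim_row N" "j < dim_col N"
  have "app (op_mat D K) (\<lambda>k. if k = j then 1 else 0) i = hom (K $$ (i, j))" for K
    using ij N by (simp add: app_op_mat if_distrib cong: if_cong)
  then have "hom (M $$ (i, j)) = hom (N $$ (i, j))" using eq by metis
  then show "M $$ (i, j) = N $$ (i, j)" by simp
qed (use M N in auto)

section \<open>Linearity and transposition of Suslin matrices, quotient groups, elementary
  rows\<close>

lemma vec_last_carrier: "vec_last v n \<in> carrier_vec n" by (simp add: vec_last_def)

lemma suslin_add:
  fixes v w :: "'a::comm_ring_1 vec"
  assumes "v \<in> carrier_vec (r + 1)" "w \<in> carrier_vec (r + 1)" "v' \<in> carrier_vec (r + 1)" "w' \<in> carrier_vec (r + 1)"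
  shows "suslin r (v + v') (w + w') = suslin r v w + suslin r v' w'"
  using assms
proof (induction r arbitrary: v w v' w')
  case 0
  then show ?case by (auto intro!: eq_matI)
next
  case (Suc r)
  have l: "vec_last (v + v') (Suc r) = vec_last v (Suc r) + vec_last v' (Suc r)"
    "vec_last (w + w') (Suc r) = vec_last w (Suc r) + vec_last w' (Suc r)"
    using Suc.prems by (auto simp: vec_last_def intro!: eq_vecI)
  have s: "suslin r (vec_last v (Suc r) + vec_last v' (Suc r)) (vec_last w (Suc r) + vec_last w' (Suc r))
      = suslin r (vec_last v (Suc r)) (vec_last w (Suc r)) + suslin r (vec_last v' (Suc r)) (vec_last w' (Suc r))"
    "suslin r (vec_last w (Suc r) + vec_last w' (Suc r)) (vec_last v (Suc r) + vec_last v' (Suc r))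
      = suslin r (vec_last w (Suc r)) (vec_last v (Suc r)) + suslin r (vec_last w' (Suc r)) (vec_last v' (Suc r))"
    by (rule Suc.IH; simp add: vec_last_carrier)+
  note c = suslin_carrier[of r "vec_last v (Suc r)" "vec_last w (Suc r)"] suslin_carrier[of r "vec_last v' (Suc r)" "vec_last w' (Suc r)"]
     suslin_carrier[of r "vec_last w (Suc r)" "vec_last v (Suc r)"] suslin_carrier[of r "vec_last w' (Suc r)" "vec_last v' (Suc r)"]
  show ?case
    unfolding suslin.simps l s using Suc.prems c
    by (subst add_four_block_mat[where ?nr1.0 = "2 ^ r" and ?nc1.0 = "2 ^ r" and ?nr2.0 = "2 ^ r" and ?nc2.0 = "2 ^ r"])
      (auto intro!: arg_cong4[of _ _ _ _ _ _ _ _ four_block_mat] eq_matI)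
qed

lemma suslin_smult:
  fixes v w :: "'a::comm_ring_1 vec"
  assumes "v \<in> carrier_vec (r + 1)" "w \<in> carrier_vec (r + 1)"
  shows "suslin r (c \<cdot>\<^sub>v v) (c \<cdot>\<^sub>v w) = c \<cdot>\<^sub>m suslin r v w"
  using assms
proof (induction r arbitrary: v w)
  case 0
  then show ?case by (auto intro!: eq_matI)
next
  case (Suc r)
  have l: "vec_last (c \<cdot>\<^sub>v v) (Suc r) = c \<cdot>\<^sub>v vec_last v (Suc r)" "vec_last (c \<cdot>\<^sub>v w) (Suc r) = c \<cdot>\<^sub>v vec_last w (Suc r)"
    using Suc.prems by (auto simp: vec_last_def intro!: eq_vecI)
  note s = Suc.IH[of "vec_last v (Suc r)" "vec_last w (Suc r)"] Suc.IH[of "vec_last w (Suc r)" "vec_last v (Suc r)"]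
  note c = suslin_carrier[of r "vec_last v (Suc r)" "vec_last w (Suc r)"] suslin_carrier[of r "vec_last w (Suc r)" "vec_last v (Suc r)"]
  show ?case
    using Suc.prems c s
    by (auto simp: l vec_last_carrier carrier_matD intro!: eq_matI simp del: smult_four_block_mat)
qed

text \<open>The conjugate of a Suslin matrix is again a Suslin matrix, with the first entries of the
  two rows exchanged and all others negated. This is the source of the assumptions
  \<open>g'_0\<close>, \<open>g'_n\<close> and \<open>g'_other\<close>.\<close>

lemma transpose_suslin:
  fixes v w :: "'a::comm_ring_1 vec"
  assumes "v \<in> carrier_vec (Suc r + 1)" "w \<in> carrier_vec (Suc r + 1)"
  shows "transpose_mat (suslin (Suc r) w v)
    = suslin (Suc r) (vec (Suc r + 1) (\<lambda>i. if i = 0 then w $ 0 else - v $ i)) (vec (Suc r + 1) (\<lambda>i. if i = 0 then v $ 0 else - w $ i))"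
proof -
  let ?v = "vec_last v (Suc r)" and ?w = "vec_last w (Suc r)"
  have l: "vec_last (vec (Suc r + 1) (\<lambda>i. if i = 0 then w $ 0 else - v $ i)) (Suc r) = (- 1) \<cdot>\<^sub>v ?v"
    "vec_last (vec (Suc r + 1) (\<lambda>i. if i = 0 then v $ 0 else - w $ i)) (Suc r) = (- 1) \<cdot>\<^sub>v ?w"
    using assms by (auto simp: vec_last_def intro!: eq_vecI)
  note c = suslin_carrier[of r ?v ?w] suslin_carrier[of r ?w ?v]
  have s: "suslin r ((- 1) \<cdot>\<^sub>v ?v) ((- 1) \<cdot>\<^sub>v ?w) = (- 1) \<cdot>\<^sub>m suslin r ?v ?w"
    "suslin r ((- 1) \<cdot>\<^sub>v ?w) ((- 1) \<cdot>\<^sub>v ?v) = (- 1) \<cdot>\<^sub>m suslin r ?w ?v"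
    by (rule suslin_smult; simp add: vec_last_carrier)+
  show ?thesis unfolding suslin.simps l s using c
    by (subst transpose_four_block_mat[of _ "2 ^ r" "2 ^ r" _ "2 ^ r" _ "2 ^ r"])
      (auto intro!: arg_cong4[of _ _ _ _ _ _ _ _ four_block_mat] eq_matI)
qed

text \<open>The hypotheses have the inverse-free form of \<open>normalizes\<close> and
  \<open>comm\<close>; normality of \<open>H\<close> is derived from the first of them.\<close>

lemma (in group) comm_group_factor:
  assumes S: "subgroup S G" and H: "subgroup H G" "H \<subseteq> S"
    and norm: "\<And>x h. x \<in> S \<Longrightarrow> h \<in> H \<Longrightarrow> \<exists>d\<in>H. x \<otimes> h = d \<otimes> x"
    and comm: "\<And>x y. x \<in> S \<Longrightarrow> y \<in> S \<Longrightarrow> \<exists>d\<in>H. x \<otimes> y = d \<otimes> (y \<otimes> x)"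
  shows "comm_group (G\<lparr>carrier := S\<rparr> Mod H)"
proof -
  let ?G' = "G\<lparr>carrier := S\<rparr>"
  interpret G': group ?G' by (rule subgroup.subgroup_is_group[OF S group_axioms])
  have sub: "subgroup H ?G'" by (rule subgroup_incl[OF H(1) S H(2)])
  have c: "x \<in> S \<Longrightarrow> x \<in> carrier G" for x using subgroup.subset[OF S] by blast
  have m: "x \<in> S \<Longrightarrow> y \<in> S \<Longrightarrow> x \<otimes> y \<in> S" for x y by (rule subgroup.m_closed[OF S])
  have "normal H ?G'"
  proof (rule G'.normal_invI[OF sub])
    fix x h assume "x \<in> carrier ?G'" and h: "h \<in> H"
    then have x: "x \<in> S" by simp
    obtain d where d: "d \<in> H" "x \<otimes> h = d \<otimes> x" using norm[OF x h] by blast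
    have i: "inv\<^bsub>?G'\<^esub> x = inv x" by (rule m_inv_consistent[OF S x])
    have dc: "d \<in> carrier G" using d H(2) c by blast
    have "d \<otimes> x \<otimes> inv x = d" using dc c[OF x] by (simp add: m_assoc)
    then show "x \<otimes>\<^bsub>?G'\<^esub> h \<otimes>\<^bsub>?G'\<^esub> inv\<^bsub>?G'\<^esub> x \<in> H" using d by (simp add: i)
  qed
  then interpret N: normal H ?G' .
  show ?thesis
  proof (rule group.group_comm_groupI[OF N.factorgroup_is_group])
    fix A B assume "A \<in> carrier (?G' Mod H)" "B \<in> carrier (?G' Mod H)"
    then obtain a b where ab: "a \<in> S" "b \<in> S" "A = H #>\<^bsub>?G'\<^esub> a" "B = H #>\<^bsub>?G'\<^esub> b"
      by (auto simp: FactGroup_def RCOSETS_def)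
    obtain d where d: "d \<in> H" "a \<otimes> b = d \<otimes> (b \<otimes> a)" using comm[OF ab(1,2)] by blast
    then have "a \<otimes> b \<in> H #>\<^bsub>?G'\<^esub> (b \<otimes> a)" by (auto simp: r_coset_def)
    moreover have "b \<otimes> a \<in> carrier ?G'" using m[OF ab(2,1)] by simp
    ultimately have "H #>\<^bsub>?G'\<^esub> (b \<otimes> a) = H #>\<^bsub>?G'\<^esub> (a \<otimes> b)" by (rule G'.repr_independence[OF _ _ sub])
    moreover have "A \<otimes>\<^bsub>?G' Mod H\<^esub> B = H #>\<^bsub>?G'\<^esub> (a \<otimes> b)" "B \<otimes>\<^bsub>?G' Mod H\<^esub> A = H #>\<^bsub>?G'\<^esub> (b \<otimes> a)"
      using N.rcos_sum[of a b] N.rcos_sum[of b a] ab by (simp_all add: FactGroup_def)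
    ultimately show "A \<otimes>\<^bsub>?G' Mod H\<^esub> B = B \<otimes>\<^bsub>?G' Mod H\<^esub> A" by simp
  qed
qed

lemma mat_of_row_inject: assumes "mat_of_row v = mat_of_row w" shows "v = w"
proof -
  have "row (mat_of_row v) 0 = row (mat_of_row w) 0" by (simp only: assms)
  then show ?thesis by (simp only: row_mat_of_row)
qed

lemma row_mat_carrier:
  assumes "M \<in> carrier_mat 1 n"
  shows "mat_of_row (row M 0) = M" "row M 0 \<in> carrier_vec n"
proof -
  show "row M 0 \<in> carrier_vec n" using row_carrier_vec[of 0 1 M n] assms by simp
  show "mat_of_row (row M 0) = M" using assms by (intro eq_matI) (auto simp: mat_of_row_def)
qed

lemma GL_simps:
  "carrier (GL D) \<subseteq> carrier_mat D D" "x \<otimes>\<^bsub>GL D\<^esub> y = x * y" "\<one>\<^bsub>GL D\<^esub> = 1\<^sub>m D"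
  by (auto simp: GL_def units_of_def Units_def ring_mat_def)

lemma elem_group_GL: "elem_group n \<subseteq> carrier (GL n :: 'a::comm_ring_1 mat monoid)"
  unfolding elem_group_def
  by (rule group.generate_incl[OF group_GL]) (auto intro: addrow_mat_in_GL)

lemma row_times_addrow:
  fixes v :: "'a::comm_ring_1 vec"
  assumes v: "v \<in> carrier_vec n" and kl: "k < n" "l < n"
  shows "mat_of_row v * addrow_mat n a k l = mat_of_row (vec n (\<lambda>j. v $ j + (if j = l then a * v $ k else 0)))"
proof (rule eq_matI)
  fix i j assume "i < dim_row (mat_of_row (vec n (\<lambda>j. v $ j + (if j = l then a * v $ k else 0))))"
    "j < dim_col (mat_of_row (vec n (\<lambda>j. v $ j + (if j = l then a * v $ k else 0))))"
  then have ij: "i = 0" "j < n" by (auto simp: mat_of_row_def)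
  have "(mat_of_row v * addrow_mat n a k l) $$ (i, j) = (\<Sum>m<n. v $ m * ((if m = j then 1 else 0) + (if m = k then (if j = l then a else 0) else 0)))"
  proof -
    have "addrow_mat n a k l $$ (m, j) = (if m = j then 1 else 0) + (if m = k then (if j = l then a else 0) else 0)" if "m < n" for m
      using that ij kl by (auto simp: addrow_mat_def add.commute)
    moreover have "(mat_of_row v * addrow_mat n a k l) $$ (i, j) = (\<Sum>m<n. v $ m * addrow_mat n a k l $$ (m, j))"
      using ij v by (simp add: scalar_prod_def atLeast0LessThan mat_of_row_def)
    ultimately show ?thesis by simp
  qed
  also have "\<dots> = v $ j + (if j = l then a * v $ k else 0)"
    using ij kl by (simp add: distrib_left sum.distrib if_distrib[of "\<lambda>x. _ * x"] mult.commute[of a] cong: if_cong)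
  finally show "(mat_of_row v * addrow_mat n a k l) $$ (i, j) = mat_of_row (vec n (\<lambda>j. v $ j + (if j = l then a * v $ k else 0))) $$ (i, j)"
    using ij by (simp add: mat_of_row_def)
qed (use v in \<open>auto simp: mat_of_row_def\<close>)

lemma elementary_completion:
  fixes v :: "'a::comm_ring_1 vec"
  assumes v: "v \<in> carrier_vec (r + 1)" "v $ 0 = 1"
  shows "\<exists>\<epsilon>\<in>elem_group (r + 1). mat_of_row v = mat_of_row (unit_vec (r + 1) 0) * \<epsilon>"
proof -
  \<comment> \<open>The row is filled in from the left: each new entry is a multiple of the first
    one, which is 1.\<close>
  have "\<exists>\<epsilon>\<in>elem_group (r + 1). mat_of_row (vec (r + 1) (\<lambda>j. if j \<le> m then v $ j else 0)) = mat_of_row (unit_vec (r + 1) 0) * \<epsilon>"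
    if "m \<le> r" for m
    using that
  proof (induction m)
    case 0
    have "vec (r + 1) (\<lambda>j. if j \<le> 0 then v $ j else 0) = unit_vec (r + 1) 0" using v by auto
    moreover have "(1\<^sub>m (r + 1) :: 'a mat) \<in> elem_group (r + 1)"
      unfolding elem_group_def using generate.one[of "GL (r + 1)"] by (simp add: GL_simps)
    ultimately show ?case by (intro bexI[of _ "1\<^sub>m (r + 1)"]) (auto simp: mat_of_row_def)
  next
    case (Suc m)
    then obtain \<epsilon> where e: "\<epsilon> \<in> elem_group (r + 1)"
      "mat_of_row (vec (r + 1) (\<lambda>j. if j \<le> m then v $ j else 0)) = mat_of_row (unit_vec (r + 1) 0) * \<epsilon>" by auto
    let ?A = "addrow_mat (r + 1) (v $ Suc m) 0 (Suc m)"
    have A: "?A \<in> elem_group (r + 1)" unfolding elem_group_def using Suc by (intro generate.incl) force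
    have "mat_of_row (vec (r + 1) (\<lambda>j. if j \<le> Suc m then v $ j else 0)) = mat_of_row (vec (r + 1) (\<lambda>j. if j \<le> m then v $ j else 0)) * ?A"
      using Suc v by (subst row_times_addrow) (auto simp: le_Suc_eq intro!: arg_cong[where f = mat_of_row])
    also have "\<dots> = mat_of_row (unit_vec (r + 1) 0) * (\<epsilon> * ?A)"
      unfolding e(2) using e(1) A elem_group_GL[of "r + 1", where ?'a = 'a] GL_simps(1)[of "r + 1", where ?'a = 'a]
      by (intro assoc_mult_mat[of _ 1 "r + 1" _ "r + 1" _ "r + 1"]) (auto simp: mat_of_row_def)
    finally show ?case
      using generate.eng[of \<epsilon> "GL (r + 1)" _ ?A] e(1) A
      by (intro bexI[of _ "\<epsilon> * ?A"]) (auto simp: elem_group_def GL_simps)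
  qed
  from this[of r] show ?thesis
  proof -
    have "vec (r + 1) (\<lambda>j. if j \<le> r then v $ j else 0) = v" using v by auto
    then show ?thesis using \<open>r \<le> r \<Longrightarrow> _\<close> by simp
  qed
qed

section \<open>Suslin matrices\<close>

text \<open>Matrices live over \<open>'a\<close>, operators over \<open>'b\<close>. Injectivity of
  \<open>hom\<close> makes \<open>Phi\<close> injective, so identities found with coefficients in
  \<open>'b\<close> descend to matrices over \<open>'a\<close>.\<close>

locale suslin_rep = inj_comm_ring_hom hom for hom :: "'a::comm_ring_1 \<Rightarrow> 'b::comm_ring_1" +
  fixes r :: nat
  assumes r2: "2 \<le> r"
begin

definition row_part :: "(nat \<Rightarrow> 'a) \<Rightarrow> 'a vec" where "row_part x = vec (r + 1) x"
definition col_part :: "(nat \<Rightarrow> 'a) \<Rightarrow> 'a vec" where "col_part x = vec (r + 1) (\<lambda>i. x (i + (r + 1)))"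
definition join :: "'a vec \<Rightarrow> 'a vec \<Rightarrow> nat \<Rightarrow> 'a" where
  "join v w i = (if i < r + 1 then v $ i else w $ (i - (r + 1)))"

definition suslin_mat :: "(nat \<Rightarrow> 'a) \<Rightarrow> 'a mat" where "suslin_mat x = suslin r (row_part x) (col_part x)"
definition suslin_mat' :: "(nat \<Rightarrow> 'a) \<Rightarrow> 'a mat" where "suslin_mat' x = transpose_mat (suslin r (col_part x) (row_part x))"

definition Phi :: "'a mat \<Rightarrow> 'b lin" where "Phi = op_mat (2 ^ r)"

definition basis :: "nat \<Rightarrow> nat \<Rightarrow> 'a" where "basis i k = (if k = i then 1 else 0)"
definition gamma :: "nat \<Rightarrow> 'b lin" where "gamma i = Phi (suslin_mat (basis i))"
definition gamma' :: "nat \<Rightarrow> 'b lin" where "gamma' i = Phi (suslin_mat' (basis i))"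
definition qform :: "(nat \<Rightarrow> 'a) \<Rightarrow> 'a" where "qform x = row_part x \<bullet> col_part x"

lemma row_part_col_part [simp]: "row_part x \<in> carrier_vec (r + 1)" "col_part x \<in> carrier_vec (r + 1)"
  "row_part x \<in> carrier_vec (Suc r)" "col_part x \<in> carrier_vec (Suc r)"
  by (simp_all add: row_part_def col_part_def)

lemma row_part_join: "v \<in> carrier_vec (r + 1) \<Longrightarrow> row_part (join v w) = v" "w \<in> carrier_vec (r + 1) \<Longrightarrow> col_part (join v w) = w"
  by (auto simp: row_part_def col_part_def join_def)

lemma suslin_mat_carrier [simp]: "suslin_mat x \<in> carrier_mat (2 ^ r) (2 ^ r)" "suslin_mat' x \<in> carrier_mat (2 ^ r) (2 ^ r)"
  using suslin_carrier by (auto simp: suslin_mat_def suslin_mat'_def)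

lemma Phi_simps:
  assumes "M \<in> carrier_mat (2 ^ r) (2 ^ r)" "N \<in> carrier_mat (2 ^ r) (2 ^ r)"
  shows "Phi (M + N) = Phi M + Phi N" "Phi (M * N) = Phi M * Phi N" "Phi (c \<cdot>\<^sub>m M) = lin_smul (hom c) (Phi M)"
  using op_mat_simps[OF _ assms] by (simp_all add: Phi_def)

lemma Phi_one: "Phi (1\<^sub>m (2 ^ r)) = 1" by (simp add: Phi_def op_mat_one)

lemma Phi_inj: "M \<in> carrier_mat (2 ^ r) (2 ^ r) \<Longrightarrow> N \<in> carrier_mat (2 ^ r) (2 ^ r) \<Longrightarrow> Phi M = Phi N \<Longrightarrow> M = N"
  unfolding Phi_def by (rule op_mat_inj)

lemma suslin_mat_add: "suslin_mat (\<lambda>i. x i + y i) = suslin_mat x + suslin_mat y" "suslin_mat' (\<lambda>i. x i + y i) = suslin_mat' x + suslin_mat' y"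
proof -
  have v: "row_part (\<lambda>i. x i + y i) = row_part x + row_part y" "col_part (\<lambda>i. x i + y i) = col_part x + col_part y"
    by (auto simp: row_part_def col_part_def)
  show "suslin_mat (\<lambda>i. x i + y i) = suslin_mat x + suslin_mat y" unfolding suslin_mat_def v by (rule suslin_add) auto
  have "suslin r (col_part x + col_part y) (row_part x + row_part y) = suslin r (col_part x) (row_part x) + suslin r (col_part y) (row_part y)"
    by (rule suslin_add) auto
  then show "suslin_mat' (\<lambda>i. x i + y i) = suslin_mat' x + suslin_mat' y" unfolding suslin_mat'_def v
    by (simp add: transpose_add[OF suslin_carrier suslin_carrier])
qed

lemma suslin_mat_smult: "suslin_mat (\<lambda>i. c * x i) = c \<cdot>\<^sub>m suslin_mat x" "suslin_mat' (\<lambda>i. c * x i) = c \<cdot>\<^sub>m suslin_mat' x"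
proof -
  have v: "row_part (\<lambda>i. c * x i) = c \<cdot>\<^sub>v row_part x" "col_part (\<lambda>i. c * x i) = c \<cdot>\<^sub>v col_part x"
    by (auto simp: row_part_def col_part_def)
  show "suslin_mat (\<lambda>i. c * x i) = c \<cdot>\<^sub>m suslin_mat x" unfolding suslin_mat_def v by (rule suslin_smult) auto
  have "suslin r (c \<cdot>\<^sub>v col_part x) (c \<cdot>\<^sub>v row_part x) = c \<cdot>\<^sub>m suslin r (col_part x) (row_part x)"
    by (rule suslin_smult) auto
  then show "suslin_mat' (\<lambda>i. c * x i) = c \<cdot>\<^sub>m suslin_mat' x" unfolding suslin_mat'_def v by (auto intro!: eq_matI)
qed

lemma suslin_mat_cong: "(\<And>i. i < 2 * (r + 1) \<Longrightarrow> x i = y i) \<Longrightarrow> suslin_mat x = suslin_mat y"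
  and suslin_mat'_cong: "(\<And>i. i < 2 * (r + 1) \<Longrightarrow> x i = y i) \<Longrightarrow> suslin_mat' x = suslin_mat' y"
proof -
  assume "\<And>i. i < 2 * (r + 1) \<Longrightarrow> x i = y i"
  then have "row_part x = row_part y" "col_part x = col_part y" by (auto simp: row_part_def col_part_def)
  then show "suslin_mat x = suslin_mat y" "suslin_mat' x = suslin_mat' y" by (simp_all add: suslin_mat_def suslin_mat'_def)
qed

lemma linear_expand:
  fixes F :: "(nat \<Rightarrow> 'a) \<Rightarrow> 'b lin"
  assumes add: "\<And>x y. F (\<lambda>i. x i + y i) = F x + F y" and smul: "\<And>c x. F (\<lambda>i. c * x i) = lin_smul (hom c) (F x)"
    and cong: "\<And>x y. (\<And>i. i < m \<Longrightarrow> x i = y i) \<Longrightarrow> F x = F y"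
  shows "F x = (\<Sum>i<m. lin_smul (hom (x i)) (F (basis i)))"
proof -
  have "F (\<lambda>i. if i < k then x i else 0) = (\<Sum>i<k. lin_smul (hom (x i)) (F (basis i)))" for k
  proof (induction k)
    case 0
    have "F (\<lambda>i. 0 * x i) = 0" unfolding smul by (auto intro!: lin_eqI)
    then show ?case by simp
  next
    case (Suc k)
    have "(\<lambda>i. if i < Suc k then x i else 0) = (\<lambda>i. (if i < k then x i else 0) + x k * basis k i)"
      by (auto simp: basis_def fun_eq_iff less_Suc_eq)
    then show ?case using Suc by (simp add: add smul)
  qed
  moreover have "F x = F (\<lambda>i. if i < m then x i else 0)" by (rule cong) auto
  ultimately show ?thesis by simp
qed

lemma Phi_smult: "M \<in> carrier_mat (2 ^ r) (2 ^ r) \<Longrightarrow> Phi (c \<cdot>\<^sub>m M) = lin_smul (hom c) (Phi M)"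
  by (rule Phi_simps(3)) auto

lemma Phi_suslin_mat: "Phi (suslin_mat x) = (\<Sum>i<2 * (r + 1). lin_smul (hom (x i)) (gamma i))"
  unfolding gamma_def
proof (rule linear_expand[where F = "\<lambda>x. Phi (suslin_mat x)"])
  show "Phi (suslin_mat x) = Phi (suslin_mat y)" if "\<And>i. i < 2 * (r + 1) \<Longrightarrow> x i = y i" for x y using suslin_mat_cong[OF that] by simp
qed (auto simp: suslin_mat_add suslin_mat_smult Phi_simps Phi_smult)

lemma Phi_suslin_mat': "Phi (suslin_mat' x) = (\<Sum>i<2 * (r + 1). lin_smul (hom (x i)) (gamma' i))"
  unfolding gamma'_def
proof (rule linear_expand[where F = "\<lambda>x. Phi (suslin_mat' x)"])
  show "Phi (suslin_mat' x) = Phi (suslin_mat' y)" if "\<And>i. i < 2 * (r + 1) \<Longrightarrow> x i = y i" for x y using suslin_mat'_cong[OF that] by simp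
qed (auto simp: suslin_mat_add suslin_mat_smult Phi_simps Phi_smult)

lemma Phi_unit: "Phi (suslin_mat x) * Phi (suslin_mat' x) = lin_smul (hom (qform x)) 1" "Phi (suslin_mat' x) * Phi (suslin_mat x) = lin_smul (hom (qform x)) 1"
proof -
  have "suslin_mat x * suslin_mat' x = qform x \<cdot>\<^sub>m 1\<^sub>m (2 ^ r)" "suslin_mat' x * suslin_mat x = qform x \<cdot>\<^sub>m 1\<^sub>m (2 ^ r)"
    using suslin_mult_transpose[of "row_part x" r "col_part x"] by (simp_all add: suslin_mat_def suslin_mat'_def qform_def)
  then show "Phi (suslin_mat x) * Phi (suslin_mat' x) = lin_smul (hom (qform x)) 1" "Phi (suslin_mat' x) * Phi (suslin_mat x) = lin_smul (hom (qform x)) 1"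
    using Phi_simps(2)[OF suslin_mat_carrier(1,2), of x x] Phi_simps(2)[OF suslin_mat_carrier(2,1), of x x]
    by (simp_all add: Phi_smult Phi_one)
qed

lemma qform_sum: "qform x = (\<Sum>i<r + 1. x i * x (i + (r + 1)))"
  by (simp add: qform_def row_part_def col_part_def scalar_prod_def atLeast0LessThan)

definition flip' :: "(nat \<Rightarrow> 'a) \<Rightarrow> nat \<Rightarrow> 'a" where
  "flip' x i = (if i = 0 then x (r + 1) else if i = r + 1 then x 0 else - x i)"

lemma suslin_mat'_eq_suslin_mat: "suslin_mat' x = suslin_mat (flip' x)"
proof -
  obtain r' where r': "r = Suc r'" using r2 by (cases r) auto
  have "vec (r + 1) (\<lambda>i. if i = 0 then col_part x $ 0 else - row_part x $ i) = row_part (flip' x)"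
    "vec (r + 1) (\<lambda>i. if i = 0 then row_part x $ 0 else - col_part x $ i) = col_part (flip' x)"
    by (auto simp: row_part_def col_part_def flip'_def)
  moreover have "row_part x \<in> carrier_vec (Suc r' + 1)" "col_part x \<in> carrier_vec (Suc r' + 1)"
    by (simp_all only: r'[symmetric] row_part_col_part)
  note transpose_suslin[OF this, folded r']
  ultimately show ?thesis by (simp only: suslin_mat_def suslin_mat'_def)
qed

lemma flip'_flip': "suslin_mat (flip' (flip' x)) = suslin_mat x" by (rule suslin_mat_cong) (auto simp: flip'_def)

lemma qform_flip': "qform (flip' x) = qform x"
proof -
  have "(\<Sum>i<Suc r. flip' x i * flip' x (i + Suc r)) = (\<Sum>i<Suc r. x i * x (i + Suc r))"
    by (intro sum.cong) (auto simp: flip'_def)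
  then show ?thesis by (simp add: qform_sum del: sum.lessThan_Suc)
qed

lemma suslin_zero: "suslin k (0\<^sub>v (k + 1)) (0\<^sub>v (k + 1)) = (0\<^sub>m (2 ^ k) (2 ^ k) :: 'a mat)"
proof -
  have "suslin k (0 \<cdot>\<^sub>v 0\<^sub>v (k + 1)) (0 \<cdot>\<^sub>v 0\<^sub>v (k + 1)) = 0 \<cdot>\<^sub>m suslin k (0\<^sub>v (k + 1)) (0\<^sub>v (k + 1) :: 'a vec)"
    by (rule suslin_smult) auto
  moreover have "0 \<cdot>\<^sub>v 0\<^sub>v (k + 1) = (0\<^sub>v (k + 1) :: 'a vec)" by auto
  moreover have "0 \<cdot>\<^sub>m M = 0\<^sub>m (2 ^ k) (2 ^ k)" if "M \<in> carrier_mat (2 ^ k) (2 ^ k)" for M :: "'a mat"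
    using that by (auto intro!: eq_matI)
  ultimately show ?thesis using suslin_carrier[of k "0\<^sub>v (k + 1) :: 'a vec" "0\<^sub>v (k + 1)"] by metis
qed

text \<open>The relations are the polarization of \<open>Phi_unit\<close>: basis vectors are
  isotropic, and the sum of two distinct ones has form value 1 exactly when their indices are
  dual.\<close>

lemma clifford_gamma: "clifford (r + 1) lin_smul gamma gamma'"
proof
  show "3 \<le> r + 1" using r2 by simp
  have pol: "Phi (suslin_mat x) * Phi (suslin_mat' y) + Phi (suslin_mat y) * Phi (suslin_mat' x) = lin_smul (hom (qform (\<lambda>i. x i + y i) - qform x - qform y)) 1"
    "Phi (suslin_mat' x) * Phi (suslin_mat y) + Phi (suslin_mat' y) * Phi (suslin_mat x) = lin_smul (hom (qform (\<lambda>i. x i + y i) - qform x - qform y)) 1" for x y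
  proof -
    have a: "Phi (suslin_mat (\<lambda>i. x i + y i)) = Phi (suslin_mat x) + Phi (suslin_mat y)" "Phi (suslin_mat' (\<lambda>i. x i + y i)) = Phi (suslin_mat' x) + Phi (suslin_mat' y)"
      by (simp_all add: suslin_mat_add Phi_simps)
    have m: "lin_smul (hom (c - d - e)) 1 = lin_smul (hom c) 1 - lin_smul (hom d) 1 - lin_smul (hom e) (1 :: 'b lin)" for c d e
      by (auto intro!: lin_eqI simp: hom_minus hom_add algebra_simps)
    show "Phi (suslin_mat x) * Phi (suslin_mat' y) + Phi (suslin_mat y) * Phi (suslin_mat' x) = lin_smul (hom (qform (\<lambda>i. x i + y i) - qform x - qform y)) 1"
      unfolding m Phi_unit(1)[symmetric] a by (simp add: algebra_simps)
    show "Phi (suslin_mat' x) * Phi (suslin_mat y) + Phi (suslin_mat' y) * Phi (suslin_mat x) = lin_smul (hom (qform (\<lambda>i. x i + y i) - qform x - qform y)) 1"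
      unfolding m Phi_unit(2)[symmetric] a by (simp add: algebra_simps)
  qed
  have q0: "qform (basis i) = 0" for i
    unfolding qform_sum by (intro sum.neutral) (auto simp: basis_def)
  have q1: "qform (\<lambda>k. basis i k + basis j k) = (if j = star (r + 1) i then 1 else 0)" if ij: "i < 2 * (r + 1)" "j < 2 * (r + 1)" "i \<noteq> j" for i j
  proof -
    \<comment> \<open>Only the summand at the smaller of the two indices can be nonzero.\<close>
    have "qform (\<lambda>k. basis i k + basis j k) = (\<Sum>k<r + 1. if k = min i j then (if j = star (r + 1) i then 1 else 0) else 0)"
      unfolding qform_sum using ij by (intro sum.cong) (auto simp: basis_def star_def min_def)
    also have "\<dots> = (if j = star (r + 1) i then 1 else 0)" using ij by (auto simp: star_def)
    finally show ?thesis .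
  qed
  have iso: "gamma i * gamma' i = 0" "gamma' i * gamma i = 0" for i
    using Phi_unit[of "basis i"] by (auto simp: gamma_def gamma'_def q0 intro!: lin_eqI)
  then show "gamma i * gamma' i = 0" "gamma' i * gamma i = 0" for i by auto
  show "gamma i * gamma' j + gamma j * gamma' i = (if j = star (r + 1) i then 1 else 0)"
    "gamma' i * gamma j + gamma' j * gamma i = (if j = star (r + 1) i then 1 else 0)"
    if ij: "i < 2 * (r + 1)" "j < 2 * (r + 1)" for i j
  proof -
    have "lin_smul 1 1 = (1 :: 'b lin)" "lin_smul 0 1 = (0 :: 'b lin)" by (auto intro!: lin_eqI)
    then show "gamma i * gamma' j + gamma j * gamma' i = (if j = star (r + 1) i then 1 else 0)"
      "gamma' i * gamma j + gamma' j * gamma i = (if j = star (r + 1) i then 1 else 0)"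
      using pol[of "basis i" "basis j"] q1[OF ij] ij iso by (cases "i = j"; auto simp: gamma_def gamma'_def q0)+
  qed
  have fl: "flip' (basis 0) = basis (r + 1)" "flip' (basis (r + 1)) = basis 0" "i \<noteq> 0 \<Longrightarrow> i \<noteq> r + 1 \<Longrightarrow> flip' (basis i) = (\<lambda>k. - 1 * basis i k)" for i
    by (auto simp: flip'_def basis_def fun_eq_iff)
  show "gamma' 0 = gamma (r + 1)" "gamma' (r + 1) = gamma 0" by (simp_all only: gamma_def gamma'_def suslin_mat'_eq_suslin_mat fl)
  show "gamma' i = - gamma i" if "i \<noteq> 0" "i \<noteq> r + 1" for i
  proof -
    have "suslin_mat' (basis i) = - 1 \<cdot>\<^sub>m suslin_mat (basis i)" unfolding suslin_mat'_eq_suslin_mat fl(3)[OF that] by (rule suslin_mat_smult)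
    then show ?thesis by (auto simp: gamma_def gamma'_def Phi_smult hom_uminus intro!: lin_eqI)
  qed
  show "gamma 0 + gamma (r + 1) = 1"
  proof -
    obtain r' where r': "r = Suc r'" using r2 by (cases r) auto
    \<comment> \<open>Both rows of this vector are (1, 0, ..., 0), so the off-diagonal blocks vanish
      and the Suslin matrix is the identity.\<close>
    let ?e = "\<lambda>k. basis 0 k + basis (r + 1) k"
    have e: "row_part ?e $ 0 = 1" "col_part ?e $ 0 = 1" "vec_last (row_part ?e) r = 0\<^sub>v r" "vec_last (col_part ?e) r = 0\<^sub>v r"
      by (auto simp: row_part_def col_part_def basis_def vec_last_def)
    have z: "suslin r' (0\<^sub>v r) (0\<^sub>v r) = (0\<^sub>m (2 ^ r') (2 ^ r') :: 'a mat)" using suslin_zero[of r'] by (simp add: r')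
    have sus: "suslin r = suslin (Suc r')" using r' by (rule arg_cong)
    have "suslin_mat ?e = four_block_mat (1 \<cdot>\<^sub>m 1\<^sub>m (2 ^ r')) (0\<^sub>m (2 ^ r') (2 ^ r')) (- transpose_mat (0\<^sub>m (2 ^ r') (2 ^ r'))) (1 \<cdot>\<^sub>m 1\<^sub>m (2 ^ r'))"
      unfolding suslin_mat_def sus suslin.simps unfolding r'[symmetric] e z ..
    also have "\<dots> = four_block_mat (1 \<cdot>\<^sub>m 1\<^sub>m (2 ^ r')) (0\<^sub>m (2 ^ r') (2 ^ r')) (0\<^sub>m (2 ^ r') (2 ^ r')) (1 \<cdot>\<^sub>m 1\<^sub>m (2 ^ r'))"
      by (intro arg_cong4[of _ _ _ _ _ _ _ _ four_block_mat]) auto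
    also have "\<dots> = 1 \<cdot>\<^sub>m 1\<^sub>m (2 ^ r)" by (simp add: four_block_smult_one r' mult_2)
    also have "\<dots> = 1\<^sub>m (2 ^ r)" by auto
    finally have "Phi (suslin_mat ?e) = 1" by (simp add: Phi_one)
    then show ?thesis by (simp add: suslin_mat_add Phi_simps gamma_def)
  qed
qed (auto simp: lin_smul)

section \<open>Suslin matrices as Clifford elements and rows in the elementary orbit\<close>

definition N :: nat where "N = r + 1"

sublocale C: clifford N lin_smul gamma gamma'
  unfolding N_def by (rule clifford_gamma)

definition P :: "'b set" where "P = range hom"

lemma P_I [simp]: "hom x \<in> P" by (simp add: P_def)

lemma P_subring: "subring_set P"
  unfolding subring_set_def P_def
proof (intro conjI ballI)
  show "1 \<in> range hom" by (metis hom_one rangeI)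
  fix x y assume "x \<in> range hom" "y \<in> range hom"
  then obtain a b where "x = hom a" "y = hom b" by blast
  then show "x + y \<in> range hom" "x * y \<in> range hom" by (metis hom_add rangeI, metis hom_mult rangeI)
next
  fix x assume "x \<in> range hom"
  then obtain a where "x = hom a" by blast
  then have "- x = hom (- a)" by (simp add: hom_uminus)
  then show "- x \<in> range hom" by blast
qed

lemma C_S: "C.S (\<lambda>i. hom (x i)) = Phi (suslin_mat x)" "C.S' (\<lambda>i. hom (x i)) = Phi (suslin_mat' x)"
  unfolding C.S_def C.S'_def Phi_suslin_mat Phi_suslin_mat' by (simp_all only: N_def)

lemma smul_one_iff: "lin_smul c 1 = 1 \<longleftrightarrow> c = (1 :: 'b)"
proof
  assume "lin_smul c 1 = (1 :: 'b lin)"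
  then have "app (lin_smul c 1) (\<lambda>_. 1) 0 = app 1 (\<lambda>_. 1 :: 'b) 0" by simp
  then show "c = 1" by simp
qed (simp add: lin_smul)

lemma unit_vector_iff: "C.unit_vector (\<lambda>i. hom (x i)) \<longleftrightarrow> qform x = 1"
  unfolding C.unit_vector_def C_S Phi_unit smul_one_iff by simp

definition suslin_op :: "(nat \<Rightarrow> 'a) \<Rightarrow> 'b lin" where "suslin_op x = C.S (\<lambda>i. hom (x i))"

lemma suslin_op_cong: assumes "\<And>i. i < 2 * N \<Longrightarrow> x i = y i" shows "suslin_op x = suslin_op y"
proof -
  have "suslin_mat x = suslin_mat y" using assms by (intro suslin_mat_cong) (simp add: N_def)
  then show ?thesis unfolding suslin_op_def C_S by simp
qed

lemma suslin_op_root_group_unit: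
  assumes "qform x = 1" "x 0 * b = 1"
  shows "suslin_op x \<in> C.root_group P"
  unfolding suslin_op_def
proof (rule C.unit_vector_root_group)
  show "C.unit_vector (\<lambda>i. hom (x i))" using assms by (simp add: unit_vector_iff)
  show "hom (x 0) * hom b = 1" using assms(2) hom_mult[of "x 0" b] by simp
  have 1: "hom y * hom z \<in> P" "- (hom y * hom z) \<in> P" "- hom y \<in> P" for y z
    using subring_setD(4,5)[OF P_subring] by simp_all
  then show "- hom b \<in> P" "- (hom (x k) * hom b) \<in> P" for k by simp_all
  show "- 1 \<in> P" "1 \<in> P" using subring_setD(2,5)[OF P_subring] by simp_all
qed simp

text \<open>An elementary operation on \<open>v\<close> together with the inverse transpose one on
  \<open>w\<close>, so that the pairing of \<open>v\<close> and \<open>w\<close> is kept. It is the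
  transvection for the indices \<open>l\<close> and \<open>k + N\<close>.\<close>

definition row_op :: "nat \<Rightarrow> 'a \<Rightarrow> nat \<Rightarrow> (nat \<Rightarrow> 'a) \<Rightarrow> nat \<Rightarrow> 'a" where
  "row_op l u k x = x(l := x l + u * x k, k + N := x (k + N) - u * x (l + N))"

lemma row_op:
  assumes "l < N" "k < N" "k \<noteq> l"
  shows "C.transvect l (hom u) (k + N) (\<lambda>i. hom (x i)) = (\<lambda>i. hom (row_op l u k x i))"
    "C.root_pair l (k + N)" "l \<noteq> k + N"
proof -
  have "star N l = l + N" "star N (k + N) = k" using assms by (simp_all add: star_def)
  note st = this
  show "C.transvect l (hom u) (k + N) (\<lambda>i. hom (x i)) = (\<lambda>i. hom (row_op l u k x i))"
  proof
    fix m
    show "C.transvect l (hom u) (k + N) (\<lambda>i. hom (x i)) m = hom (row_op l u k x m)"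
      unfolding C.transvect_def st row_op_def fun_upd_apply
      by (cases "m = k + N"; cases "m = l") (simp_all only: simp_thms if_True if_False hom_add hom_minus hom_mult)
  qed
  show "C.root_pair l (k + N)" "l \<noteq> k + N" using assms st by (auto simp: C.root_pair_def)
qed

lemma qform_row_op: assumes "l < N" "k < N" "k \<noteq> l" "qform x = 1" shows "qform (row_op l u k x) = 1"
  using C.unit_vector_transvect[OF row_op(2,3)[OF assms(1-3)], of "\<lambda>i. hom (x i)" "hom u"] assms(4)
  unfolding row_op(1)[OF assms(1-3)] unit_vector_iff by blast

lemma row_op_root_group: assumes "l < N" "k < N" "k \<noteq> l" "suslin_op (row_op l u k x) \<in> C.root_group P" shows "suslin_op x \<in> C.root_group P"
  using C.transvect_root_group[OF P_subring P_I row_op(2,3)[OF assms(1-3)], of u "\<lambda>i. hom (x i)"] assms(4)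
  unfolding row_op(1)[OF assms(1-3)] suslin_op_def by blast

lemma Phi_mult: "g \<in> carrier (GL (2 ^ r)) \<Longrightarrow> h \<in> carrier (GL (2 ^ r)) \<Longrightarrow> Phi (g \<otimes>\<^bsub>GL (2 ^ r)\<^esub> h) = Phi g * Phi h"
  using GL_simps(1)[of "2 ^ r", where ?'a = 'a] by (subst GL_simps(2), intro Phi_simps) auto

lemma Phi_GL_inj: "g \<in> carrier (GL (2 ^ r)) \<Longrightarrow> h \<in> carrier (GL (2 ^ r)) \<Longrightarrow> Phi g = Phi h \<Longrightarrow> g = h"
  using GL_simps(1)[of "2 ^ r", where ?'a = 'a] Phi_inj by auto

lemma Phi_suslin:
  assumes "v \<in> carrier_vec (r + 1)" "w \<in> carrier_vec (r + 1)"
  shows "Phi (suslin r v w) = suslin_op (join v w)" "qform (join v w) = v \<bullet> w"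
  unfolding suslin_op_def C_S suslin_mat_def qform_def row_part_join(1)[OF assms(1)] row_part_join(2)[OF assms(2)] by (rule refl)+

text \<open>All admissible \<open>w\<close> are taken at once, because an elementary operation on
  the row \<open>v\<close> changes its partner too.\<close>

definition elementary_row :: "'a vec \<Rightarrow> bool" where
  "elementary_row v \<longleftrightarrow> (\<forall>w\<in>carrier_vec (r + 1). v \<bullet> w = 1 \<longrightarrow> suslin_op (join v w) \<in> C.root_group P)"

lemma elementary_row_addrow:
  assumes kl: "k < r + 1" "l < r + 1" "k \<noteq> l"
    and v: "v \<in> carrier_vec (r + 1)" "v' \<in> carrier_vec (r + 1)" "mat_of_row v' = mat_of_row v * addrow_mat (r + 1) a k l"
    and E: "elementary_row v"
  shows "elementary_row v'"
  unfolding elementary_row_def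
proof (intro ballI impI)
  fix w assume w: "w \<in> carrier_vec (r + 1)" "v' \<bullet> w = 1"
  have kl': "l < N" "k < N" "k \<noteq> l" using kl by (auto simp: N_def)
  have "mat_of_row v' = mat_of_row (vec (r + 1) (\<lambda>j. v $ j + (if j = l then a * v $ k else 0)))"
    using v(3) unfolding row_times_addrow[OF v(1) kl(1,2)] .
  then have "v' = vec (r + 1) (\<lambda>j. v $ j + (if j = l then a * v $ k else 0))" by (rule mat_of_row_inject)
  then have v': "v' $ j = v $ j + (if j = l then a * v $ k else 0)" if "j < r + 1" for j using that by simp
  \<comment> \<open>The coefficient \<open>- a\<close> undoes the operation, so the first half of
    \<open>x\<close> is \<open>v\<close> again; its second half is a new partner of
    \<open>v\<close>.\<close>
  define x where "x = row_op l (- a) k (join v' w)"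
  have q1: "qform x = 1" unfolding x_def
    using qform_row_op[OF kl'] Phi_suslin(2)[OF v(2) w(1)] w(2) by simp
  have row_part: "row_part x = v"
  proof (rule eq_vecI)
    fix i assume "i < dim_vec v"
    then have i: "i < r + 1" using v(1) by simp
    then show "row_part x $ i = v $ i"
      using v'[OF i] v'[OF kl(1)] kl by (auto simp: row_part_def x_def row_op_def join_def N_def)
  qed (use v(1) in \<open>simp add: row_part_def\<close>)
  have "join v (col_part x) i = x i" if "i < 2 * N" for i
  proof (cases "i < r + 1")
    case True then show ?thesis unfolding row_part[symmetric] by (simp add: join_def row_part_def)
  next
    case False
    then have "i = (i - (r + 1)) + (r + 1)" by simp
    then obtain k where k: "i = k + (r + 1)" by blast
    have "k < r + 1" using that unfolding k N_def by simp
    then show ?thesis unfolding k by (simp add: join_def col_part_def)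
  qed
  then have "suslin_op (join v (col_part x)) = suslin_op x" by (rule suslin_op_cong)
  moreover have "v \<bullet> col_part x = 1" using q1 unfolding qform_def row_part .
  moreover have "suslin_op (join v (col_part x)) \<in> C.root_group P"
    using E[unfolded elementary_row_def, rule_format, OF row_part_col_part(2) \<open>v \<bullet> col_part x = 1\<close>] .
  ultimately have "suslin_op x \<in> C.root_group P" by simp
  then show "suslin_op (join v' w) \<in> C.root_group P" unfolding x_def by (rule row_op_root_group[OF kl'])
qed

lemma elementary_row_step:
  assumes "\<epsilon> \<in> elem_group (r + 1)"
  shows "\<forall>v v'. v \<in> carrier_vec (r + 1) \<longrightarrow> v' \<in> carrier_vec (r + 1) \<longrightarrow> mat_of_row v' = mat_of_row v * \<epsilon>
    \<longrightarrow> elementary_row v \<longrightarrow> elementary_row v'"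
  using assms unfolding elem_group_def
proof (induction rule: generate.induct)
  case one
  have "v' = v" if "v \<in> carrier_vec (r + 1)" "mat_of_row v' = mat_of_row v * 1\<^sub>m (r + 1)" for v v' :: "'a vec"
  proof (rule mat_of_row_inject)
    have "mat_of_row v \<in> carrier_mat 1 (r + 1)" using that(1) by (rule mat_of_row_carrier)
    then show "mat_of_row v' = mat_of_row v" unfolding that(2) by (rule right_mult_one_mat)
  qed
  then show ?case unfolding GL_simps by metis
next
  case (incl h)
  then obtain a k l where h: "h = addrow_mat (r + 1) a k l" and kl: "k < r + 1" "l < r + 1" "k \<noteq> l" by blast
  show ?case unfolding h by (intro allI impI) (rule elementary_row_addrow[OF kl])
next
  case (inv h)
  then obtain a k l where h: "h = addrow_mat (r + 1) a k l" and kl: "k < r + 1" "l < r + 1" "k \<noteq> l" by blast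
  have "addrow_mat (r + 1) (- a) k l * h = 1\<^sub>m (r + 1)"
    using addrow_mat_inv[OF kl, of "- a"] by (simp add: h)
  then have "inv\<^bsub>GL (r + 1)\<^esub> h = addrow_mat (r + 1) (- a) k l"
    unfolding h using addrow_mat_in_GL[OF kl] by (intro group.inv_equality[OF group_GL]) (auto simp only: GL_simps)
  then have inv: "inv\<^bsub>GL (r + 1)\<^esub> h = addrow_mat (r + 1) (- a) k l" .
  show ?case unfolding inv by (intro allI impI) (rule elementary_row_addrow[OF kl])
next
  case (eng h1 h2)
  show ?case
  proof (intro allI impI)
    fix v v' :: "'a vec"
    assume v: "v \<in> carrier_vec (r + 1)" "v' \<in> carrier_vec (r + 1)" "mat_of_row v' = mat_of_row v * (h1 \<otimes>\<^bsub>GL (r + 1)\<^esub> h2)"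
      and E: "elementary_row v"
    define v'' where "v'' = row (mat_of_row v * h1) 0"
    have "h1 \<in> carrier (GL (r + 1))" "h2 \<in> carrier (GL (r + 1))"
      using eng(1,2) elem_group_GL[of "r + 1", where ?'a = 'a] unfolding elem_group_def by auto
    then have h: "h1 \<in> carrier_mat (r + 1) (r + 1)" "h2 \<in> carrier_mat (r + 1) (r + 1)"
      using GL_simps(1)[of "r + 1", where ?'a = 'a] by auto
    have vc: "mat_of_row v \<in> carrier_mat 1 (r + 1)" using v(1) by (rule mat_of_row_carrier)
    have c: "mat_of_row v * h1 \<in> carrier_mat 1 (r + 1)" by (rule mult_carrier_mat[OF vc h(1)])
    have m: "mat_of_row v'' = mat_of_row v * h1" "v'' \<in> carrier_vec (r + 1)"
      using row_mat_carrier[OF c] by (simp_all only: v''_def)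
    have "mat_of_row v' = mat_of_row v'' * h2"
      using v(3) unfolding m(1) GL_simps by (simp only: assoc_mult_mat[OF vc h])
    then show "elementary_row v'"
      using eng(4)[rule_format, OF m(2) v(2)] eng(3)[rule_format, OF v(1) m(2) m(1) E] by blast
  qed
qed

lemma EUm_generator_root_group:
  assumes "v \<in> carrier_vec (r + 1)" "w \<in> carrier_vec (r + 1)" "v \<bullet> w = 1"
    and "\<epsilon> \<in> elem_group (r + 1)" "mat_of_row v = mat_of_row (unit_vec (r + 1) 0) * \<epsilon>"
  shows "suslin_op (join v w) \<in> C.root_group P"
proof -
  have "elementary_row (unit_vec (r + 1) 0)"
    unfolding elementary_row_def
  proof (intro ballI impI)
    fix w :: "'a vec" assume w: "w \<in> carrier_vec (r + 1)" "unit_vec (r + 1) 0 \<bullet> w = 1"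
    show "suslin_op (join (unit_vec (r + 1) 0) w) \<in> C.root_group P"
      by (rule suslin_op_root_group_unit[where b = 1]) (use Phi_suslin(2)[OF _ w(1)] w(2) in \<open>auto simp: join_def\<close>)
  qed
  then have "elementary_row v"
    using elementary_row_step[OF assms(4), rule_format, OF unit_vec_carrier assms(1,5)] by blast
  then show ?thesis using assms(2,3) by (simp add: elementary_row_def)
qed

section \<open>Images of \<open>EUm\<close> and \<open>SUm\<close> and the quotient group\<close>

abbreviation G :: "'a mat monoid" where "G \<equiv> GL (2 ^ r)"

lemma Phi_generate:
  assumes X: "X \<subseteq> carrier G" and K: "1 \<in> K" "\<And>x y. x \<in> K \<Longrightarrow> y \<in> K \<Longrightarrow> x * y \<in> K"
    and XK: "\<And>x. x \<in> X \<Longrightarrow> Phi x \<in> K" "\<And>x. x \<in> X \<Longrightarrow> \<exists>y\<in>K. Phi x * y = 1"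
    and g: "g \<in> generate G X"
  shows "Phi g \<in> K"
  using g
proof (induction rule: generate.induct)
  case one then show ?case using K by (simp add: GL_simps Phi_one)
next
  case (incl h) then show ?case by (rule XK)
next
  case (inv h)
  then obtain y where y: "y \<in> K" "Phi h * y = 1" using XK by blast
  have h: "h \<in> carrier G" using inv X by blast
  have "Phi (inv\<^bsub>G\<^esub> h) * Phi h = 1"
    using Phi_mult[OF group.inv_closed[OF group_GL h] h] group.l_inv[OF group_GL h] by (simp add: GL_simps Phi_one)
  then have "Phi (inv\<^bsub>G\<^esub> h) * (Phi h * y) = y" by (simp only: mult.assoc[symmetric] mult_1_left)
  then have "Phi (inv\<^bsub>G\<^esub> h) = y" unfolding y(2) by (simp only: mult_1_right)
  then show ?case using y(1) by simp
next
  case (eng h1 h2)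
  then have "h1 \<in> carrier G" "h2 \<in> carrier G" using group.generate_in_carrier[OF group_GL X] by auto
  then show ?case using eng K by (simp only: Phi_mult)
qed

lemma suslin_monoid_EU_carrier: "SUm r \<subseteq> carrier G" "EUm r \<subseteq> carrier G"
  using subgroup.subset[OF subgroup_SUm] subgroup.subset[OF subgroup_EUm] by auto

lemma suslin_op_inverse: "qform x = 1 \<Longrightarrow> suslin_op x * suslin_op (flip' x) = 1"
  using Phi_unit(1)[of x] by (simp add: suslin_op_def C_S suslin_mat'_eq_suslin_mat[symmetric] lin_smul)

lemma EUm_root_group:
  assumes "g \<in> EUm r" shows "Phi g \<in> C.root_group P"
proof (rule Phi_generate[OF _ _ _ _ _ assms[unfolded EUm_def]])
  let ?X = "{suslin r v w | v w. v \<in> carrier_vec (r + 1) \<and> w \<in> carrier_vec (r + 1) \<and> v \<bullet> w = 1 \<and>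
      (\<exists>\<epsilon> \<in> elem_group (r + 1). mat_of_row v = mat_of_row (unit_vec (r + 1) 0) * \<epsilon>)} :: 'a mat set"
  show "?X \<subseteq> carrier G" using suslin_in_GL by blast
  show X: "Phi x \<in> C.root_group P" if x: "x \<in> ?X" for x
  proof -
    obtain v w \<epsilon> where vw: "x = suslin r v w" "v \<in> carrier_vec (r + 1)" "w \<in> carrier_vec (r + 1)" "v \<bullet> w = 1"
      "\<epsilon> \<in> elem_group (r + 1)" "mat_of_row v = mat_of_row (unit_vec (r + 1) 0) * \<epsilon>" using x by blast
    show ?thesis unfolding vw(1) Phi_suslin(1)[OF vw(2,3)] by (rule EUm_generator_root_group[OF vw(2-6)])
  qed
  show "\<exists>y\<in>C.root_group P. Phi x * y = 1" if "x \<in> ?X" for x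
    using C.root_group_inv[OF X[OF that]] subring_setD(5)[OF P_subring] by blast
qed (auto intro: C.root_group.one C.root_group_mult)

text \<open>A monoid suffices: the inverse of a generator is the generator of the flipped vector, by
  \<open>suslin_op_inverse\<close>.\<close>

inductive_set suslin_monoid :: "'b lin set" where
  one: "1 \<in> suslin_monoid"
| step: "qform x = 1 \<Longrightarrow> y \<in> suslin_monoid \<Longrightarrow> suslin_op x * y \<in> suslin_monoid"

lemma suslin_monoid_mult: "x \<in> suslin_monoid \<Longrightarrow> y \<in> suslin_monoid \<Longrightarrow> x * y \<in> suslin_monoid"
  by (induction rule: suslin_monoid.induct) (auto simp: mult.assoc intro: suslin_monoid.step)

lemma suslin_monoid_suslin_op: "qform x = 1 \<Longrightarrow> suslin_op x \<in> suslin_monoid" using suslin_monoid.step[OF _ suslin_monoid.one] by fastforce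

lemma SUm_suslin_monoid:
  assumes "g \<in> SUm r" shows "Phi g \<in> suslin_monoid"
proof (rule Phi_generate[OF _ _ _ _ _ assms[unfolded SUm_def]])
  let ?X = "{suslin r v w | v w. v \<in> carrier_vec (r + 1) \<and> w \<in> carrier_vec (r + 1) \<and> v \<bullet> w = 1} :: 'a mat set"
  show "?X \<subseteq> carrier G" using suslin_in_GL by blast
  have X: "\<exists>z. Phi x = suslin_op z \<and> qform z = 1" if x: "x \<in> ?X" for x
  proof -
    obtain v w where vw: "x = suslin r v w" "v \<in> carrier_vec (r + 1)" "w \<in> carrier_vec (r + 1)" "v \<bullet> w = 1" using x by blast
    show ?thesis using Phi_suslin[OF vw(2,3)] vw by metis
  qed
  show "Phi x \<in> suslin_monoid" if "x \<in> ?X" for x using X[OF that] suslin_monoid_suslin_op by metis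
  show "\<exists>y\<in>suslin_monoid. Phi x * y = 1" if "x \<in> ?X" for x
    using X[OF that] suslin_monoid_suslin_op suslin_op_inverse qform_flip' by metis
qed (auto intro: suslin_monoid.one suslin_monoid_mult)

text \<open>The inclusion converse to \<open>EUm_root_group\<close>. Rows with first entry 1 lie in
  the elementary orbit by \<open>elementary_completion\<close>, and by
  \<open>root_in_subgroup\<close> their Suslin matrices already produce all root elements when 1/2
  exists.\<close>

lemma root_group_EUm:
  assumes half: "h + h = (1 :: 'a)" and y: "y \<in> C.root_group P"
  shows "y \<in> Phi ` EUm r"
proof -
  let ?H = "Phi ` EUm r"
  have H1: "1 \<in> ?H"
    using subgroup.one_closed[OF subgroup_EUm[of r, where ?'a = 'a]] Phi_one by (auto simp: GL_simps image_iff intro!: bexI)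
  have H2: "x * y \<in> ?H" if xy: "x \<in> ?H" "y \<in> ?H" for x y
  proof -
    obtain a b where ab: "a \<in> EUm r" "b \<in> EUm r" "x = Phi a" "y = Phi b" using xy by blast
    then have "x * y = Phi (a \<otimes>\<^bsub>G\<^esub> b)" using suslin_monoid_EU_carrier(2) by (subst Phi_mult) auto
    then show ?thesis using subgroup.m_closed[OF subgroup_EUm ab(1,2)] by blast
  qed
  have H3: "\<exists>y\<in>?H. y * x = 1" if x: "x \<in> ?H" for x
  proof -
    obtain a where a: "a \<in> EUm r" "x = Phi a" using x by blast
    have ac: "a \<in> carrier G" using a suslin_monoid_EU_carrier(2) by blast
    have "Phi (inv\<^bsub>G\<^esub> a) * Phi a = 1"
      using Phi_mult[OF group.inv_closed[OF group_GL ac] ac] group.l_inv[OF group_GL ac] by (simp add: GL_simps Phi_one)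
    then show ?thesis using subgroup.m_inv_closed[OF subgroup_EUm a(1)] a(2) by blast
  qed
  have H4: "C.S t \<in> ?H" if t: "C.unit_vector t" "\<And>k. k < 2 * N \<Longrightarrow> t k \<in> P" "t 0 = 1" for t
  proof -
    \<comment> \<open>The coordinates are pulled back along \<open>hom\<close>, so that
      \<open>C.S t\<close> becomes the image of an actual Suslin matrix over
      \<open>'a\<close>.\<close>
    define x where "x k = inv_into UNIV hom (t k)" for k
    have x: "hom (x k) = t k" if "k < 2 * N" for k
      using t(2)[OF that] by (simp add: x_def P_def f_inv_into_f)
    have S: "C.S t = C.S (\<lambda>k. hom (x k))" "C.S' t = C.S' (\<lambda>k. hom (x k))"
      unfolding C.S_def C.S'_def by (intro sum.cong refl; simp add: x)+
    then have qx: "qform x = 1" using t(1) by (simp only: unit_vector_iff[symmetric] C.unit_vector_def)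
    have "hom (x 0) = hom 1" using x[of 0] t(3) by (simp add: N_def)
    then have "x 0 = 1" by simp
    then have "row_part x $ 0 = 1" by (simp add: row_part_def)
    from elementary_completion[OF row_part_col_part(1) this] qx have "suslin_mat x \<in> EUm r"
      unfolding EUm_def suslin_mat_def qform_def by (intro generate.incl) (use row_part_col_part in blast)
    then show ?thesis unfolding S C_S by blast
  qed
  have "hom h + hom h = 1" using half hom_add[of h h] by simp
  note root = C.root_in_subgroup[OF P_subring P_I this H1 H2 H3 H4]
  show ?thesis using y
  proof induction
    case (step i j c x) then show ?case using root H2 by blast
  qed (rule H1)
qed

lemma suslin_op_normalizes: "qform x = 1 \<Longrightarrow> C.normalizes P (suslin_op x)"
  unfolding suslin_op_def by (rule C.normalizes_S[OF P_subring]) (simp_all add: unit_vector_iff)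

lemma suslin_monoid_normalizes: "x \<in> suslin_monoid \<Longrightarrow> C.normalizes P x"
  by (induction rule: suslin_monoid.induct) (auto intro: C.normalizes_mult[OF P_subring] suslin_op_normalizes C.normalizes_root_group[OF P_subring] C.root_group.one)

text \<open>Commuting modulo the root group passes from generators to products because generators
  normalize the root group.\<close>

lemma suslin_monoid_comm:
  assumes comm: "\<And>x y. qform x = 1 \<Longrightarrow> qform y = 1 \<Longrightarrow> C.comm P (suslin_op x) (suslin_op y)" and x: "x \<in> suslin_monoid" and y: "y \<in> suslin_monoid"
  shows "C.comm P x y"
  using x
proof induction
  case one then show ?case using C.comm_root_group(2)[OF P_subring suslin_monoid_normalizes[OF y] C.root_group.one] .
next
  case (step s x)
  have "C.comm P (suslin_op s) y" using y
  proof induction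
    case one then show ?case using C.comm_root_group(1)[OF P_subring suslin_op_normalizes C.root_group.one] step by blast
  next
    case (step t y)
    then show ?case using C.comm_mult_right[OF P_subring suslin_op_normalizes comm] \<open>qform s = 1\<close> by blast
  qed
  then show ?case using C.comm_mult_left[OF P_subring suslin_op_normalizes] step by blast
qed

lemma comm_group_quotient:
  assumes half: "h + h = (1 :: 'a)"
    and comm: "\<And>x y. qform x = 1 \<Longrightarrow> qform y = 1 \<Longrightarrow> C.comm P (suslin_op x) (suslin_op y)"
  shows "comm_group (G\<lparr>carrier := SUm r\<rparr> Mod (EUm r))"
proof (rule group.comm_group_factor[OF group_GL subgroup_SUm subgroup_EUm EUm_subset_SUm])
  interpret G: group G by (rule group_GL)
  have c: "x \<in> SUm r \<Longrightarrow> x \<in> carrier G" for x using suslin_monoid_EU_carrier(1) by blast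
  have m: "x \<in> SUm r \<Longrightarrow> y \<in> SUm r \<Longrightarrow> x \<otimes>\<^bsub>G\<^esub> y \<in> SUm r" for x y
    by (rule subgroup.m_closed[OF subgroup_SUm])
  have key: "\<exists>d\<in>EUm r. a = d \<otimes>\<^bsub>G\<^esub> b" if a: "a \<in> SUm r" "b \<in> SUm r" "e \<in> C.root_group P" "Phi a = e * Phi b" for a b e
  proof -
    obtain d where d: "d \<in> EUm r" "e = Phi d" using root_group_EUm[OF half a(3)] by blast
    have dc: "d \<in> carrier G" using d(1) suslin_monoid_EU_carrier(2) by blast
    have "a = d \<otimes>\<^bsub>G\<^esub> b"
    proof (rule Phi_GL_inj[OF c[OF a(1)] G.m_closed[OF dc c[OF a(2)]]])
      show "Phi a = Phi (d \<otimes>\<^bsub>G\<^esub> b)" unfolding Phi_mult[OF dc c[OF a(2)]] a(4) d(2) ..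
    qed
    then show ?thesis using d(1) by blast
  qed
  fix x :: "'a mat" assume x: "x \<in> SUm r"
  show "\<exists>d\<in>EUm r. x \<otimes>\<^bsub>G\<^esub> h = d \<otimes>\<^bsub>G\<^esub> x" if h: "h \<in> EUm r" for h
  proof -
    have h': "h \<in> SUm r" using h EUm_subset_SUm by blast
    obtain e where e: "e \<in> C.root_group P" "Phi x * Phi h = e * Phi x"
      using suslin_monoid_normalizes[OF SUm_suslin_monoid[OF x]] EUm_root_group[OF h] unfolding C.normalizes_def[OF P_subring] by blast
    show ?thesis by (rule key[OF m[OF x h'] x e(1)]) (unfold Phi_mult[OF c[OF x] c[OF h']], rule e(2))
  qed
  show "\<exists>d\<in>EUm r. x \<otimes>\<^bsub>G\<^esub> y = d \<otimes>\<^bsub>G\<^esub> (y \<otimes>\<^bsub>G\<^esub> x)" if y: "y \<in> SUm r" for y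
  proof -
    obtain e where e: "e \<in> C.root_group P" "Phi x * Phi y = e * (Phi y * Phi x)"
      using suslin_monoid_comm[OF comm SUm_suslin_monoid[OF x] SUm_suslin_monoid[OF y]] unfolding C.comm_def[OF P_subring] by blast
    show ?thesis
      by (rule key[OF m[OF x y] m[OF y x] e(1)])
        (unfold Phi_mult[OF c[OF x] c[OF y]] Phi_mult[OF c[OF y] c[OF x]], rule e(2))
  qed
qed

end

section \<open>Local rings\<close>

lemma class_ideal_iff:
  fixes J :: "'a::comm_ring_1 set"
  shows "ideal J (class_ring :: 'a ring) \<longleftrightarrow>
    0 \<in> J \<and> (\<forall>x\<in>J. \<forall>y\<in>J. x + y \<in> J) \<and> (\<forall>x\<in>J. \<forall>c. c * x \<in> J)"
proof
  assume "ideal J (class_ring :: 'a ring)"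
  then interpret ideal J "class_ring :: 'a ring" .
  show "0 \<in> J \<and> (\<forall>x\<in>J. \<forall>y\<in>J. x + y \<in> J) \<and> (\<forall>x\<in>J. \<forall>c. c * x \<in> J)"
    using zero_closed a_closed I_l_closed by auto
next
  assume J: "0 \<in> J \<and> (\<forall>x\<in>J. \<forall>y\<in>J. x + y \<in> J) \<and> (\<forall>x\<in>J. \<forall>c. c * x \<in> J)"
  have inv: "inv\<^bsub>add_monoid (class_ring :: 'a ring)\<^esub> x = - x" for x
  proof -
    have "inv\<^bsub>add_monoid (class_ring :: 'a ring)\<^esub> x = a_inv (class_ring :: 'a ring) x" by (simp only: a_inv_def)
    also have "\<dots> = - x" by (simp only: class_ring_simps)
    finally show ?thesis .
  qed
  have neg: "- x \<in> J" if "x \<in> J" for x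
  proof -
    have "- 1 * x \<in> J" using J that by blast
    then show ?thesis by simp
  qed
  have "subgroup J (add_monoid (class_ring :: 'a ring))"
  proof
    show "inv\<^bsub>add_monoid (class_ring :: 'a ring)\<^esub> x \<in> J" if "x \<in> J" for x unfolding inv using neg[OF that] .
  qed (use J in auto)
  then show "ideal J (class_ring :: 'a ring)"
    using J by (intro idealI class_ring.ring_axioms) (auto simp: mult.commute)
qed

text \<open>Krull's argument: Zorn's lemma for the ideals that contain \<open>x\<close> but not
  1.\<close>

lemma nonunit_in_maximalideal:
  fixes x :: "'a::comm_ring_1"
  assumes "\<not> x dvd 1"
  shows "\<exists>M. maximalideal M (class_ring :: 'a ring) \<and> x \<in> M"
proof -
  let ?A = "{J. ideal J (class_ring :: 'a ring) \<and> x \<in> J \<and> 1 \<notin> J}"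
  have "range (\<lambda>c. c * x) \<in> ?A"
  proof -
    have "1 \<notin> range (\<lambda>c. c * x)" using assms by (auto simp: dvd_def mult.commute)
    moreover have "x \<in> range (\<lambda>c. c * x)" using rangeI[of "\<lambda>c. c * x" 1] by simp
    moreover have "0 \<in> range (\<lambda>c. c * x)" using rangeI[of "\<lambda>c. c * x" 0] by simp
    moreover have "a * x + b * x \<in> range (\<lambda>c. c * x)" for a b using rangeI[of "\<lambda>c. c * x" "a + b"] by (simp add: distrib_right)
    moreover have "b * (a * x) \<in> range (\<lambda>c. c * x)" for a b using rangeI[of "\<lambda>c. c * x" "b * a"] by (simp only: mult.assoc)
    ultimately show ?thesis unfolding class_ideal_iff by blast
  qed
  moreover have "\<Union>C \<in> ?A" if C: "C \<noteq> {}" "subset.chain ?A C" for C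
  proof -
    have CA: "C \<subseteq> ?A" and ch: "\<And>J K. J \<in> C \<Longrightarrow> K \<in> C \<Longrightarrow> J \<subseteq> K \<or> K \<subseteq> J"
      using C(2) unfolding subset_chain_def by blast+
    have i: "0 \<in> J" "a \<in> J \<Longrightarrow> b \<in> J \<Longrightarrow> a + b \<in> J" "a \<in> J \<Longrightarrow> c * a \<in> J" "x \<in> J" "1 \<notin> J"
      if "J \<in> C" for J a b c using subsetD[OF CA that] unfolding class_ideal_iff by blast+
    have "a + b \<in> \<Union>C" if ab: "a \<in> \<Union>C" "b \<in> \<Union>C" for a b
    proof -
      obtain J K where JK: "a \<in> J" "J \<in> C" "b \<in> K" "K \<in> C" using ab by blast
      from ch[OF JK(2,4)] show ?thesis
      proof
        assume "J \<subseteq> K" then show ?thesis using i(2)[OF JK(4), of a b] JK by blast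
      next
        assume "K \<subseteq> J" then show ?thesis using i(2)[OF JK(2), of a b] JK by blast
      qed
    qed
    moreover have "c * a \<in> \<Union>C" if a: "a \<in> \<Union>C" for a c
    proof -
      obtain J where "a \<in> J" "J \<in> C" using a by blast
      then show ?thesis using i(3)[of J a c] by blast
    qed
    moreover obtain J where J: "J \<in> C" using C(1) by blast
    moreover have "0 \<in> \<Union>C" "x \<in> \<Union>C" using i(1,4)[OF J] J by blast+
    moreover have "1 \<notin> \<Union>C" using i(5) by blast
    ultimately show ?thesis unfolding class_ideal_iff by blast
  qed
  ultimately have "\<exists>M\<in>?A. \<forall>X\<in>?A. M \<subseteq> X \<longrightarrow> X = M"
    by (intro subset_Zorn_nonempty) blast+
  then obtain M where M: "ideal M (class_ring :: 'a ring)" "x \<in> M" "1 \<notin> M"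
    and max: "\<And>X. ideal X (class_ring :: 'a ring) \<Longrightarrow> x \<in> X \<Longrightarrow> 1 \<notin> X \<Longrightarrow> M \<subseteq> X \<Longrightarrow> X = M"
    by blast
  have "maximalideal M (class_ring :: 'a ring)"
  proof (rule maximalidealI[OF M(1)])
    show "carrier (class_ring :: 'a ring) \<noteq> M" using M(3) by auto
    fix J assume J: "ideal J (class_ring :: 'a ring)" "M \<subseteq> J"
    show "J = M \<or> J = carrier (class_ring :: 'a ring)"
    proof (cases "1 \<in> J")
      case True
      then have "c * 1 \<in> J" for c using J(1) unfolding class_ideal_iff by blast
      then show ?thesis by auto
    next
      case False
      then show ?thesis using max[OF J(1) subsetD[OF J(2) M(2)] False J(2)] by blast
    qed
  qed
  then show ?thesis using M(2) by blast
qed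

lemma local_ring_add:
  fixes x y :: "'a::comm_ring_1"
  assumes R: "local_ring TYPE('a)" and xy: "x + y dvd 1"
  shows "x dvd 1 \<or> y dvd 1"
proof (rule ccontr)
  assume "\<not> ?thesis"
  then obtain M N where M: "maximalideal M (class_ring :: 'a ring)" "x \<in> M"
    and N: "maximalideal N (class_ring :: 'a ring)" "y \<in> N" using nonunit_in_maximalideal by metis
  have "M = N" using R M(1) N(1) unfolding local_ring_def by blast
  interpret maximalideal M "class_ring :: 'a ring" by (rule M(1))
  have i: "ideal M (class_ring :: 'a ring)" by (rule is_ideal)
  then have "x + y \<in> M" using M(2) N(2) \<open>M = N\<close> unfolding class_ideal_iff by blast
  moreover obtain z where z: "1 = (x + y) * z" using xy by (auto simp: dvd_def)
  ultimately have "z * (x + y) \<in> M" using i unfolding class_ideal_iff by blast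
  then have "1 \<in> M" unfolding z mult.commute[of z] .
  then have "c * 1 \<in> M" for c using i unfolding class_ideal_iff by blast
  then show False using I_notcarr by auto
qed

lemma local_ring_sum:
  fixes f :: "nat \<Rightarrow> 'a::comm_ring_1"
  assumes R: "local_ring TYPE('a)" and "sum f {..<m} dvd 1"
  shows "\<exists>i<m. f i dvd 1"
  using assms(2)
proof (induction m)
  case 0 then show ?case by (simp add: dvd_def)
next
  case (Suc m)
  then have "sum f {..<m} dvd 1 \<or> f m dvd 1" by (intro local_ring_add[OF R]) simp
  then show ?case using Suc.IH less_Suc_eq by auto
qed

text \<open>Turns a congruence between two values of the deformation parameter into one between all
  entries of the deformed vectors.\<close>

lemma pcompose_diff_dvd:
  fixes f p q :: "'a::comm_ring_1 poly"
  shows "p - q dvd f \<circ>\<^sub>p p - f \<circ>\<^sub>p q"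
proof (induction f)
  case (pCons a f)
  have "pCons a f \<circ>\<^sub>p p - pCons a f \<circ>\<^sub>p q = p * (f \<circ>\<^sub>p p - f \<circ>\<^sub>p q) + (p - q) * (f \<circ>\<^sub>p q)"
    by (simp add: pcompose_pCons algebra_simps)
  then show ?case using pCons by (simp add: dvd_add)
qed simp

interpretation fps_of_poly: inj_comm_ring_hom "fps_of_poly :: 'a::comm_ring_1 poly \<Rightarrow> 'a fps"
  by unfold_locales (auto simp: fps_of_poly_add fps_of_poly_mult fps_of_poly_eq_iff fps_eq_iff poly_eq_iff)

lemma fps_of_poly_invertible:
  fixes p :: "'a::comm_ring_1 poly"
  assumes "coeff p 0 dvd 1" shows "\<exists>b. fps_of_poly p * b = 1"
proof -
  obtain y where "1 = coeff p 0 * y" using assms by (auto simp: dvd_def)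
  then have "fps_nth (fps_of_poly p) 0 * y = 1" by simp
  from fps_right_inverse[OF this] show ?thesis by blast
qed

text \<open>The radical of \<open>J\<close> is an ideal and contains a comaximal family, hence 1;
  and 1 is its own power.\<close>

lemma one_in_ideal:
  fixes J :: "'a::comm_ring_1 set" and m :: nat
  assumes J: "0 \<in> J" "\<And>x y. x \<in> J \<Longrightarrow> y \<in> J \<Longrightarrow> x + y \<in> J" "\<And>x c. x \<in> J \<Longrightarrow> c * x \<in> J"
    and a: "\<exists>k. a ^ k \<in> J" and b: "\<And>i. i < m \<Longrightarrow> \<exists>k. b i ^ k \<in> J" and 1: "\<exists>u. (\<Sum>i<m. b i * c i) + a * u = 1"
  shows "1 \<in> J"
proof -
  define R where "R = {x. \<exists>k. x ^ k \<in> J}"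
  have Rm: "c * x \<in> R" if "x \<in> R" for x c
    using that J(3) by (auto simp: R_def power_mult_distrib)
  have Ra: "x + y \<in> R" if x: "x \<in> R" and y: "y \<in> R" for x y
  proof -
    obtain k l where kl: "x ^ k \<in> J" "y ^ l \<in> J" using x y by (auto simp: R_def)
    have s: "sum f A \<in> J" if "\<And>i. i \<in> A \<Longrightarrow> f i \<in> J" "finite A" for f :: "nat \<Rightarrow> 'a" and A
      using that(2,1) by (induction A) (auto intro: J)
    \<comment> \<open>In each binomial term either the exponent of \<open>x\<close> is at least
      \<open>k\<close> or that of \<open>y\<close> is at least \<open>l\<close>.\<close>
    have "of_nat (k + l choose i) * x ^ i * y ^ (k + l - i) \<in> J" for i
    proof (cases "k \<le> i")
      case True
      then have "x ^ i = x ^ (i - k) * x ^ k" by (simp add: power_add[symmetric])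
      then have "of_nat (k + l choose i) * x ^ i * y ^ (k + l - i)
        = (of_nat (k + l choose i) * x ^ (i - k) * y ^ (k + l - i)) * x ^ k"
        by (simp add: algebra_simps)
      then show ?thesis using J(3) kl by simp
    next
      case False
      then have "k + l - i = (k - i) + l" by simp
      then have "of_nat (k + l choose i) * x ^ i * y ^ (k + l - i)
        = (of_nat (k + l choose i) * x ^ i * y ^ (k - i)) * y ^ l"
        by (simp add: power_add algebra_simps)
      then show ?thesis using J(3) kl by simp
    qed
    then have "(x + y) ^ (k + l) \<in> J" unfolding binomial_ring by (intro s) auto
    then show ?thesis by (auto simp: R_def)
  qed
  have "(0 :: 'a) ^ 1 \<in> J" using J(1) by simp
  then have R0: "0 \<in> R" unfolding R_def by blast
  have "(\<Sum>i<k. b i * c i) \<in> R" if "k \<le> m" for k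
    using that
  proof (induction k)
    case (Suc k)
    have "b k \<in> R" using b[of k] Suc.prems by (simp add: R_def)
    then show ?case using Suc Rm[of "b k" "c k"] by (auto simp: mult.commute intro!: Ra)
  qed (simp add: R0)
  moreover have "a \<in> R" using a by (simp add: R_def)
  ultimately have "1 \<in> R" using 1 Ra Rm by (metis mult.commute order_refl)
  then show ?thesis by (simp add: R_def)
qed

section \<open>Commutativity over polynomial rings\<close>

locale local_poly = suslin_rep "fps_of_poly :: 'a::comm_ring_1 poly \<Rightarrow> 'a fps" r for r +
  assumes local: "local_ring TYPE('a)" and two: "(2 :: 'a) dvd 1"
begin

definition commutes :: "'a fps lin \<Rightarrow> 'a fps lin \<Rightarrow> bool" where "commutes = C.comm P"

abbreviation const_unit :: "'a poly \<Rightarrow> bool" where "const_unit p \<equiv> coeff p 0 dvd 1"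

lemma qform_N: "qform x = (\<Sum>i<N. x i * x (i + N))"
  unfolding N_def by (rule qform_sum)

lemma unit_entry:
  assumes "qform x = 1" shows "\<exists>i<N. const_unit (x i)"
proof -
  have "(\<Sum>i<N. coeff (x i) 0 * coeff (x (i + N)) 0) = coeff (qform x) 0"
    unfolding qform_N by (simp add: coeff_sum coeff_mult)
  then have "(\<Sum>i<N. coeff (x i) 0 * coeff (x (i + N)) 0) dvd 1" using assms by simp
  then show ?thesis using local_ring_sum[OF local] dvd_mult_left by blast
qed

lemma row_op_0: "0 < i \<Longrightarrow> row_op 0 u i x 0 = x 0 + u * x i"
  by (simp add: row_op_def)

text \<open>Some \<open>x i\<close> has unit constant term. It is the difference of
  \<open>x 0 + x i\<close> and \<open>x 0\<close>, and in a local ring one of these must then have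
  unit constant term as well.\<close>

lemma const_unit_row_op:
  assumes "qform x = 1" "\<not> const_unit (x 0)"
  shows "\<exists>i. 0 < i \<and> i < N \<and> const_unit (row_op 0 1 i x 0)"
proof -
  obtain i where i: "i < N" "const_unit (x i)" using unit_entry[OF assms(1)] by blast
  then have i0: "0 < i" using assms(2) by (cases i) auto
  have "coeff (x i) 0 = coeff (x 0 + 1 * x i) 0 + - coeff (x 0) 0" by simp
  then have "const_unit (x 0 + 1 * x i) \<or> - coeff (x 0) 0 dvd 1" 
    using i(2) local_ring_add[OF local, of "coeff (x 0 + 1 * x i) 0" "- coeff (x 0) 0"] by simp
  moreover have "\<not> - coeff (x 0) 0 dvd 1" using assms(2) by simp
  ultimately have "const_unit (row_op 0 1 i x 0)" unfolding row_op_0[OF i0] by blast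
  then show ?thesis using i i0 by blast
qed

text \<open>A constant entry with unit constant term is a unit of R[X] itself, so the word of
  \<open>unit_vector_root_group\<close> has its coefficients in \<open>P\<close>.\<close>

lemma suslin_op_const:
  assumes qform: "qform x = 1" and c: "\<And>i. x i = [:c i:]"
  shows "suslin_op x \<in> C.root_group P"
proof -
  have *: "suslin_op y \<in> C.root_group P" if "qform y = 1" "y 0 = [:d:]" "d dvd 1" for y d
  proof -
    obtain e where e: "1 = d * e" using \<open>d dvd 1\<close> by (auto simp: dvd_def)
    have "y 0 * [:e:] = 1" unfolding that(2) using e by (simp add: one_pCons mult.commute)
    then show ?thesis by (rule suslin_op_root_group_unit[OF that(1)])
  qed
  show ?thesis
  proof (cases "const_unit (x 0)")
    case True
    then show ?thesis using *[OF qform c[of 0]] c[of 0] by simp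
  next
    case False
    then obtain i where i: "0 < i" "i < N" "const_unit (row_op 0 1 i x 0)" using const_unit_row_op[OF qform] by blast
    have N: "0 < N" "i \<noteq> 0" using i by auto
    have r: "row_op 0 1 i x 0 = [:c 0 + c i:]" unfolding row_op_0[OF i(1)] c by simp
    have "suslin_op (row_op 0 1 i x) \<in> C.root_group P"
      by (rule *[OF qform_row_op[OF N(1) i(2) N(2) qform] r]) (use i(3) r in simp)
    then show ?thesis by (rule row_op_root_group[OF N(1) i(2) N(2)])
  qed
qed

definition suslin_inv :: "(nat \<Rightarrow> 'a poly) \<Rightarrow> 'a fps lin" where "suslin_inv x = suslin_op (flip' x)"

lemma suslin_inv: "qform x = 1 \<Longrightarrow> suslin_op x * suslin_inv x = 1" "qform x = 1 \<Longrightarrow> suslin_inv x * suslin_op x = 1"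
  using suslin_op_inverse[of x] Phi_unit(2)[of x] by (simp_all add: suslin_inv_def suslin_op_def C_S suslin_mat'_eq_suslin_mat[symmetric] lin_smul)

lemma normalizes_suslin_inv: "qform x = 1 \<Longrightarrow> C.normalizes P (suslin_inv x)"
  unfolding suslin_inv_def by (rule suslin_op_normalizes) (simp add: qform_flip')

text \<open>The inverse of \<open>t 0\<close> as a power series enters only here; hypothesis and
  conclusion speak of polynomial coefficients.\<close>

lemma dilation_poly:
  assumes t: "qform t = 1" "const_unit (t 0)"
  shows "\<exists>k. \<forall>s s'. qform s = 1 \<longrightarrow> qform s' = 1 \<longrightarrow> (\<forall>i. t 0 ^ k dvd s i - s' i) \<longrightarrow> commutes (suslin_inv s' * suslin_op s) (suslin_op t)"
proof -
  obtain b where b: "fps_of_poly (t 0) * b = 1" using fps_of_poly_invertible[OF t(2)] by blast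
  have "C.unit_vector (\<lambda>i. fps_of_poly (t i))" unfolding unit_vector_iff by (rule t(1))
  from C.dilation[OF P_subring this P_I b] obtain k where k: "\<forall>s s'. C.unit_vector s \<longrightarrow> C.unit_vector s' \<longrightarrow>
      (\<forall>i<2 * N. s i \<in> P \<and> s' i \<in> P \<and> s i - s' i \<in> pow_mult P (fps_of_poly (t 0)) k)
      \<longrightarrow> (\<exists>e\<in>C.root_group P. C.S' s' * C.S s * C.S (\<lambda>i. fps_of_poly (t i)) = e * (C.S (\<lambda>i. fps_of_poly (t i)) * (C.S' s' * C.S s)))"
    by (rule exE)
  show ?thesis
  proof (intro exI[of _ k] allI impI)
    fix s s' assume s: "qform s = 1" "qform s' = 1" "\<forall>i. t 0 ^ k dvd s i - s' i"
    have "fps_of_poly (s i) - fps_of_poly (s' i) \<in> pow_mult P (fps_of_poly (t 0)) k" for i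
    proof -
      obtain d where d: "s i - s' i = t 0 ^ k * d" using s(3) by (auto simp: dvd_def)
      have "fps_of_poly (s i) - fps_of_poly (s' i) = fps_of_poly (s i - s' i)" by (rule fps_of_poly_diff[symmetric])
      also have "\<dots> = fps_of_poly (t 0) ^ k * fps_of_poly d" unfolding d fps_of_poly_mult fps_of_poly_power ..
      finally have eq: "fps_of_poly (s i) - fps_of_poly (s' i) = fps_of_poly (t 0) ^ k * fps_of_poly d" .
      show ?thesis unfolding eq by (rule pow_multI[OF P_I])
    qed
    then have "\<exists>e\<in>C.root_group P. C.S' (\<lambda>i. fps_of_poly (s' i)) * C.S (\<lambda>i. fps_of_poly (s i)) * C.S (\<lambda>i. fps_of_poly (t i))
       = e * (C.S (\<lambda>i. fps_of_poly (t i)) * (C.S' (\<lambda>i. fps_of_poly (s' i)) * C.S (\<lambda>i. fps_of_poly (s i))))"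
      by (intro k[rule_format] conjI) (simp_all only: unit_vector_iff s(1,2) P_I)
    moreover have "C.S' (\<lambda>i. fps_of_poly (s' i)) = suslin_inv s'" unfolding suslin_inv_def suslin_op_def C_S suslin_mat'_eq_suslin_mat ..
    ultimately show "commutes (suslin_inv s' * suslin_op s) (suslin_op t)" unfolding commutes_def C.comm_def[OF P_subring] suslin_op_def by simp
  qed
qed

text \<open>The sum of the two candidates is \<open>2 * p\<close>, whose constant term is a
  unit.\<close>

lemma const_unit_add_or_diff:
  assumes "const_unit p" shows "const_unit (p + 1 * p') \<or> const_unit (p + - 1 * p')"
proof (rule local_ring_add[OF local])
  have "coeff (p + 1 * p') 0 + coeff (p + - 1 * p') 0 = 2 * coeff p 0"
    by (simp only: coeff_add coeff_minus mult_1 mult_minus_left) (simp only: mult_2 add_ac right_minus add_0_left add_0_right minus_add_cancel add_minus_cancel)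
  also have "\<dots> dvd 1 * 1" by (rule mult_dvd_mono[OF two assms])
  finally show "coeff (p + 1 * p') 0 + coeff (p + - 1 * p') 0 dvd 1" by (simp only: mult_1)
qed

text \<open>The substitution of \<open>X * d\<close> for \<open>X\<close>: \<open>d = 1\<close>
  gives \<open>s\<close> back and \<open>d = 0\<close> its constant terms.\<close>

definition shift :: "(nat \<Rightarrow> 'a poly) \<Rightarrow> 'a poly \<Rightarrow> nat \<Rightarrow> 'a poly" where
  "shift s d i = s i \<circ>\<^sub>p ([:0, 1:] * d)"

lemma qform_shift: "qform s = 1 \<Longrightarrow> qform (shift s d) = 1"
proof -
  have "qform (shift s d) = qform s \<circ>\<^sub>p ([:0, 1:] * d)"
    unfolding qform_N shift_def by (simp add: pcompose_sum pcompose_mult)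
  then show "qform s = 1 \<Longrightarrow> qform (shift s d) = 1" by (simp add: pcompose_1)
qed

lemma comm_row_op:
  assumes t: "qform t = 1" and i: "0 < i" "i < N" and x: "C.normalizes P x" and c: "commutes x (suslin_op (row_op 0 u i t))"
  shows "commutes x (suslin_op t)"
proof -
  have N: "0 < N" "i \<noteq> 0" using i by auto
  have ut: "C.unit_vector (\<lambda>j. fps_of_poly (t j))" using t by (simp add: unit_vector_iff)
  show ?thesis
    using C.comm_transvect[OF P_subring x row_op(2,3)[OF N(1) i(2) N(2)] P_I ut P_I, of u] c
    unfolding row_op(1)[OF N(1) i(2) N(2)] commutes_def suslin_op_def by blast
qed

text \<open>The inverse of \<open>S s\<close> appears because the increments of \<open>d\<close>
  from 0 to 1 telescope to the inverse of \<open>S s\<close> times \<open>S (s(0))\<close>, whose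
  second factor is then removed as an element of the root group.\<close>

lemma comm_suslin_inv_unit:
  assumes t: "qform t = 1" "const_unit (t 0)" and s: "qform s = 1"
  shows "commutes (suslin_inv s) (suslin_op t)"
proof -
  \<comment> \<open>The quantifier over \<open>e\<close> makes \<open>J\<close> closed under
    multiples, and the one over \<open>d\<close> allows increments to be performed one after the
    other, which gives closure under sums.\<close>
  define J where "J = {c. \<forall>d e. commutes (suslin_inv (shift s (d + c * e)) * suslin_op (shift s d)) (suslin_op t)}"
  have nrm: "C.normalizes P (suslin_inv (shift s d) * suslin_op (shift s d'))" for d d'
    by (rule C.normalizes_mult[OF P_subring normalizes_suslin_inv[OF qform_shift[OF s]] suslin_op_normalizes[OF qform_shift[OF s]]])
  \<comment> \<open>Here \<open>t'\<close> is \<open>t\<close> itself or an elementary transform of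
    it, and \<open>tr\<close> carries commutation with \<open>t'\<close> back to \<open>t\<close>.
    In this way \<open>J\<close> receives powers of several entries although it is defined by the
    single vector \<open>t\<close>.\<close>
  have powJ: "\<exists>k. (t' 0) ^ k \<in> J"
    if t': "qform t' = 1" "const_unit (t' 0)" and tr: "\<And>x. C.normalizes P x \<Longrightarrow> commutes x (suslin_op t') \<Longrightarrow> commutes x (suslin_op t)" for t'
  proof -
    obtain k where k: "\<And>s s'. qform s = 1 \<Longrightarrow> qform s' = 1 \<Longrightarrow> \<forall>i. t' 0 ^ k dvd s i - s' i \<Longrightarrow> commutes (suslin_inv s' * suslin_op s) (suslin_op t')"
      using dilation_poly[OF t'] by blast
    have "commutes (suslin_inv (shift s (d + t' 0 ^ k * e)) * suslin_op (shift s d)) (suslin_op t)" for d e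
    proof (rule tr[OF nrm], rule k[OF qform_shift[OF s] qform_shift[OF s]], rule allI)
      fix i
      have dd: "[:0, 1:] * d - [:0, 1:] * (d + t' 0 ^ k * e) = t' 0 ^ k * (- ([:0, 1:] * e))" by (simp add: algebra_simps)
      have "t' 0 ^ k dvd [:0, 1:] * d - [:0, 1:] * (d + t' 0 ^ k * e)" unfolding dd by (rule dvd_triv_left)
      then show "t' 0 ^ k dvd shift s d i - shift s (d + t' 0 ^ k * e) i"
        unfolding shift_def by (rule dvd_trans[OF _ pcompose_diff_dvd])
    qed
    then show ?thesis by (auto simp: J_def)
  qed
  have "1 \<in> J"
  proof (rule one_in_ideal[where a = "t 0" and m = "N - 1"])
    have one: "commutes 1 (suslin_op t)" unfolding commutes_def by (rule C.comm_root_group(2)[OF P_subring suslin_op_normalizes[OF t(1)] C.root_group.one])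
    have "commutes (suslin_inv (shift s d) * suslin_op (shift s d)) (suslin_op t)" for d
      unfolding suslin_inv(2)[OF qform_shift[OF s]] by (rule one)
    then show "0 \<in> J" by (simp add: J_def)
    show "c * x \<in> J" if "x \<in> J" for x c
    proof -
      have "commutes (suslin_inv (shift s (d + c * x * e)) * suslin_op (shift s d)) (suslin_op t)" for d e
      proof -
        have eq: "d + c * x * e = d + x * (c * e)" by (simp add: algebra_simps)
        show ?thesis unfolding eq using \<open>x \<in> J\<close> unfolding J_def by blast
      qed
      then show ?thesis by (simp add: J_def)
    qed
    show "x + y \<in> J" if "x \<in> J" "y \<in> J" for x y
    proof -
      have "commutes (suslin_inv (shift s (d + (x + y) * e)) * suslin_op (shift s d)) (suslin_op t)" for d e
      proof -
        let ?m = "shift s (d + x * e)"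
        have eq: "d + (x + y) * e = (d + x * e) + y * e" by (simp add: algebra_simps)
        have "commutes (suslin_inv (shift s (d + (x + y) * e)) * suslin_op ?m) (suslin_op t)"
          unfolding eq using \<open>y \<in> J\<close> unfolding J_def by blast
        moreover have "commutes (suslin_inv ?m * suslin_op (shift s d)) (suslin_op t)" using \<open>x \<in> J\<close> unfolding J_def by blast
        ultimately have "commutes ((suslin_inv (shift s (d + (x + y) * e)) * suslin_op ?m) * (suslin_inv ?m * suslin_op (shift s d))) (suslin_op t)"
          unfolding commutes_def by (rule C.comm_mult_left[OF P_subring nrm])
        moreover have "(suslin_inv (shift s (d + (x + y) * e)) * suslin_op ?m) * (suslin_inv ?m * suslin_op (shift s d))
          = suslin_inv (shift s (d + (x + y) * e)) * (suslin_op ?m * suslin_inv ?m) * suslin_op (shift s d)" by (simp only: mult.assoc)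
        ultimately show ?thesis by (simp only: suslin_inv(1)[OF qform_shift[OF s]] mult_1_right)
      qed
      then show ?thesis by (simp add: J_def)
    qed
    show t0: "\<exists>k. t 0 ^ k \<in> J" by (rule powJ[OF t])
    \<comment> \<open>A sign for which \<open>t 0 + \<sigma> i * t (Suc i)\<close> has unit constant
      term. This is the entry 0 of an elementary transform of \<open>t\<close>, so
      \<open>powJ\<close> applies to it.\<close>
    define \<sigma> where "\<sigma> i = (if const_unit (t 0 + 1 * t (Suc i)) then 1 else - 1 :: 'a poly)" for i
    have \<sigma>\<sigma>: "\<sigma> i * \<sigma> i = 1" for i by (simp add: \<sigma>_def)
    have unit: "const_unit (t 0 + \<sigma> i * t (Suc i))" for i
    proof (cases "const_unit (t 0 + 1 * t (Suc i))")
      case True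
      then have "\<sigma> i = 1" unfolding \<sigma>_def by (rule if_P)
      then show ?thesis using True by (simp only:)
    next
      case False
      then have s: "\<sigma> i = - 1" unfolding \<sigma>_def by (rule if_not_P)
      show ?thesis unfolding s using const_unit_add_or_diff[OF t(2)] False by blast
    qed
    show "\<exists>k. (t 0 + \<sigma> i * t (Suc i)) ^ k \<in> J" if i: "i < N - 1" for i
    proof -
      have iN: "0 < Suc i" "Suc i < N" "0 < N" "Suc i \<noteq> 0" using i by auto
      have "const_unit (row_op 0 (\<sigma> i) (Suc i) t 0)" unfolding row_op_0[OF iN(1)] by (rule unit)
      then have "\<exists>k. (row_op 0 (\<sigma> i) (Suc i) t 0) ^ k \<in> J"
        by (rule powJ[OF qform_row_op[OF iN(3,2,4) t(1)] _ comm_row_op[OF t(1) iN(1,2)]])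
      then show ?thesis unfolding row_op_0[OF iN(1)] .
    qed
    \<comment> \<open>As \<open>\<sigma> i * \<sigma> i = 1\<close>, the weights
      \<open>\<sigma> i * t (Suc i + N)\<close> reproduce the terms of \<open>qform t\<close> with
      index at least 1, up to the multiple \<open>t 0 * A\<close>. The coefficient
      \<open>t (0 + N) - A\<close> of \<open>t 0\<close> corrects this.\<close>
    define A B where "A = (\<Sum>i<N - 1. \<sigma> i * t (Suc i + N))" and "B = (\<Sum>i<N - 1. t (Suc i) * t (Suc i + N))"
    have "(t 0 + \<sigma> i * t (Suc i)) * (\<sigma> i * t (Suc i + N))
       = t 0 * (\<sigma> i * t (Suc i + N)) + (\<sigma> i * \<sigma> i) * (t (Suc i) * t (Suc i + N))" for i
      by (simp only: distrib_right) (simp only: mult_ac)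
    then have AB: "(\<Sum>i<N - 1. (t 0 + \<sigma> i * t (Suc i)) * (\<sigma> i * t (Suc i + N))) = t 0 * A + B"
      unfolding \<sigma>\<sigma> A_def B_def by (simp only: sum.distrib sum_distrib_left mult_1)
    have N1: "Suc (N - 1) = N" by (simp add: N_def)
    have "(\<Sum>i<Suc (N - 1). t i * t (i + N)) = t 0 * t (0 + N) + B"
      unfolding B_def by (rule sum.lessThan_Suc_shift)
    then have "t 0 * t (0 + N) + B = 1" using t(1) unfolding N1 qform_N by (simp only:)
    moreover have "t 0 * A + B + t 0 * (t (0 + N) - A) = t 0 * t (0 + N) + B" by (simp only: right_diff_distrib) simp
    ultimately have "t 0 * A + B + t 0 * (t (0 + N) - A) = 1" by (simp only:)
    then show "\<exists>u. (\<Sum>i<N - 1. (t 0 + \<sigma> i * t (Suc i)) * (\<sigma> i * t (Suc i + N))) + t 0 * u = 1"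
      unfolding AB by blast
  qed
  then have "commutes (suslin_inv (shift s (0 + 1 * 1)) * suslin_op (shift s 0)) (suslin_op t)" unfolding J_def by blast
  moreover have "shift s (0 + 1 * 1) = s" by (auto simp: shift_def fun_eq_iff)
  ultimately have c1: "commutes (suslin_inv s * suslin_op (shift s 0)) (suslin_op t)" by simp
  have "suslin_op (shift s 0) \<in> C.root_group P"
    by (rule suslin_op_const[OF qform_shift[OF s]]) (simp add: shift_def pcompose_0')
  moreover obtain e where e: "e \<in> C.root_group P" "suslin_op (shift s 0) * e = 1"
    using C.root_group_inv[OF \<open>suslin_op (shift s 0) \<in> C.root_group P\<close>] subring_setD(5)[OF P_subring] by blast
  have c2: "commutes e (suslin_op t)" unfolding commutes_def by (rule C.comm_root_group(2)[OF P_subring suslin_op_normalizes[OF t(1)] e(1)])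
  have "C.normalizes P (suslin_inv s * suslin_op (shift s 0))"
    by (rule C.normalizes_mult[OF P_subring normalizes_suslin_inv[OF s] suslin_op_normalizes[OF qform_shift[OF s]]])
  then have "commutes (suslin_inv s * suslin_op (shift s 0) * e) (suslin_op t)" using c1 c2 unfolding commutes_def by (rule C.comm_mult_left[OF P_subring])
  moreover have "suslin_inv s * suslin_op (shift s 0) * e = suslin_inv s" unfolding mult.assoc e(2) by simp
  ultimately show ?thesis by simp
qed

text \<open>Two reductions: \<open>S s\<close> is the inverse belonging to the flipped vector, and
  if \<open>t 0\<close> has no unit constant term, an elementary operation provides one without
  affecting commutation modulo the root group.\<close>

lemma comm_suslin_op:
  assumes s: "qform s = 1" and t: "qform t = 1" shows "C.comm P (suslin_op s) (suslin_op t)"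
proof -
  have i: "suslin_inv (flip' s) = suslin_op s" unfolding suslin_inv_def suslin_op_def C_S flip'_flip' ..
  have f: "qform (flip' s) = 1" using s by (simp add: qform_flip')
  have "commutes (suslin_inv (flip' s)) (suslin_op t)"
  proof (cases "const_unit (t 0)")
    case True show ?thesis by (rule comm_suslin_inv_unit[OF t True f])
  next
    case False
    then obtain j where j: "0 < j" "j < N" "const_unit (row_op 0 1 j t 0)" using const_unit_row_op[OF t] by blast
    have qj: "qform (row_op 0 1 j t) = 1" by (rule qform_row_op[OF _ j(2) _ t]) (use j in auto)
    have "commutes (suslin_inv (flip' s)) (suslin_op (row_op 0 1 j t))" by (rule comm_suslin_inv_unit[OF qj j(3) f])
    then show ?thesis by (rule comm_row_op[OF t j(1,2) normalizes_suslin_inv[OF f]])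
  qed
  then show ?thesis unfolding i commutes_def .
qed

end

theorem theorem5p4:
  fixes r :: nat
  assumes "local_ring TYPE('a :: comm_ring_1)"
    and "(2 :: 'a) dvd 1"
    and "r \<ge> 2"
  shows "comm_group ((GL (2 ^ r))\<lparr>carrier := SUm r\<rparr> Mod (EUm r :: 'a poly mat set))"
proof -
  interpret local_poly r by unfold_locales (rule assms)+
  obtain k :: 'a where k: "1 = 2 * k" using assms(2) by (auto simp: dvd_def)
  have "k + k = 1" unfolding k by (rule mult_2[symmetric])
  then have "[:k:] + [:k:] = 1" by (simp add: one_pCons)
  then show ?thesis by (rule comm_group_quotient[OF _ comm_suslin_op])
qed

end
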